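(* Let each of $f,g$ be either the logarithm function or a power function $t\mapsto t^\gamma$ with positive exponent, defined on $]0,\infty[$. Let $\mathcal A,\mathcal B$ be unital $C^*$-algebras and let $\phi:\mathcal A_+^{-1}\to\mathcal B_+^{-1}$ be a surjective positive homogeneous map such that for all $A,B\in\mathcal A_+^{-1}$: $f(A)\le f(B)$ if and only if $g(\phi(A))\le g(\phi(B))$. Then: (c1) if $f,g$ are both power functions and $f=g$, then $\phi(A)=f^{-1}(CJ(f(A))C)$ for all $A\in\mathcal A_+^{-1}$, with some $C\in\mathcal B_+^{-1}$ and a Jordan *-isomorphism $J:\mathcal A\to\mathcal B$; (c2) if $f,g$ are both power functions and $f\ne g$, then $\mathcal A,\mathcal B$ are commutative and $\phi(A)=CJ(A)$ for all $A\in\mathcal A_+^{-1}$, with some $C\in\mathcal B_+^{-1}$ and an algebra *-isomorphism $J:\mathcal A\to\mathcal B$; (c3) if $f=g=\log$, then $\phi(A)=\exp(J(\log A)+X_0)$ for all $A\in\mathcal A_+^{-1}$, with a Jordan *-isomorphism $J:\mathcal A\to\mathcal B$ and a self-adjoint $X_0\in\mathcal B$; (c4) if $f$ is a power function and $g=\log$, then $\mathcal A,\mathcal B$ are commutative and $\phi(A)=CJ(A)$ for all $A\in\mathcal A_+^{-1}$, with some $C\in\mathcal B_+^{-1}$ and an algebra *-isomorphism $J:\mathcal A\to\mathcal B$.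
   Context: $\mathcal A_+^{-1}$ denotes the set of positive invertible elements; $f(A)$ etc. are defined by continuous functional calculus and $\le$ is the usual order of self-adjoint elements. $\phi$ is positive homogeneous if $\phi(tA)=t\phi(A)$ for all $A$ and all real $t>0$. A Jordan *-isomorphism $J:\mathcal A\to\mathcal B$ is a linear bijection with $J(XY+YX)=J(X)J(Y)+J(Y)J(X)$ and $J(X^* )=J(X)^*$. *)

theory Defs
  imports "HOL-Analysis.Analysis" "HOL-Computational_Algebra.Polynomial"
begin

class cstar_algebra = real_normed_algebra_1 + banach +
  fixes cscale :: "complex \<Rightarrow> 'a \<Rightarrow> 'a"
    and cstar :: "'a \<Rightarrow> 'a"
  assumes cscale_of_real: "cscale (complex_of_real r) x = r *\<^sub>R x"
    and cscale_add_left: "cscale (a + b) x = cscale a x + cscale b x"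
    and cscale_add_right: "cscale a (x + y) = cscale a x + cscale a y"
    and cscale_assoc: "cscale a (cscale b x) = cscale (a * b) x"
    and cscale_mult_left: "cscale a x * y = cscale a (x * y)"
    and cscale_mult_right: "x * cscale a y = cscale a (x * y)"
    and norm_cscale: "norm (cscale a x) = cmod a * norm x"
    and cstar_cstar: "cstar (cstar x) = x"
    and cstar_add: "cstar (x + y) = cstar x + cstar y"
    and cstar_mult: "cstar (x * y) = cstar y * cstar x"
    and cstar_cscale: "cstar (cscale a x) = cscale (cnj a) (cstar x)"
    and cstar_identity: "norm (cstar x * x) = norm x ^ 2"

definition selfadj :: "'a::cstar_algebra \<Rightarrow> bool" where
  "selfadj x \<longleftrightarrow> cstar x = x"

definition invertible_el :: "'a::cstar_algebra \<Rightarrow> bool" where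
  "invertible_el x \<longleftrightarrow> (\<exists>y. x * y = 1 \<and> y * x = 1)"

text \<open>Real part of the spectrum; for self-adjoint elements this is the whole spectrum.\<close>
definition rspec :: "'a::cstar_algebra \<Rightarrow> real set" where
  "rspec x = {t. \<not> invertible_el (x - of_real t)}"

definition positive_el :: "'a::cstar_algebra \<Rightarrow> bool" where
  "positive_el x \<longleftrightarrow> selfadj x \<and> rspec x \<subseteq> {0..}"

definition cle :: "'a::cstar_algebra \<Rightarrow> 'a \<Rightarrow> bool" where
  "cle x y \<longleftrightarrow> selfadj x \<and> selfadj y \<and> positive_el (y - x)"

definition pos_inv :: "'a::cstar_algebra \<Rightarrow> bool" where
  "pos_inv x \<longleftrightarrow> positive_el x \<and> invertible_el x"

definition peval :: "real poly \<Rightarrow> 'a::cstar_algebra \<Rightarrow> 'a" where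
  "peval p x = (\<Sum>i\<le>degree p. coeff p i *\<^sub>R x ^ i)"

text \<open>Continuous functional calculus for self-adjoint elements: f(x) is the limit of
  p(x) for real polynomials p approximating f uniformly on the spectrum of x.\<close>
definition cfc :: "(real \<Rightarrow> real) \<Rightarrow> 'a::cstar_algebra \<Rightarrow> 'a" where
  "cfc f x = (THE y. \<forall>e>0. \<exists>p. (\<forall>t\<in>rspec x. \<bar>f t - poly p t\<bar> \<le> e)
                               \<and> norm (y - peval p x) \<le> e)"

definition clinear_map :: "('a::cstar_algebra \<Rightarrow> 'b::cstar_algebra) \<Rightarrow> bool" where
  "clinear_map J \<longleftrightarrow> (\<forall>x y. J (x + y) = J x + J y) \<and> (\<forall>c x. J (cscale c x) = cscale c (J x))"

definition jordan_star_iso :: "('a::cstar_algebra \<Rightarrow> 'b::cstar_algebra) \<Rightarrow> bool" where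
  "jordan_star_iso J \<longleftrightarrow> clinear_map J \<and> bij J
     \<and> (\<forall>x y. J (x * y + y * x) = J x * J y + J y * J x)
     \<and> (\<forall>x. J (cstar x) = cstar (J x))"

definition algebra_star_iso :: "('a::cstar_algebra \<Rightarrow> 'b::cstar_algebra) \<Rightarrow> bool" where
  "algebra_star_iso J \<longleftrightarrow> clinear_map J \<and> bij J
     \<and> (\<forall>x y. J (x * y) = J x * J y)
     \<and> (\<forall>x. J (cstar x) = cstar (J x))"

definition commutative_alg :: "'a::cstar_algebra itself \<Rightarrow> bool" where
  "commutative_alg _ \<longleftrightarrow> (\<forall>x y :: 'a. x * y = y * x)"

definition is_power_fun :: "(real \<Rightarrow> real) \<Rightarrow> bool" where
  "is_power_fun f \<longleftrightarrow> (\<exists>\<gamma>>0. \<forall>t>0. f t = t powr \<gamma>)"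

definition is_log_fun :: "(real \<Rightarrow> real) \<Rightarrow> bool" where
  "is_log_fun f \<longleftrightarrow> (\<forall>t>0. f t = ln t)"

end

theory Submission
  imports Defs "HOL-Computational_Algebra.Fundamental_Theorem_Algebra"
begin

text \<open>
  In logarithmic coordinates \<open>A = exp x\<close> the map becomes a bijection between self-adjoint parts that
  commutes with adding scalars and carries the order \<open>exp (\<alpha> x) \<le> exp (\<alpha> y)\<close> to
  \<open>exp (\<beta> x) \<le> exp (\<beta> y)\<close>, where the exponent \<open>0\<close> stands for the logarithm and the usual order. Such a
  map is an isometry of Thompson-type metrics, so a Mazur-Ulam argument shows that it preserves the
  reflections \<open>x \<mapsto> m x\<^sup>-\<^sup>1 m\<close> (in logarithmic coordinates and for exponent \<open>0\<close>: \<open>x \<mapsto> 2 m - x\<close>).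
  After normalization it therefore commutes with \<open>x \<mapsto> x / 2\<close>, and since all these orders agree
  infinitesimally at the origin, it is an order isomorphism for the usual order. A second use of the
  Mazur-Ulam argument makes it linear, and Kadison's inequality for it and its inverse makes it a Jordan
  isomorphism \<open>J\<close>. As \<open>J\<close> commutes with \<open>exp\<close>, the orders for \<open>\<alpha>\<close> and \<open>\<beta>\<close> coincide; if
  \<open>\<alpha> \<noteq> \<beta>\<close>, then \<open>exp\<close> and hence squaring are monotone, which forces commutativity.
\<close>

section \<open>C*-algebra basics\<close>

text \<open>The orders for different exponents do not agree in general, and for positive exponents
  their reflections need not be affine, so the isometry argument alone cannot produce a linear map.
  What survives is one identity: reflecting the origin through x gives x + x for every exponent,
  hence a map that fixes 0 and preserves reflections commutes with doubling. Repeated halving then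
  drags any pair to the origin, where exp (h x) = 1 + h x + o(h) erases the exponent; a slack s > 0,
  removed at the end by closedness of the positive cone, absorbs the error. The normalization
  depends on the target exponent: the usual order is invariant under adding self-adjoint elements,
  while for \<beta> > 0 it is congruence of exp (\<beta> x) that preserves the order. The former
  leads to the shift X0 in (c3), the latter to the factors C in (c1). The C*-algebraic facts start
  from the C*-identity. As only real spectra are considered, the central point is that a
  self-adjoint x has norm x or - norm x in its spectrum; positivity then becomes a norm inequality,
  and real polynomials suffice for the functional calculus.\<close>

lemma cstar_scaleR: "cstar (r *\<^sub>R x) = r *\<^sub>R cstar (x::'a::cstar_algebra)"
  using cstar_cscale[of "complex_of_real r" x] by (simp add: cscale_of_real)

lemma cstar_0 [simp]: "cstar (0::'a::cstar_algebra) = 0"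
  using cstar_scaleR[of 0 "0::'a"] by simp

lemma cstar_minus: "cstar (- x) = - cstar (x::'a::cstar_algebra)"
  using cstar_scaleR[of "-1" x] by simp

lemma cstar_diff: "cstar (x - y) = cstar x - cstar (y::'a::cstar_algebra)"
  using cstar_add[of x "-y"] by (simp add: cstar_minus)

lemma cstar_1 [simp]: "cstar (1::'a::cstar_algebra) = 1"
  by (metis cstar_cstar cstar_mult mult_1_left mult_1_right)

lemma cstar_of_real [simp]: "cstar (of_real r :: 'a::cstar_algebra) = of_real r"
  by (simp add: of_real_def cstar_scaleR)

lemma norm_cstar: "norm (cstar x) = norm (x::'a::cstar_algebra)"
proof -
  have le: "norm y \<le> norm (cstar y)" for y :: 'a
  proof (cases "y = 0")
    case False
    have "norm y * norm y \<le> norm (cstar y) * norm y"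
      using norm_mult_ineq[of "cstar y" y] by (simp add: cstar_identity power2_eq_square)
    then show ?thesis using False by simp
  qed simp
  show ?thesis using le[of x] le[of "cstar x"] by (simp add: cstar_cstar)
qed

lemma bounded_linear_cstar: "bounded_linear (cstar :: 'a::cstar_algebra \<Rightarrow> 'a)"
  by (rule bounded_linear_intro[where K = 1])
    (simp_all add: cstar_add cstar_scaleR norm_cstar)

lemmas tendsto_cstar = bounded_linear.tendsto[OF bounded_linear_cstar]

lemma selfadj_simps [simp]:
  "selfadj (0::'a::cstar_algebra)" "selfadj (1::'a)" "selfadj (of_real r :: 'a)"
  by (simp_all add: selfadj_def)

lemma selfadj_intros:
  fixes x y :: "'a::cstar_algebra"
  shows "selfadj x \<Longrightarrow> selfadj y \<Longrightarrow> selfadj (x + y)"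
    "selfadj x \<Longrightarrow> selfadj y \<Longrightarrow> selfadj (x - y)"
    "selfadj x \<Longrightarrow> selfadj (- x)"
    "selfadj x \<Longrightarrow> selfadj (r *\<^sub>R x)"
    "selfadj x \<Longrightarrow> selfadj y \<Longrightarrow> x * y = y * x \<Longrightarrow> selfadj (x * y)"
    "selfadj x \<Longrightarrow> selfadj y \<Longrightarrow> selfadj (x * y * x)"
    "selfadj x \<Longrightarrow> selfadj y \<Longrightarrow> selfadj (x * y + y * x)"
  by (simp_all add: selfadj_def cstar_add cstar_diff cstar_minus cstar_scaleR cstar_mult mult.assoc add.commute)

lemma selfadj_power: "selfadj (x::'a::cstar_algebra) \<Longrightarrow> selfadj (x ^ n)"
  by (induction n) (auto simp: selfadj_def cstar_mult power_commutes)

lemma selfadj_limit: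
  assumes "X \<longlonglongrightarrow> (x::'a::cstar_algebra)" "\<And>n. selfadj (X n)"
  shows "selfadj x"
proof -
  have "X \<longlonglongrightarrow> cstar x" using tendsto_cstar[OF assms(1)] assms(2) by (simp add: selfadj_def)
  then show ?thesis using assms(1) LIMSEQ_unique unfolding selfadj_def by blast
qed

lemma norm_square_selfadj: "selfadj (x::'a::cstar_algebra) \<Longrightarrow> norm (x * x) = (norm x)\<^sup>2"
  using cstar_identity[of x] by (simp add: selfadj_def)

lemma of_real_commute: "of_real r * x = x * (of_real r :: 'a::real_algebra_1)"
  by (simp add: of_real_def)

section \<open>Invertible elements, the real spectrum and the norm\<close>

lemma invertible_el_1 [simp]: "invertible_el (1::'a::cstar_algebra)"
  unfolding invertible_el_def by (intro exI[of _ 1]) simp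

lemma not_invertible_el_0 [simp]: "\<not> invertible_el (0::'a::cstar_algebra)"
  unfolding invertible_el_def by simp

lemma invertible_el_mult:
  fixes x y :: "'a::cstar_algebra"
  assumes "invertible_el x" "invertible_el y"
  shows "invertible_el (x * y)"
proof -
  obtain u v where "x * u = 1" "u * x = 1" "y * v = 1" "v * y = 1"
    using assms unfolding invertible_el_def by blast
  then have "x * y * (v * u) = 1" "v * u * (x * y) = 1"
    by (simp_all add: mult.assoc[of x] mult.assoc[of v] mult.assoc[symmetric, of y] mult.assoc[symmetric, of u])
  then show ?thesis unfolding invertible_el_def by blast
qed

lemma invertible_el_mult_commD:
  fixes x y :: "'a::cstar_algebra"
  assumes "invertible_el (x * y)" "x * y = y * x"
  shows "invertible_el x"
proof -
  obtain z where z: "x * y * z = 1" "z * (x * y) = 1"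
    using assms unfolding invertible_el_def by blast
  have "z * y = z * y * (x * (y * z))" using z by (simp add: mult.assoc)
  also have "\<dots> = z * (x * y) * (y * z)" using assms(2) by (simp add: mult.assoc)
  also have "\<dots> = y * z" using z by simp
  finally have zy: "z * y = y * z" .
  have "x * (y * z) = 1" using z by (simp add: mult.assoc)
  moreover have "y * z * x = 1"
    using z(2) assms(2) by (simp add: zy[symmetric] mult.assoc)
  ultimately show ?thesis unfolding invertible_el_def by blast
qed

lemma invertible_el_scaleR:
  fixes x :: "'a::cstar_algebra"
  assumes "r \<noteq> 0"
  shows "invertible_el (r *\<^sub>R x) \<longleftrightarrow> invertible_el x"
proof -
  have *: "invertible_el (r *\<^sub>R x)" if "invertible_el x" "r \<noteq> 0" for r and x :: 'a
  proof -
    obtain u where "x * u = 1" "u * x = 1" using \<open>invertible_el x\<close> unfolding invertible_el_def by blast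
    then show ?thesis
      unfolding invertible_el_def using \<open>r \<noteq> 0\<close> by (intro exI[of _ "(1/r) *\<^sub>R u"]) simp
  qed
  show ?thesis using *[of x r] *[of "r *\<^sub>R x" "1/r"] assms by auto
qed

lemma invertible_el_minus: "invertible_el (- x) \<longleftrightarrow> invertible_el (x::'a::cstar_algebra)"
  using invertible_el_scaleR[of "-1" x] by simp

lemma invertible_el_one_minus:
  fixes x :: "'a::cstar_algebra"
  assumes "norm x < 1"
  shows "invertible_el (1 - x)"
proof -
  have s: "summable (\<lambda>n. x ^ n)" using complete_algebra_summable_geometric[OF assms] .
  define S where "S = (\<Sum>n. x ^ n)"
  have sp: "(\<Sum>n. x ^ Suc n) = S - 1" using suminf_split_head[OF s] by (simp add: S_def)
  have "(\<Sum>n. x * x ^ n) = x * S" "(\<Sum>n. x ^ n * x) = S * x"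
    unfolding S_def by (rule suminf_mult[OF s], rule suminf_mult2[OF s, symmetric])
  then have "x * S = S - 1" "S * x = S - 1"
    using sp by (simp_all add: power_commutes)
  then have "(1 - x) * S = 1" "S * (1 - x) = 1" by (simp_all add: algebra_simps)
  then show ?thesis unfolding invertible_el_def by blast
qed

lemma invertible_el_of_real_minus:
  fixes x :: "'a::cstar_algebra"
  assumes "norm x < \<bar>t\<bar>"
  shows "invertible_el (x - of_real t)"
proof -
  have t: "t \<noteq> 0" using assms by (auto dest: order.strict_trans1[OF norm_ge_zero])
  have "norm ((1/t) *\<^sub>R x) < 1" using assms t by (simp add: field_simps)
  then have "invertible_el ((-t) *\<^sub>R (1 - (1/t) *\<^sub>R x))"
    using invertible_el_one_minus invertible_el_scaleR t by (metis neg_equal_0_iff_equal)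
  then show ?thesis using t by (simp add: algebra_simps of_real_def)
qed

lemma rspec_bounded: "t \<in> rspec x \<Longrightarrow> \<bar>t\<bar> \<le> norm (x::'a::cstar_algebra)"
  using invertible_el_of_real_minus[of x t] by (force simp: rspec_def)

lemma open_invertible_el: "open {x::'a::cstar_algebra. invertible_el x}"
  unfolding open_dist
proof (intro ballI, simp)
  fix x :: 'a assume "invertible_el x"
  then obtain u where u: "x * u = 1" "u * x = 1" unfolding invertible_el_def by blast
  then have u0: "u \<noteq> 0" by auto
  have "invertible_el y" if "dist y x < 1 / norm u" for y
  proof -
    have "norm (u * (x - y)) \<le> norm u * dist y x"
      using norm_mult_ineq[of u "x - y"] by (simp add: dist_norm norm_minus_commute)
    also have "\<dots> < 1" using that u0 by (simp add: field_simps)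
    finally have "invertible_el (x * (1 - u * (x - y)))"
      by (intro invertible_el_mult invertible_el_one_minus \<open>invertible_el x\<close>)
    moreover have "x * (1 - u * (x - y)) = y"
      by (simp add: right_diff_distrib u mult.assoc[symmetric])
    ultimately show ?thesis by simp
  qed
  then show "\<exists>e>0. \<forall>y. dist y x < e \<longrightarrow> invertible_el y"
    using u0 by (intro exI[of _ "1 / norm u"]) auto
qed

lemma compact_rspec: "compact (rspec (x::'a::cstar_algebra))"
proof (rule compact_eq_bounded_closed[THEN iffD2], intro conjI)
  show "bounded (rspec x)"
    unfolding bounded_iff using rspec_bounded by auto
  have "- rspec x = (\<lambda>t. x - of_real t) -` {x. invertible_el x}" by (auto simp: rspec_def)
  moreover have "open \<dots>"
    by (intro open_vimage open_invertible_el continuous_intros)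
  ultimately show "closed (rspec x)" by (simp add: closed_def)
qed

text \<open>If u inverts 1 - a b, then 1 + b u a inverts 1 - b a; the formula comes from the formal
  geometric series, b (1 + a b + ...) a = b a + b a b a + ....\<close>

lemma invertible_el_one_minus_swap:
  fixes a b :: "'a::cstar_algebra"
  assumes "invertible_el (1 - a * b)"
  shows "invertible_el (1 - b * a)"
proof -
  obtain u where u: "(1 - a * b) * u = 1" "u * (1 - a * b) = 1"
    using assms unfolding invertible_el_def by blast
  have 1: "a * b * u = u - 1" "u * (a * b) = u - 1"
    using u by (simp_all add: algebra_simps)
  have "b * a * (b * u * a) = b * (a * b * u) * a" "b * u * a * (b * a) = b * (u * (a * b)) * a"
    by (simp_all add: mult.assoc)
  then have "(1 - b * a) * (1 + b * u * a) = 1" "(1 + b * u * a) * (1 - b * a) = 1"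
    unfolding 1 by (simp_all add: algebra_simps)
  then show ?thesis unfolding invertible_el_def by blast
qed

text \<open>The square root is \<open>1 - z\<close>, where \<open>z\<close> is the fixed point of the contraction
  \<open>z \<mapsto> (y + z\<^sup>2) / 2\<close> on a ball.\<close>
lemma sqrt_one_minus_exists:
  fixes y :: "'a::cstar_algebra"
  assumes "selfadj y" "norm y < 1"
  obtains w where "selfadj w" "w * w = 1 - y" "\<And>v. v * y = y * v \<Longrightarrow> v * w = w * v" "norm (1 - w) \<le> norm y"
proof -
  \<comment> \<open>Self-adjointness and commutation with the commutant of y are closed conditions
    preserved by the iteration, so putting them into the complete set makes the fixed point inherit
    them. On the ball of radius \<open>norm y\<close> the contraction constant is
    \<open>norm y\<close> itself.\<close>
  define S where "S = {z. norm z \<le> norm y \<and> cstar z = z \<and> (\<forall>v. v * y = y * v \<longrightarrow> v * z = z * v)}"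
  define F where "F z = (1/2) *\<^sub>R (y + z * z)" for z
  have S_eq: "S = cball 0 (norm y) \<inter> {z. cstar z = z} \<inter> (\<Inter>v\<in>{v. v * y = y * v}. {z. v * z = z * v})"
    by (auto simp: S_def)
  have "closed S"
    unfolding S_eq
    by (intro closed_Int closed_cball closed_INT ballI closed_Collect_eq
        bounded_linear.continuous_on[OF bounded_linear_cstar] continuous_intros)
  then have complete: "complete S" using complete_eq_closed by blast
  have nonempty: "S \<noteq> {}" by (auto simp: S_def intro!: exI[of _ 0])
  have "\<exists>!z. z \<in> S \<and> F z = z"
  proof (rule Banach_fix[OF complete nonempty, of "norm y"])
    show "F ` S \<subseteq> S"
    proof (intro image_subsetI)
      fix z assume z: "z \<in> S"
      then have zs: "cstar z = z" unfolding S_def by blast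
      have "norm (z * z) \<le> norm z * norm z" by (rule norm_mult_ineq)
      also have "\<dots> \<le> norm y * 1" using z assms(2) by (intro mult_mono) (auto simp: S_def)
      finally have "norm (F z) \<le> norm y"
        unfolding F_def using norm_triangle_ineq[of y "z * z"] by simp
      moreover have "v * F z = F z * v" if v: "v * y = y * v" for v
      proof -
        have "v * z = z * v" using z v by (simp add: S_def)
        then have "v * (z * z) = z * z * v" by (simp add: mult.assoc[symmetric]) (simp add: mult.assoc)
        then show ?thesis unfolding F_def using v by (simp add: algebra_simps)
      qed
      moreover have "cstar (F z) = F z"
        using zs assms(1) by (simp add: F_def cstar_scaleR cstar_add cstar_mult selfadj_def)
      ultimately show "F z \<in> S"
        unfolding S_def by blast
    qed
    fix a b assume ab: "a \<in> S" "b \<in> S"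
    have "F a - F b = (1/2) *\<^sub>R (a * (a - b) + (a - b) * b)"
      unfolding F_def by (simp add: algebra_simps)
    also have "norm \<dots> \<le> (1/2) * (norm a * norm (a - b) + norm (a - b) * norm b)"
      using norm_triangle_ineq[of "a * (a - b)" "(a - b) * b"]
        norm_mult_ineq[of a "a - b"] norm_mult_ineq[of "a - b" b] by simp
    also have "\<dots> = (norm a + norm b) / 2 * norm (a - b)" by (simp add: algebra_simps)
    also have "\<dots> \<le> norm y * norm (a - b)"
      using ab by (intro mult_right_mono) (auto simp: S_def)
    finally show "dist (F a) (F b) \<le> norm y * dist a b" by (simp add: dist_norm)
  qed (use assms in auto)
  then obtain z where z: "z \<in> S" "F z = z" by blast
  have "2 *\<^sub>R z = y + z * z" using arg_cong[OF z(2), of "\<lambda>u. 2 *\<^sub>R u"] by (simp add: F_def)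
  then have "z + z = y + z * z" by (simp add: scaleR_2)
  then have "(1 - z) * (1 - z) = 1 - y" by (simp add: algebra_simps)
  moreover have "selfadj (1 - z)" "norm (1 - (1 - z)) \<le> norm y"
    using z(1) by (auto simp: S_def selfadj_def cstar_diff)
  moreover have "v * (1 - z) = (1 - z) * v" if "v * y = y * v" for v
    using z(1) that unfolding S_def by (auto simp: left_diff_distrib right_diff_distrib)
  ultimately show ?thesis
    using that[of "1 - z"] by blast
qed

text \<open>The element \<open>v = x + i q\<close> is normal with \<open>v\<^sup>* v = c\<close>, and \<open>x\<close> is its real part.\<close>
lemma norm_le_if_squares_sum:
  fixes x q :: "'a::cstar_algebra"
  assumes "selfadj x" "selfadj q" "x * q = q * x" "x * x + q * q = of_real c" "c \<ge> 0"
  shows "(norm x)\<^sup>2 \<le> c"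
proof -
  define v where "v = x + cscale \<i> q"
  have xq: "cstar x = x" "cstar q = q" using assms by (auto simp: selfadj_def)
  have cv: "cstar v = x + cscale (-\<i>) q"
    unfolding v_def by (simp add: cstar_add cstar_cscale xq)
  have "cscale (-\<i>) (q * x) + cscale \<i> (x * q) = 0"
    using cscale_add_left[of "-\<i>" \<i> "x * q"] cscale_of_real[of 0 "x * q"] assms(3) by simp
  moreover have "cscale 1 (q * q) = q * q" using cscale_of_real[of 1 "q * q"] by simp
  moreover have "cstar v * v = x * x + q * q + (cscale (-\<i>) (q * x) + cscale \<i> (x * q))"
    if "cscale 1 (q * q) = q * q"
    unfolding cv unfolding v_def using that
    by (simp add: distrib_left distrib_right cscale_mult_left cscale_mult_right cscale_assoc
        cscale_add_right)
  ultimately have "cstar v * v = x * x + q * q"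
    by simp
  then have n: "(norm v)\<^sup>2 = c"
    using cstar_identity[of v] assms(4,5) by simp
  have "cscale (-\<i>) q + cscale \<i> q = 0"
    using cscale_add_left[of "-\<i>" \<i> q] cscale_of_real[of 0 q] by simp
  then have "v + cstar v = 2 *\<^sub>R x"
    unfolding cv unfolding v_def by (simp add: scaleR_2 algebra_simps)
  then have "2 * norm x \<le> norm v + norm (cstar v)"
    using norm_triangle_ineq[of v "cstar v"] by simp
  then have "norm x \<le> norm v" by (simp add: norm_cstar)
  then show ?thesis using n by (metis norm_ge_zero power_mono)
qed

lemma inverse_selfadj:
  fixes x u :: "'a::cstar_algebra"
  assumes "selfadj x" "x * u = 1" "u * x = 1"
  shows "selfadj u"
proof -
  have "cstar u * x = 1" "x * cstar u = 1"
    using arg_cong[OF assms(2), of cstar] arg_cong[OF assms(3), of cstar] assms(1)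
    by (simp_all add: selfadj_def cstar_mult)
  then have "cstar u = cstar u * (x * u)" "cstar u * x * u = u" using assms by simp_all
  then have "cstar u = u" by (simp add: mult.assoc)
  then show ?thesis by (simp add: selfadj_def)
qed

lemma inverse_commute:
  fixes x u v :: "'a::monoid_mult"
  assumes "x * u = 1" "u * x = 1" "v * x = x * v"
  shows "v * u = u * v"
proof -
  have "v * u = (u * x) * v * u" using assms by simp
  also have "\<dots> = u * (x * v) * u" by (simp add: mult.assoc)
  also have "\<dots> = u * v * (x * u)" unfolding assms(3)[symmetric] by (simp only: mult.assoc)
  finally show ?thesis using assms by simp
qed

text \<open>Because 1 - x x = (1 - x)(1 + x), this forces 1 or -1 into the spectrum of x. After
  scaling it becomes \<open>norm_in_rspec\<close>, which takes over the role of the spectral radius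
  formula.\<close>

lemma not_invertible_one_minus_square:
  fixes x :: "'a::cstar_algebra"
  assumes x: "selfadj x" "norm x = 1"
  shows "\<not> invertible_el (1 - x * x)"
proof
  assume inv: "invertible_el (1 - x * x)"
  then obtain u where u: "(1 - x * x) * u = 1" "u * (1 - x * x) = 1"
    unfolding invertible_el_def by blast
  define y where "y = x * x"
  have y: "selfadj y" "norm y = 1" "x * y = y * x"
    using x by (auto simp: y_def norm_square_selfadj mult.assoc intro!: selfadj_intros)
  have u': "u * (1 - y) = 1" "(1 - y) * u = 1" using u by (simp_all add: y_def)
  define K where "K = norm u"
  have K: "K > 0" using u by (auto simp: K_def)
  text \<open>If \<open>1 - y\<close> is invertible, then \<open>1 - r y - d\<close> is still a square for some fixed
    \<open>d > 0\<close> and all \<open>r < 1\<close> near \<open>1\<close>, which forces \<open>r \<le> 1 - d\<close>.\<close>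
  define d where "d = min (1/2) (1 / (4 * K))"
  have d: "d > 0" "d \<le> 1/2" "d * (2 * K) < 1" using K by (auto simp: d_def min_def field_simps)
  \<comment> \<open>The constants are matched to three needs: r > 1 - d for the final contradiction,
    (1 - r) K \<le> 1/4 so that passing from 1 - y to 1 - r y at most doubles the bound K on the
    inverse, and d * 2 K < 1 so that 1 - d (1 - r y)^-1 has a square root.\<close>
  define r where "r = max (1 - d / 2) (1 - 1 / (4 * K))"
  have r: "r < 1" "r > 1 - d" "(1 - r) * K \<le> 1/4" "r > 0" using K d by (auto simp: r_def max_def field_simps)
  have ry: "selfadj (r *\<^sub>R y)" "norm (r *\<^sub>R y) < 1" using y r by (auto intro: selfadj_intros)
  obtain w where w: "selfadj w" "w * w = 1 - r *\<^sub>R y" "\<And>v. v * (r *\<^sub>R y) = (r *\<^sub>R y) * v \<Longrightarrow> v * w = w * v"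
    using sqrt_one_minus_exists[OF ry] by blast
  have wc: "v * w = w * v" if "v * y = y * v" for v using that by (intro w(3)) simp
  \<comment> \<open>The perturbation factors as 1 - r y = (1 + e)(1 - y), and 1 + e is inverted by a
    Neumann series.\<close>
  define e where "e = ((1 - r) *\<^sub>R y) * u"
  have e: "norm e \<le> 1/4"
  proof -
    have "norm e \<le> norm ((1 - r) *\<^sub>R y) * K" unfolding e_def K_def by (rule norm_mult_ineq)
    also have "norm ((1 - r) *\<^sub>R y) = 1 - r" using y r by simp
    finally show ?thesis using r by linarith
  qed
  obtain ri where ri: "(1 - r *\<^sub>R y) * ri = 1" "ri * (1 - r *\<^sub>R y) = 1"
  proof -
    have "invertible_el (1 + e)" using invertible_el_one_minus[of "-e"] e by simp
    then have "invertible_el ((1 + e) * (1 - y))"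
      using inv by (intro invertible_el_mult) (auto simp: y_def)
    moreover have "(1 + e) * (1 - y) = 1 - r *\<^sub>R y"
      unfolding e_def distrib_right mult.assoc u' by (simp add: algebra_simps)
    ultimately show ?thesis using that unfolding invertible_el_def by auto
  qed
  have nri: "norm ri \<le> 2 * K"
  proof -
    have "ri = u * (1 - y) * ri" using u' by simp
    also have "1 - y = (1 - r *\<^sub>R y) - (1 - r) *\<^sub>R y" by (simp add: algebra_simps)
    also have "u * ((1 - r *\<^sub>R y) - (1 - r) *\<^sub>R y) * ri = u * ((1 - r *\<^sub>R y) * ri) - u * ((1 - r) *\<^sub>R y) * ri"
      by (simp add: algebra_simps)
    finally have eq: "ri = u - u * ((1 - r) *\<^sub>R y) * ri" using ri by simp
    have "norm (u * ((1 - r) *\<^sub>R y) * ri) \<le> norm (u * ((1 - r) *\<^sub>R y)) * norm ri" by (rule norm_mult_ineq)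
    also have "norm (u * ((1 - r) *\<^sub>R y)) \<le> K * norm ((1 - r) *\<^sub>R y)"
      unfolding K_def by (rule norm_mult_ineq)
    also have "K * norm ((1 - r) *\<^sub>R y) = (1 - r) * K" using y r by simp
    finally have "norm (u * ((1 - r) *\<^sub>R y) * ri) \<le> (1 - r) * K * norm ri" by (simp add: mult_right_mono)
    also have "\<dots> \<le> 1/4 * norm ri" using r by (intro mult_right_mono) auto
    finally have "norm ri \<le> K + 1/4 * norm ri"
      using arg_cong[OF eq, of norm] norm_triangle_ineq4[of u "u * ((1 - r) *\<^sub>R y) * ri"]
      unfolding K_def by argo
    then show ?thesis using K by linarith
  qed
  have ri_sa: "selfadj ri" by (rule inverse_selfadj[OF selfadj_intros(2)[OF selfadj_simps(2) ry(1)] ri])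
  have ri_comm: "v * ri = ri * v" if "v * y = y * v" for v
    by (rule inverse_commute[OF ri]) (use that in \<open>simp add: algebra_simps\<close>)
  have dri: "selfadj (d *\<^sub>R ri)" "norm (d *\<^sub>R ri) < 1"
    using ri_sa nri d by (auto intro: selfadj_intros le_less_trans[OF mult_left_mono[OF nri, of d]])
  obtain h where h: "selfadj h" "h * h = 1 - d *\<^sub>R ri" "\<And>v. v * (d *\<^sub>R ri) = (d *\<^sub>R ri) * v \<Longrightarrow> v * h = h * v"
    using sqrt_one_minus_exists[OF dri] by blast
  have hc: "v * h = h * v" if "v * y = y * v" for v using ri_comm[OF that] by (intro h(3)) simp
  have wh: "w * h = h * w" using wc[of y] by (intro hc) auto
  \<comment> \<open>All factors commute, so q q = (1 - r y)(1 - d (1 - r y)^-1) = 1 - d - r y. Hence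
    the squares of \<open>sqrt r *\<^sub>R x\<close> and q add up to the scalar 1 - d.\<close>
  define q where "q = w * h"
  have q: "selfadj q" unfolding q_def using w(1) h(1) wh by (rule selfadj_intros)
  have "q * q = w * (h * w) * h" unfolding q_def by (simp only: mult.assoc)
  also have "\<dots> = (w * w) * (h * h)" unfolding wh[symmetric] by (simp only: mult.assoc)
  also have "\<dots> = (1 - d) *\<^sub>R 1 - r *\<^sub>R y"
    unfolding w(2) h(2) right_diff_distrib mult_1_right mult_scaleR_right ri
    by (simp add: scaleR_left_diff_distrib)
  finally have qq: "q * q = (1 - d) *\<^sub>R 1 - r *\<^sub>R y" .
  have "x * q = (x * w) * h" unfolding q_def by (simp only: mult.assoc)
  also have "\<dots> = w * (x * h)" unfolding wc[OF y(3)] by (simp only: mult.assoc)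
  also have "\<dots> = q * x" unfolding hc[OF y(3)] q_def by (simp only: mult.assoc)
  finally have "x * q = q * x" .
  then have "(norm (sqrt r *\<^sub>R x))\<^sup>2 \<le> 1 - d"
    using x q d r qq
    by (intro norm_le_if_squares_sum[of _ q] selfadj_intros) (auto simp: y_def of_real_def)
  then show False using x r by simp
qed

lemma norm_in_rspec:
  fixes x :: "'a::cstar_algebra"
  assumes "selfadj x"
  shows "norm x \<in> rspec x \<or> - norm x \<in> rspec x"
proof (cases "x = 0")
  case True then show ?thesis by (simp add: rspec_def)
next
  case False
  define z where "z = (1 / norm x) *\<^sub>R x"
  have z: "selfadj z" "norm z = 1" unfolding z_def using False assms by (auto intro: selfadj_intros)
  have "\<not> (invertible_el (z - 1) \<and> invertible_el (z + 1))"
  proof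
    assume "invertible_el (z - 1) \<and> invertible_el (z + 1)"
    then have "invertible_el (- ((z - 1) * (z + 1)))"
      using invertible_el_mult invertible_el_minus by blast
    moreover have "- ((z - 1) * (z + 1)) = 1 - z * z" by (simp add: algebra_simps)
    ultimately show False using not_invertible_one_minus_square[OF z] by simp
  qed
  moreover have "x - of_real (norm x) = norm x *\<^sub>R (z - 1)" "x - of_real (- norm x) = norm x *\<^sub>R (z + 1)"
    unfolding z_def using False by (simp_all add: algebra_simps of_real_def)
  ultimately show ?thesis
    unfolding rspec_def using invertible_el_scaleR[of "norm x"] False by auto
qed

section \<open>Positive elements\<close>

lemma positive_elD: "positive_el x \<Longrightarrow> selfadj (x::'a::cstar_algebra)"
  by (simp add: positive_el_def)

lemma rspec_shift: "t \<in> rspec (x - of_real c) \<longleftrightarrow> t + c \<in> rspec (x::'a::cstar_algebra)"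
  by (simp add: rspec_def algebra_simps)

lemma rspec_reflect: "t \<in> rspec (of_real c - x) \<longleftrightarrow> c - t \<in> rspec (x::'a::cstar_algebra)"
proof -
  have "of_real c - x - of_real t = - (x - of_real (c - t))" by simp
  then show ?thesis unfolding rspec_def using invertible_el_minus by (metis mem_Collect_eq)
qed

text \<open>Together with \<open>positive_elI_norm\<close> this trades positivity for an inequality
  norm (c - x) \<le> c. Sums and limits of positive elements are then controlled by the triangle
  inequality, although their spectra are not directly related.\<close>

lemma norm_reflect_le_if_positive_el:
  fixes x :: "'a::cstar_algebra"
  assumes "positive_el x" "norm x \<le> c"
  shows "norm (of_real c - x) \<le> c"
proof -
  let ?r = "norm (of_real c - x)"
  have x: "rspec x \<subseteq> {0..}" and "selfadj (of_real c - x)"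
    using assms by (auto simp: positive_el_def intro: selfadj_intros)
  then consider "c - ?r \<in> rspec x" | "c + ?r \<in> rspec x"
    using norm_in_rspec rspec_reflect[of "?r" c x] rspec_reflect[of "-?r" c x] by fastforce
  then show ?thesis
  proof cases
    case 1 then show ?thesis using x by auto
  next
    case 2 then have "\<bar>c + ?r\<bar> \<le> c" using rspec_bounded assms(2) by (meson order_trans)
    then show ?thesis using norm_ge_zero[of "of_real c - x"] by linarith
  qed
qed

lemma positive_elI_norm:
  fixes x :: "'a::cstar_algebra"
  assumes "selfadj x" "norm (of_real c - x) \<le> c"
  shows "positive_el x"
proof -
  have "0 \<le> t" if "t \<in> rspec x" for t
  proof -
    have "c - t \<in> rspec (of_real c - x)" using that by (simp add: rspec_reflect)
    then have "\<bar>c - t\<bar> \<le> c" using rspec_bounded assms(2) by (meson order_trans)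
    then show ?thesis by linarith
  qed
  then show ?thesis using assms by (auto simp: positive_el_def)
qed

lemma positive_el_of_real [simp]: "c \<ge> 0 \<Longrightarrow> positive_el (of_real c :: 'a::cstar_algebra)"
  by (rule positive_elI_norm[where c = c]) auto

lemma positive_el_0 [simp]: "positive_el (0 :: 'a::cstar_algebra)"
  using positive_el_of_real[of 0] by simp

lemma positive_el_1 [simp]: "positive_el (1 :: 'a::cstar_algebra)"
  using positive_el_of_real[of 1] by simp

lemma positive_el_add:
  fixes x y :: "'a::cstar_algebra"
  assumes "positive_el x" "positive_el y"
  shows "positive_el (x + y)"
proof (rule positive_elI_norm[where c = "norm x + norm y"])
  show "selfadj (x + y)" using assms by (auto dest: positive_elD intro: selfadj_intros)
  have "of_real (norm x + norm y) - (x + y) = (of_real (norm x) - x) + (of_real (norm y) - y)" by simp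
  then show "norm (of_real (norm x + norm y) - (x + y)) \<le> norm x + norm y"
    using norm_triangle_mono[OF norm_reflect_le_if_positive_el norm_reflect_le_if_positive_el] assms
    by (metis order_refl)
qed

lemma positive_el_scaleR:
  fixes x :: "'a::cstar_algebra"
  assumes "positive_el x" "r \<ge> 0"
  shows "positive_el (r *\<^sub>R x)"
proof (rule positive_elI_norm[where c = "r * norm x"])
  show "selfadj (r *\<^sub>R x)" using assms by (auto dest: positive_elD intro: selfadj_intros)
  have "of_real (r * norm x) - r *\<^sub>R x = r *\<^sub>R (of_real (norm x) - x)"
    by (simp add: of_real_def algebra_simps)
  then show "norm (of_real (r * norm x) - r *\<^sub>R x) \<le> r * norm x"
    using norm_reflect_le_if_positive_el[OF assms(1) order_refl] assms(2) by (simp add: mult_left_mono)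
qed

lemma positive_el_sum: "(\<And>i. i \<in> I \<Longrightarrow> positive_el (f i :: 'a::cstar_algebra)) \<Longrightarrow> positive_el (sum f I)"
  by (induction I rule: infinite_finite_induct) (auto intro: positive_el_add)

lemma positive_el_limit:
  fixes x :: "'a::cstar_algebra"
  assumes lim: "X \<longlonglongrightarrow> x" and "\<And>n. positive_el (X n)"
  shows "positive_el x"
proof -
  obtain c where c: "\<And>n. norm (X n) \<le> c"
    using Bseq_eq_bounded convergent_imp_Bseq[OF convergentI[OF lim]] by (metis BseqE)
  show ?thesis
  proof (rule positive_elI_norm[where c = c])
    show "selfadj x" using assms by (auto intro: selfadj_limit dest: positive_elD)
    have "(\<lambda>n. norm (of_real c - X n)) \<longlonglongrightarrow> norm (of_real c - x)" by (intro tendsto_intros lim)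
    then show "norm (of_real c - x) \<le> c"
      using norm_reflect_le_if_positive_el assms(2) c by (intro LIMSEQ_le_const2) blast+
  qed
qed

lemma positive_el_antisym:
  fixes x :: "'a::cstar_algebra"
  assumes "positive_el x" "positive_el (- x)"
  shows "x = 0"
proof -
  have "t = 0" if "t \<in> rspec x" for t
    using that assms rspec_reflect[of "-t" 0 x] by (force simp: positive_el_def)
  then show ?thesis using norm_in_rspec[of x] assms by (force simp: positive_el_def)
qed

lemma positive_el_norm_minus:
  fixes x :: "'a::cstar_algebra"
  assumes "selfadj x" "norm x \<le> c"
  shows "positive_el (of_real c - x)"
  using assms by (intro positive_elI_norm[where c = c] selfadj_intros) auto

lemma positive_el_norm_plus:
  fixes x :: "'a::cstar_algebra"
  assumes "selfadj x" "norm x \<le> c"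
  shows "positive_el (of_real c + x)"
  using positive_el_norm_minus[of "-x" c] assms by (auto intro: selfadj_intros)

lemma norm_le_if_positive_el:
  fixes x :: "'a::cstar_algebra"
  assumes "selfadj x" "positive_el (of_real c - x)" "positive_el (of_real c + x)"
  shows "norm x \<le> c"
proof -
  have "- c \<le> t \<and> t \<le> c" if "t \<in> rspec x" for t
    using that assms(2,3) rspec_reflect[of "c - t" c x] rspec_shift[of "t + c" x "-c"]
    by (force simp: positive_el_def add.commute)
  then show ?thesis using norm_in_rspec[OF assms(1)] by force
qed

section \<open>Positive invertible elements, square roots and congruence\<close>

lemma pos_inv_iff:
  "pos_inv (x::'a::cstar_algebra) \<longleftrightarrow> selfadj x \<and> (\<exists>d>0. positive_el (x - of_real d))"
proof
  assume x: "pos_inv x"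
  then have "selfadj x" "rspec x \<subseteq> {0..}" "0 \<notin> rspec x"
    by (auto simp: pos_inv_def positive_el_def rspec_def)
  moreover have "closed (rspec x)" using compact_rspec compact_imp_closed by blast
  then obtain d where d: "d > 0" "\<And>t. \<bar>t\<bar> < d \<Longrightarrow> t \<notin> rspec x"
    using \<open>0 \<notin> rspec x\<close> unfolding closed_def open_dist by (force simp: dist_real_def)
  have "0 \<le> t" if "t \<in> rspec (x - of_real d)" for t
  proof -
    have "t + d \<in> rspec x" using that by (simp add: rspec_shift)
    then have "t + d \<ge> 0" "\<not> \<bar>t + d\<bar> < d" using \<open>rspec x \<subseteq> {0..}\<close> d(2) by auto
    then show ?thesis by linarith
  qed
  then have "rspec (x - of_real d) \<subseteq> {0..}" by auto
  ultimately show "selfadj x \<and> (\<exists>d>0. positive_el (x - of_real d))"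
    using d(1) unfolding positive_el_def by (metis selfadj_intros(2) selfadj_simps(3))
next
  assume "selfadj x \<and> (\<exists>d>0. positive_el (x - of_real d))"
  then obtain d where d: "d > 0" "positive_el (x - of_real d)" by blast
  have "positive_el (x - of_real d + of_real d)" using d by (intro positive_el_add) auto
  moreover have "-d \<notin> rspec (x - of_real d)" using d by (auto simp: positive_el_def)
  ultimately show "pos_inv x" by (simp add: pos_inv_def rspec_def)
qed

lemma pos_inv_selfadj: "pos_inv x \<Longrightarrow> selfadj (x::'a::cstar_algebra)"
  by (simp add: pos_inv_def positive_el_def)

lemma pos_inv_positive: "pos_inv x \<Longrightarrow> positive_el (x::'a::cstar_algebra)"
  by (simp add: pos_inv_def)

lemma pos_inv_add:
  fixes x y :: "'a::cstar_algebra"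
  assumes "positive_el x" "pos_inv y"
  shows "pos_inv (x + y)"
proof -
  obtain d where "d > 0" "positive_el (y - of_real d)" using assms pos_inv_iff by blast
  moreover from this have "positive_el (x + y - of_real d)"
    using positive_el_add[OF assms(1)] by (metis add_diff_eq)
  ultimately show ?thesis
    using assms by (auto simp: pos_inv_iff dest: positive_elD intro: selfadj_intros)
qed

lemma pos_inv_of_real: "c > 0 \<Longrightarrow> pos_inv (of_real c :: 'a::cstar_algebra)"
  unfolding pos_inv_iff by (auto intro!: exI[of _ c])

lemma pos_inv_1 [simp]: "pos_inv (1 :: 'a::cstar_algebra)"
  using pos_inv_of_real[of 1] by simp

lemma pos_inv_scaleR: "pos_inv (x::'a::cstar_algebra) \<Longrightarrow> r > 0 \<Longrightarrow> pos_inv (r *\<^sub>R x)"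
  by (simp add: pos_inv_def positive_el_scaleR invertible_el_scaleR)

text \<open>With w w = 1 - x x / c and w commuting with x, the squares of
  \<open>sqrt c *\<^sub>R w\<close> and x add up to c. So c w w = c - x x has norm at most c, which
  is the norm criterion for positivity of x x.\<close>

lemma positive_el_square:
  fixes x :: "'a::cstar_algebra"
  assumes "selfadj x"
  shows "positive_el (x * x)"
proof -
  define c where "c = (norm x)\<^sup>2 + 1"
  have c: "c > 0" "norm (x * x) < c" using norm_square_selfadj[OF assms] by (auto simp: c_def add_nonneg_pos)
  let ?y = "(1 / c) *\<^sub>R (x * x)"
  have y: "selfadj ?y" "norm ?y < 1" using c assms by (auto intro: selfadj_intros)
  then obtain w where w: "selfadj w" "w * w = 1 - ?y" "\<And>v. v * ?y = ?y * v \<Longrightarrow> v * w = w * v"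
    using sqrt_one_minus_exists[OF y] by blast
  have "x * w = w * x" using w(3)[of x] by (simp add: mult.assoc)
  moreover have "c *\<^sub>R (w * w) = of_real c - x * x"
    unfolding w(2) using c by (simp add: of_real_def scaleR_diff_right)
  ultimately have "(norm (sqrt c *\<^sub>R w))\<^sup>2 \<le> c"
    using c assms w(1) by (intro norm_le_if_squares_sum[of _ x] selfadj_intros) auto
  then have "norm (c *\<^sub>R (w * w)) \<le> c"
    using norm_square_selfadj[OF w(1)] c by (simp add: power_mult_distrib)
  then have "norm (of_real c - x * x) \<le> c" using \<open>c *\<^sub>R (w * w) = _\<close> by simp
  then show ?thesis by (rule positive_elI_norm[rotated]) (use assms in \<open>auto intro: selfadj_intros\<close>)
qed

lemma invertible_el_squareD: "invertible_el (x * x) \<Longrightarrow> invertible_el (x::'a::cstar_algebra)"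
  by (rule invertible_el_mult_commD) auto

lemma pos_inv_square: "selfadj x \<Longrightarrow> invertible_el x \<Longrightarrow> pos_inv (x * x :: 'a::cstar_algebra)"
  by (simp add: pos_inv_def positive_el_square invertible_el_mult)

lemma pos_inv_sqrt_exists:
  fixes x :: "'a::cstar_algebra"
  assumes "pos_inv x"
  obtains s where "pos_inv s" "s * s = x" "\<And>v. v * x = x * v \<Longrightarrow> v * s = s * v"
proof -
  obtain d where d: "d > 0" "positive_el (x - of_real d)" using assms pos_inv_iff by blast
  \<comment> \<open>The lower bound d of x yields norm (c - x) \<le> c - d, so x / c = 1 - y with
    norm y < 1. The strict inequality is what the square root construction requires.\<close>
  define c where "c = norm x + 2 * d"
  have c: "c > 0" using d by (simp add: c_def add_nonneg_pos)
  have "norm (x - of_real d) \<le> c - d"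
    using norm_triangle_ineq4[of x "of_real d"] d by (simp add: c_def)
  then have "norm (of_real (c - d) - (x - of_real d)) \<le> c - d"
    by (rule norm_reflect_le_if_positive_el[OF d(2)])
  then have n: "norm (of_real c - x) < c" using d by simp
  let ?y = "(1 / c) *\<^sub>R (of_real c - x)"
  have y: "selfadj ?y" "norm ?y < 1" using n c assms by (auto intro!: selfadj_intros dest: pos_inv_selfadj)
  then obtain w where w: "selfadj w" "w * w = 1 - ?y" "\<And>v. v * ?y = ?y * v \<Longrightarrow> v * w = w * v" "norm (1 - w) \<le> norm ?y"
    using sqrt_one_minus_exists[OF y] by blast
  define s where "s = sqrt c *\<^sub>R w"
  have ss: "s * s = x" unfolding s_def using w(2) c by (simp add: algebra_simps of_real_def)
  have "positive_el w"
    using w(1,4) y(2) by (intro positive_elI_norm[where c = 1]) (simp_all del: norm_scaleR)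
  then have "positive_el s" unfolding s_def using c by (intro positive_el_scaleR) auto
  moreover have "invertible_el s"
    using assms ss by (auto simp: pos_inv_def intro: invertible_el_squareD)
  moreover have "v * s = s * v" if "v * x = x * v" for v
  proof -
    have "v * ?y = ?y * v" using that of_real_commute[of c v] by (simp add: algebra_simps)
    then show ?thesis using w(3) by (simp add: s_def)
  qed
  ultimately show ?thesis using ss that unfolding pos_inv_def by blast
qed

lemma pos_inv_inverse:
  fixes x u :: "'a::cstar_algebra"
  assumes "pos_inv x" "x * u = 1" "u * x = 1"
  shows "pos_inv u"
proof -
  obtain s where s: "pos_inv s" "s * s = x" using pos_inv_sqrt_exists[OF assms(1)] by blast
  then obtain v where v: "s * v = 1" "v * s = 1" by (auto simp: pos_inv_def invertible_el_def)
  have "v * v * x = v * (v * s) * s" unfolding s(2)[symmetric] by (simp only: mult.assoc)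
  then have "v * v * x * u = u" using v by simp
  then have "u = v * v" using assms(2) by (simp add: mult.assoc)
  moreover have "selfadj v" using inverse_selfadj v s pos_inv_selfadj by blast
  moreover have "invertible_el v" using v by (auto simp: invertible_el_def)
  ultimately show ?thesis by (simp add: pos_inv_square)
qed

lemma tendsto_add_inverse_Suc:
  fixes x :: "'a::real_normed_algebra_1"
  shows "(\<lambda>n. x + of_real (inverse (real (Suc n)))) \<longlonglongrightarrow> x"
proof -
  have "(\<lambda>n. x + of_real (inverse (real (Suc n)))) \<longlonglongrightarrow> x + of_real 0"
    by (intro tendsto_intros LIMSEQ_inverse_real_of_nat)
  then show ?thesis by simp
qed

lemma pos_inv_add_inverse_Suc:
  "positive_el (x::'a::cstar_algebra) \<Longrightarrow> pos_inv (x + of_real (inverse (real (Suc n))))"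
  by (intro pos_inv_add pos_inv_of_real) auto

lemma positive_elI_invertible:
  fixes x :: "'a::cstar_algebra"
  assumes "selfadj x" "\<And>t. t > 0 \<Longrightarrow> invertible_el (x + of_real t)"
  shows "positive_el x"
  unfolding positive_el_def rspec_def
  using assms(1) assms(2)[of "- t" for t] by (force simp: not_less[symmetric])

text \<open>The general case follows from the one where \<open>y\<close> is invertible because \<open>1 + a b\<close> is invertible
  if and only if \<open>1 + b a\<close> is.\<close>
lemma positive_el_congruence:
  fixes x y :: "'a::cstar_algebra"
  assumes "positive_el x" "selfadj y"
  shows "positive_el (y * x * y)"
proof -
  have inv: "positive_el (s * x * s)" if x: "positive_el x" and s: "selfadj s" "invertible_el s" for x s :: 'a
  proof (rule positive_elI_invertible)
    show "selfadj (s * x * s)" by (rule selfadj_intros(6)[OF s(1) positive_elD[OF x]])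
    fix t :: real assume t: "t > 0"
    obtain v where v: "s * v = 1" "v * s = 1" using s by (auto simp: invertible_el_def)
    then have "selfadj v" "invertible_el v" using inverse_selfadj s by (auto simp: invertible_el_def)
    then have "pos_inv (x + t *\<^sub>R (v * v))" using x t by (intro pos_inv_add pos_inv_scaleR pos_inv_square)
    then have "invertible_el (s * (x + t *\<^sub>R (v * v)) * s)" using s by (intro invertible_el_mult) (auto simp: pos_inv_def)
    moreover have "s * (v * v) * s = 1" using v by (simp add: mult.assoc[symmetric]) 
    then have "s * (x + t *\<^sub>R (v * v)) * s = s * x * s + of_real t"
      by (simp add: distrib_left distrib_right of_real_def)
    ultimately show "invertible_el (s * x * s + of_real t)" by simp
  qed
  have pos: "positive_el (y * x * y)" if "pos_inv x" for x
  proof (rule positive_elI_invertible)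
    show "selfadj (y * x * y)" by (rule selfadj_intros(6)[OF assms(2) pos_inv_selfadj[OF that]])
    fix t :: real assume t: "t > 0"
    obtain s where s: "pos_inv s" "s * s = x" using pos_inv_sqrt_exists[OF \<open>pos_inv x\<close>] by blast
    then have "positive_el (s * (y * y) * s)"
      using assms(2) by (intro inv positive_el_square) (auto simp: pos_inv_def dest: positive_elD)
    then have "invertible_el (s * (y * y) * s + of_real t)"
      using pos_inv_add[OF _ pos_inv_of_real[OF t]] by (auto simp: pos_inv_def)
    then have "invertible_el ((1 / t) *\<^sub>R (s * (y * y) * s + of_real t))"
      using t by (subst invertible_el_scaleR) auto
    also have "(1 / t) *\<^sub>R (s * (y * y) * s + of_real t) = 1 - (-(1/t) *\<^sub>R (s * y)) * (y * s)"
      using t by (simp add: algebra_simps of_real_def)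
    finally have "invertible_el (1 - (y * s) * (-(1/t) *\<^sub>R (s * y)))" by (rule invertible_el_one_minus_swap)
    also have "1 - (y * s) * (-(1/t) *\<^sub>R (s * y)) = (1 / t) *\<^sub>R (y * (s * s) * y + of_real t)"
      using t by (simp add: algebra_simps of_real_def)
    finally show "invertible_el (y * x * y + of_real t)"
      unfolding s(2) using t by (subst (asm) invertible_el_scaleR) auto
  qed
  have "(\<lambda>n. y * (x + of_real (inverse (real (Suc n)))) * y) \<longlonglongrightarrow> y * x * y"
    by (intro tendsto_intros tendsto_add_inverse_Suc)
  then show ?thesis
    by (rule positive_el_limit) (intro pos pos_inv_add_inverse_Suc assms)
qed

text \<open>For invertible x the root s of x commutes with y, so x y = s y s is a congruence of y;
  the general case is a limit.\<close>

lemma positive_el_mult: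
  fixes x y :: "'a::cstar_algebra"
  assumes "positive_el x" "positive_el y" "x * y = y * x"
  shows "positive_el (x * y)"
proof -
  have *: "positive_el (x * y)" if x: "pos_inv x" and xy: "x * y = y * x" for x
  proof -
    obtain s where s: "pos_inv s" "s * s = x" "y * s = s * y"
      using pos_inv_sqrt_exists[OF x] xy by metis
    then have "s * y * s = x * y" by (metis mult.assoc)
    then show ?thesis using positive_el_congruence[OF assms(2) pos_inv_selfadj[OF s(1)]] by simp
  qed
  have "(\<lambda>n. (x + of_real (inverse (real (Suc n)))) * y) \<longlonglongrightarrow> x * y"
    by (intro tendsto_intros tendsto_add_inverse_Suc)
  then show ?thesis
  proof (rule positive_el_limit)
    show "positive_el ((x + of_real (inverse (real (Suc n)))) * y)" for n
      by (intro * pos_inv_add_inverse_Suc assms)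
        (simp only: distrib_left distrib_right assms(3) of_real_commute[where x = y])
  qed
qed

lemma pos_inv_congruence:
  fixes x y :: "'a::cstar_algebra"
  assumes "pos_inv x" "selfadj y" "invertible_el y"
  shows "pos_inv (y * x * y)"
  using assms by (auto simp: pos_inv_def intro: positive_el_congruence invertible_el_mult)

section \<open>Continuous functional calculus\<close>

lemma peval_eq:
  assumes "degree p \<le> n"
  shows "peval p x = (\<Sum>i\<le>n. coeff p i *\<^sub>R x ^ i)"
  unfolding peval_def using assms
  by (intro sum.mono_neutral_left) (auto simp: coeff_eq_0)

lemma peval_0 [simp]: "peval 0 x = 0"
  by (simp add: peval_def)

lemma peval_add: "peval (p + q) x = peval p x + peval q x"
proof -
  let ?n = "max (degree p) (degree q)"
  show ?thesis
    by (simp add: peval_eq[of p ?n] peval_eq[of q ?n] peval_eq[of "p + q" ?n] degree_add_le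
        scaleR_add_left sum.distrib)
qed

lemma peval_smult: "peval (smult a p) x = a *\<^sub>R peval p x"
  by (simp add: peval_eq[of "smult a p" "degree p"] peval_def degree_smult_le scaleR_sum_right)

lemma peval_pCons: "peval (pCons a p) x = of_real a + x * peval p x"
proof -
  have "peval (pCons a p) x = (\<Sum>i\<le>Suc (degree p). coeff (pCons a p) i *\<^sub>R x ^ i)"
    by (rule peval_eq) (simp add: degree_pCons_le)
  also have "\<dots> = of_real a + (\<Sum>i\<le>degree p. coeff p i *\<^sub>R x ^ Suc i)"
    by (subst sum.atMost_Suc_shift) (simp add: of_real_def)
  finally show ?thesis by (simp add: peval_def sum_distrib_left)
qed

lemma peval_mult: "peval (p * q) x = peval p x * peval q x"
  by (induction p) (simp_all add: peval_pCons peval_add peval_smult distrib_right mult.assoc of_real_def)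

lemma peval_diff: "peval (p - q) x = peval p x - peval q x"
  using peval_add[of "p - q" q x] by simp

lemma selfadj_sum: "(\<And>i. i \<in> I \<Longrightarrow> selfadj (f i :: 'a::cstar_algebra)) \<Longrightarrow> selfadj (sum f I)"
  by (induction I rule: infinite_finite_induct) (auto intro: selfadj_intros)

lemma selfadj_peval: "selfadj x \<Longrightarrow> selfadj (peval p x)"
  unfolding peval_def
  by (rule selfadj_sum) (intro selfadj_intros selfadj_power)

section \<open>Real polynomials of a self-adjoint element\<close>

lemma map_poly_of_real_simps:
  fixes p q :: "real poly"
  shows "map_poly complex_of_real (p + q) = map_poly complex_of_real p + map_poly complex_of_real q"
    and "map_poly complex_of_real (p * q) = map_poly complex_of_real p * map_poly complex_of_real q"
  by (rule poly_eqI; simp add: coeff_map_poly coeff_mult)+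

text \<open>The factors are kept real because \<open>rspec\<close> contains only real points: a
  non-real root a + i b is paired with its conjugate in the quadratic (t - a)^2 + b^2.\<close>

lemma real_poly_factor_cases:
  fixes p :: "real poly"
  assumes "degree p > 0"
  obtains a q where "p = [:- a, 1:] * q"
    | a b q where "b > 0" "p = [:a\<^sup>2 + b\<^sup>2, -2 * a, 1:] * q"
proof -
  let ?c = "map_poly complex_of_real"
  have "degree (?c p) > 0" using assms by (simp add: degree_map_poly)
  then have "\<not> constant (poly (?c p))" by (simp add: constant_degree)
  then obtain z where z: "poly (?c p) z = 0" using fundamental_theorem_of_algebra by blast
  show thesis
  proof (cases "Im z = 0")
    case True
    then have "z = of_real (Re z)" by (simp add: complex_eq_iff)
    moreover have "poly (?c p) (of_real t) = of_real (poly p t)" for t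
      by (induction p) (simp_all add: map_poly_pCons)
    ultimately have "poly p (Re z) = 0" using z by (metis of_real_eq_0_iff)
    then show thesis using that(1) by (metis dvdE poly_eq_0_iff_dvd)
  next
    case False
    define m where "m = [:(Re z)\<^sup>2 + (Im z)\<^sup>2, -2 * Re z, 1:]"
    have "poly (?c m) z = 0"
      unfolding m_def
      by (simp add: map_poly_pCons complex_eq_iff power2_eq_square algebra_simps)
    moreover have "?c p = ?c m * ?c (p div m) + ?c (p mod m)"
      by (metis map_poly_of_real_simps mult_div_mod_eq)
    \<comment> \<open>The remainder modulo the quadratic m is a real polynomial of degree at most 1
      with a non-real root, hence zero.\<close>
    ultimately have r0: "poly (?c (p mod m)) z = 0" using z by simp
    have "m \<noteq> 0" "degree m = 2" by (simp_all add: m_def)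
    then have "degree (p mod m) \<le> 1" using degree_mod_less[of m p] by auto
    then have "p mod m = [:coeff (p mod m) 0, coeff (p mod m) 1:]"
      by (intro poly_eqI) (auto simp: coeff_pCons coeff_eq_0 split: nat.splits)
    then obtain u v where uv: "p mod m = [:u, v:]" by blast
    have "Im (poly (?c [:u, v:]) z) = 0" "Re (poly (?c [:u, v:]) z) = 0" using r0 uv by simp_all
    then have "v = 0 \<and> u = 0" using False by (auto simp: map_poly_pCons)
    then have "p mod m = 0" using uv by simp
    then have "p = m * (p div m)" by (metis add.right_neutral mult_div_mod_eq)
    then show thesis using that(2)[of "\<bar>Im z\<bar>" "Re z" "p div m"] False by (simp add: m_def)
  qed
qed

text \<open>Linear factors are invertible because their root avoids the spectrum; quadratic factors
  (x - a)^2 + b^2 are a positive element plus a positive scalar and thus always invertible. Non-real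
  spectral points therefore never have to be discussed.\<close>

lemma invertible_el_peval:
  fixes x :: "'a::cstar_algebra"
  assumes "selfadj x" "\<And>t. t \<in> rspec x \<Longrightarrow> poly p t \<noteq> 0"
  shows "invertible_el (peval p x)"
  using assms(2)
proof (induction "degree p" arbitrary: p rule: less_induct)
  case less
  have ne: "rspec x \<noteq> {}" using norm_in_rspec[OF assms(1)] by blast
  then have p0: "p \<noteq> 0" using less.prems by auto
  show ?case
  proof (cases "degree p = 0")
    case True
    then obtain c where c: "p = [:c:]" by (rule degree_eq_zeroE)
    then have "c \<noteq> 0" using p0 by simp
    then show ?thesis using invertible_el_scaleR[of c "1::'a"] by (simp add: c peval_pCons of_real_def)
  next
    case False
    then have "degree p > 0" by simp
    then show ?thesis
    proof (cases rule: real_poly_factor_cases)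
      case (1 a q)
      then have "q \<noteq> 0" using p0 by auto
      then have "degree p = degree [:- a, 1:] + degree q"
        unfolding 1 by (intro degree_mult_eq) auto
      then have "degree q < degree p" by simp
      moreover have "poly q t \<noteq> 0" if "t \<in> rspec x" for t using less.prems[OF that] 1 by auto
      ultimately have "invertible_el (peval q x)" by (rule less.hyps)
      moreover have "a \<notin> rspec x" using less.prems[of a] 1 by auto
      then have "invertible_el (x - of_real a)" by (simp add: rspec_def)
      moreover have "peval p x = (x - of_real a) * peval q x"
        unfolding 1 peval_mult by (simp add: peval_pCons)
      ultimately show ?thesis by (simp add: invertible_el_mult)
    next
      case (2 a b q)
      then have "q \<noteq> 0" using p0 by auto
      then have "degree p = degree [:a\<^sup>2 + b\<^sup>2, -2 * a, 1:] + degree q"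
        unfolding 2 by (intro degree_mult_eq) auto
      then have "degree q < degree p" by simp
      moreover have "poly q t \<noteq> 0" if "t \<in> rspec x" for t using less.prems[OF that] 2 by auto
      ultimately have "invertible_el (peval q x)" by (rule less.hyps)
      moreover have "positive_el ((x - of_real a) * (x - of_real a))"
        using assms(1) by (intro positive_el_square selfadj_intros) auto
      then have "invertible_el ((x - of_real a) * (x - of_real a) + of_real (b\<^sup>2))"
        using 2(1) by (intro pos_inv_add[unfolded pos_inv_def, THEN conjunct2])
          (auto simp: pos_inv_of_real[unfolded pos_inv_def] simp del: of_real_power)
      moreover have "peval p x = ((x - of_real a) * (x - of_real a) + of_real (b\<^sup>2)) * peval q x"
        unfolding 2 peval_mult
        by (simp add: peval_pCons of_real_def power2_eq_square algebra_simps)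
          (simp add: scaleR_add_left[symmetric])
      ultimately show ?thesis by (simp add: invertible_el_mult)
    qed
  qed
qed

lemma rspec_peval:
  fixes x :: "'a::cstar_algebra"
  assumes "selfadj x" "s \<in> rspec (peval p x)"
  obtains t where "t \<in> rspec x" "poly p t = s"
proof -
  have "peval (p - [:s:]) x = peval p x - of_real s" by (simp add: peval_diff peval_pCons)
  then have "\<not> invertible_el (peval (p - [:s:]) x)" using assms(2) by (simp add: rspec_def)
  then show thesis using invertible_el_peval[OF assms(1), of "p - [:s:]"] that by auto
qed

text \<open>The norm of p(x) is, up to sign, one of its spectral points, and spectral points of p(x)
  are values of p on the spectrum of x. This is the estimate that makes limits of polynomials in x
  well defined.\<close>

lemma norm_peval_le:
  fixes x :: "'a::cstar_algebra"
  assumes "selfadj x" "\<And>t. t \<in> rspec x \<Longrightarrow> \<bar>poly p t\<bar> \<le> b"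
  shows "norm (peval p x) \<le> b"
proof -
  obtain s where s: "s \<in> rspec (peval p x)" "\<bar>s\<bar> = norm (peval p x)"
    using norm_in_rspec[OF selfadj_peval[OF assms(1)], of p] by force
  then show ?thesis using rspec_peval[OF assms(1) s(1)] assms(2) by metis
qed

text \<open>The relation whose unique solution is \<open>cfc f x\<close>, with approximating sequences.\<close>
definition has_cfc :: "(real \<Rightarrow> real) \<Rightarrow> 'a::cstar_algebra \<Rightarrow> 'a \<Rightarrow> bool" where
  "has_cfc f x y \<longleftrightarrow> (\<exists>P. uniform_limit (rspec x) (\<lambda>n. poly (P n)) f sequentially
     \<and> (\<lambda>n. peval (P n) x) \<longlonglongrightarrow> y)"

lemma has_cfc_iff:
  "has_cfc f x y \<longleftrightarrow> (\<forall>e>0. \<exists>p. (\<forall>t\<in>rspec x. \<bar>f t - poly p t\<bar> \<le> e) \<and> norm (y - peval p x) \<le> e)"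
proof
  assume "has_cfc f x y"
  then obtain P where P: "uniform_limit (rspec x) (\<lambda>n. poly (P n)) f sequentially" "(\<lambda>n. peval (P n) x) \<longlonglongrightarrow> y"
    unfolding has_cfc_def by blast
  show "\<forall>e>0. \<exists>p. (\<forall>t\<in>rspec x. \<bar>f t - poly p t\<bar> \<le> e) \<and> norm (y - peval p x) \<le> e"
  proof (intro allI impI)
    fix e :: real assume e: "e > 0"
    have "\<forall>\<^sub>F n in sequentially. (\<forall>t\<in>rspec x. dist (poly (P n) t) (f t) < e) \<and> dist (peval (P n) x) y < e"
      using uniform_limitD[OF P(1) e] tendstoD[OF P(2) e] by (rule eventually_conj)
    then obtain n where "\<forall>t\<in>rspec x. dist (poly (P n) t) (f t) < e" "dist (peval (P n) x) y < e"
      using eventually_happens by fastforce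
    then show "\<exists>p. (\<forall>t\<in>rspec x. \<bar>f t - poly p t\<bar> \<le> e) \<and> norm (y - peval p x) \<le> e"
      by (intro exI[of _ "P n"]) (auto simp: dist_norm norm_minus_commute abs_minus_commute intro: less_imp_le)
  qed
next
  assume *: "\<forall>e>0. \<exists>p. (\<forall>t\<in>rspec x. \<bar>f t - poly p t\<bar> \<le> e) \<and> norm (y - peval p x) \<le> e"
  have "\<exists>p. (\<forall>t\<in>rspec x. \<bar>f t - poly p t\<bar> \<le> inverse (real (Suc n))) \<and> norm (y - peval p x) \<le> inverse (real (Suc n))" for n
    using * by simp
  then obtain P where P': "\<And>n t. t \<in> rspec x \<Longrightarrow> \<bar>f t - poly (P n) t\<bar> \<le> inverse (real (Suc n))"
    "\<And>n. norm (y - peval (P n) x) \<le> inverse (real (Suc n))" by metis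
  then have P: "\<And>n t. t \<in> rspec x \<Longrightarrow> dist (poly (P n) t) (f t) \<le> inverse (real (Suc n))"
    by (simp add: dist_real_def abs_minus_commute)
  have ev: "\<forall>\<^sub>F n in sequentially. inverse (real (Suc n)) < e" if "e > 0" for e
    using LIMSEQ_inverse_real_of_nat that by (rule order_tendstoD)
  have "uniform_limit (rspec x) (\<lambda>n. poly (P n)) f sequentially"
  proof (rule uniform_limitI)
    fix e :: real assume "e > 0"
    show "\<forall>\<^sub>F n in sequentially. \<forall>t\<in>rspec x. dist (poly (P n) t) (f t) < e"
      using ev[OF \<open>e > 0\<close>] by eventually_elim (intro ballI le_less_trans[OF P])
  qed
  moreover have "(\<lambda>n. peval (P n) x) \<longlonglongrightarrow> y"
  proof (rule tendstoI)
    fix e :: real assume "e > 0"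
    show "\<forall>\<^sub>F n in sequentially. dist (peval (P n) x) y < e"
      using ev[OF \<open>e > 0\<close>] by eventually_elim (use P'(2) in \<open>metis dist_norm dist_commute order.strict_trans1\<close>)
  qed
  ultimately show "has_cfc f x y" unfolding has_cfc_def by blast
qed

section \<open>Existence, uniqueness and rules of the functional calculus\<close>

lemma has_cfc_norm_le:
  fixes x :: "'a::cstar_algebra"
  assumes x: "selfadj x" and fc: "has_cfc f x y" and b: "\<And>t. t \<in> rspec x \<Longrightarrow> \<bar>f t\<bar> \<le> b"
  shows "norm y \<le> b"
proof (rule field_le_epsilon)
  fix e :: real assume "e > 0"
  then obtain p where p: "\<forall>t\<in>rspec x. \<bar>f t - poly p t\<bar> \<le> e / 2" "norm (y - peval p x) \<le> e / 2"
    using fc unfolding has_cfc_iff by (meson half_gt_zero)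
  have "norm (peval p x) \<le> b + e / 2"
  proof (rule norm_peval_le[OF x])
    fix t assume "t \<in> rspec x"
    then show "\<bar>poly p t\<bar> \<le> b + e / 2" using p(1) b by (smt (verit))
  qed
  then show "norm y \<le> b + e"
    using p(2) norm_triangle_sub[of y "peval p x"] by linarith
qed

lemma poly_fun_simps:
  "poly (p - q) = (\<lambda>t. poly p t - poly q t :: real)"
  "poly (p + q) = (\<lambda>t. poly p t + poly q t :: real)"
  "poly (p * q) = (\<lambda>t. poly p t * poly q t :: real)"
  "poly [:c:] = (\<lambda>t. c)" "poly [:0, 1:] = (\<lambda>t. t :: real)"
  by (simp_all add: fun_eq_iff)

lemma has_cfc_diff: "has_cfc f x y \<Longrightarrow> has_cfc g x z \<Longrightarrow> has_cfc (\<lambda>t. f t - g t) x (y - z)"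
proof -
  assume "has_cfc f x y" "has_cfc g x z"
  then obtain P Q where
    "uniform_limit (rspec x) (\<lambda>n. poly (P n)) f sequentially" "(\<lambda>n. peval (P n) x) \<longlonglongrightarrow> y"
    "uniform_limit (rspec x) (\<lambda>n. poly (Q n)) g sequentially" "(\<lambda>n. peval (Q n) x) \<longlonglongrightarrow> z"
    unfolding has_cfc_def by blast
  then show ?thesis
    unfolding has_cfc_def
    by (intro exI[of _ "\<lambda>n. P n - Q n"])
      (auto simp: peval_diff poly_fun_simps intro!: tendsto_intros uniform_limit_minus)
qed

lemma has_cfc_add: "has_cfc f x y \<Longrightarrow> has_cfc g x z \<Longrightarrow> has_cfc (\<lambda>t. f t + g t) x (y + z)"
proof -
  assume "has_cfc f x y" "has_cfc g x z"
  then obtain P Q where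
    "uniform_limit (rspec x) (\<lambda>n. poly (P n)) f sequentially" "(\<lambda>n. peval (P n) x) \<longlonglongrightarrow> y"
    "uniform_limit (rspec x) (\<lambda>n. poly (Q n)) g sequentially" "(\<lambda>n. peval (Q n) x) \<longlonglongrightarrow> z"
    unfolding has_cfc_def by blast
  then show ?thesis
    unfolding has_cfc_def
    by (intro exI[of _ "\<lambda>n. P n + Q n"])
      (auto simp: peval_add poly_fun_simps intro!: tendsto_intros uniform_limit_add)
qed

lemma has_cfc_bounded:
  fixes x :: "'a::cstar_algebra"
  assumes "has_cfc f x y"
  shows "bounded (f ` rspec x)"
proof -
  obtain p where p: "\<forall>t\<in>rspec x. \<bar>f t - poly p t\<bar> \<le> 1"
    using assms unfolding has_cfc_iff by (metis zero_less_one)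
  have "bounded (poly p ` rspec x)"
    by (intro compact_imp_bounded compact_continuous_image compact_rspec continuous_intros)
  then obtain b where "\<And>t. t \<in> rspec x \<Longrightarrow> \<bar>poly p t\<bar> \<le> b" unfolding bounded_iff by auto
  then have "\<bar>f t\<bar> \<le> b + 1" if "t \<in> rspec x" for t using that p by (smt (verit))
  then show ?thesis unfolding bounded_iff by auto
qed

lemma has_cfc_mult: "has_cfc f x y \<Longrightarrow> has_cfc g x z \<Longrightarrow> has_cfc (\<lambda>t. f t * g t) x (y * z)"
proof -
  assume fg: "has_cfc f x y" "has_cfc g x z"
  then obtain P Q where
    "uniform_limit (rspec x) (\<lambda>n. poly (P n)) f sequentially" "(\<lambda>n. peval (P n) x) \<longlonglongrightarrow> y"
    "uniform_limit (rspec x) (\<lambda>n. poly (Q n)) g sequentially" "(\<lambda>n. peval (Q n) x) \<longlonglongrightarrow> z"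
    unfolding has_cfc_def by blast
  then show ?thesis
    unfolding has_cfc_def using fg[THEN has_cfc_bounded]
    by (intro exI[of _ "\<lambda>n. P n * Q n"])
      (auto simp: peval_mult poly_fun_simps intro!: tendsto_intros uniform_lim_mult)
qed

lemma has_cfc_poly: "has_cfc (poly p) x (peval p x)"
  unfolding has_cfc_iff by (auto intro!: exI[of _ p])

lemma has_cfc_const: "has_cfc (\<lambda>t. c) x (of_real c)"
  using has_cfc_poly[of "[:c:]" x] by (simp add: peval_pCons poly_fun_simps)

lemma has_cfc_ident: "has_cfc (\<lambda>t. t) x x"
  using has_cfc_poly[of "[:0, 1:]" x] by (simp add: peval_pCons poly_fun_simps)

lemma has_cfc_cong: "(\<And>t. t \<in> rspec x \<Longrightarrow> f t = g t) \<Longrightarrow> has_cfc f x y \<longleftrightarrow> has_cfc g x y"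
  unfolding has_cfc_iff by (metis (no_types, lifting))

text \<open>The difference of two candidates for f(x) represents the zero function and so has norm
  0; this justifies the definite description in \<open>cfc\<close>.\<close>

lemma cfc_eqI:
  fixes x :: "'a::cstar_algebra"
  assumes "selfadj x" "has_cfc f x y"
  shows "cfc f x = y"
proof -
  have "z = y" if "has_cfc f x z" for z
    using has_cfc_norm_le[OF assms(1) has_cfc_diff[OF that assms(2)], of 0] by simp
  then show ?thesis
    unfolding cfc_def has_cfc_iff[symmetric] using assms(2) by (intro the_equality)
qed

text \<open>Stone-Weierstrass supplies uniformly convergent polynomials, and
  \<open>norm_peval_le\<close> turns uniform Cauchy on the spectrum into norm Cauchy in the
  algebra.\<close>

lemma has_cfc_exists:
  fixes x :: "'a::cstar_algebra"
  assumes x: "selfadj x" and cont: "continuous_on (rspec x) f"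
  shows "\<exists>y. has_cfc f x y"
proof -
  have "\<exists>p. \<forall>t\<in>rspec x. \<bar>f t - poly p t\<bar> < inverse (real (Suc n))" for n
  proof -
    obtain g where g: "real_polynomial_function g" "\<And>t. t \<in> rspec x \<Longrightarrow> \<bar>f t - g t\<bar> < inverse (real (Suc n))"
      using Stone_Weierstrass_real_polynomial_function[OF compact_rspec cont] by (metis inverse_positive_iff_positive of_nat_0_less_iff zero_less_Suc)
    then obtain a m where "g = (\<lambda>t. \<Sum>i\<le>m. a i * t ^ i)"
      unfolding real_polynomial_function_iff_sum by blast
    then have "g = poly (\<Sum>i\<le>m. monom (a i) i)" by (simp add: fun_eq_iff poly_sum poly_monom)
    then show ?thesis using g by blast
  qed
  then obtain P where "\<And>n t. t \<in> rspec x \<Longrightarrow> \<bar>f t - poly (P n) t\<bar> < inverse (real (Suc n))" by metis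
  then have P: "\<And>n t. t \<in> rspec x \<Longrightarrow> dist (poly (P n) t) (f t) < inverse (real (Suc n))"
    by (simp add: dist_real_def abs_minus_commute)
  have lim: "uniform_limit (rspec x) (\<lambda>n. poly (P n)) f sequentially"
  proof (rule uniform_limitI)
    fix e :: real assume "e > 0"
    with LIMSEQ_inverse_real_of_nat have "\<forall>\<^sub>F n in sequentially. inverse (real (Suc n)) < e"
      by (rule order_tendstoD)
    then show "\<forall>\<^sub>F n in sequentially. \<forall>t\<in>rspec x. dist (poly (P n) t) (f t) < e"
      by eventually_elim (intro ballI less_trans[OF P])
  qed
  have "Cauchy (\<lambda>n. peval (P n) x)"
  proof (rule CauchyI)
    fix e :: real assume "e > 0"
    then obtain N where N: "\<And>n t. n \<ge> N \<Longrightarrow> t \<in> rspec x \<Longrightarrow> dist (poly (P n) t) (f t) < e / 4"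
      using uniform_limitD[OF lim, of "e / 4"] unfolding eventually_sequentially by auto
    have "norm (peval (P m) x - peval (P n) x) < e" if "m \<ge> N" "n \<ge> N" for m n
    proof -
      have "norm (peval (P m - P n) x) \<le> e / 2"
      proof (rule norm_peval_le[OF x])
        fix t assume "t \<in> rspec x"
        then show "\<bar>poly (P m - P n) t\<bar> \<le> e / 2"
          using N[OF that(1), of t] N[OF that(2), of t] unfolding dist_real_def poly_diff by argo
      qed
      then show ?thesis using \<open>e > 0\<close> by (simp add: peval_diff)
    qed
    then show "\<exists>M. \<forall>m\<ge>M. \<forall>n\<ge>M. norm (peval (P m) x - peval (P n) x) < e" by blast
  qed
  then show ?thesis using lim unfolding has_cfc_def Cauchy_convergent_iff convergent_def by blast
qed

lemma has_cfc_cfc: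
  fixes x :: "'a::cstar_algebra"
  assumes "selfadj x" "continuous_on (rspec x) f"
  shows "has_cfc f x (cfc f x)"
  using has_cfc_exists[OF assms] cfc_eqI[OF assms(1)] by metis

lemma cfc_cong:
  assumes "\<And>t. t \<in> rspec x \<Longrightarrow> f t = g t"
  shows "cfc f x = cfc g x"
proof -
  have "has_cfc f x = has_cfc g x" by (intro ext has_cfc_cong assms)
  then show ?thesis unfolding cfc_def has_cfc_iff[symmetric] by simp
qed

lemma has_cfc_selfadj:
  fixes x :: "'a::cstar_algebra"
  shows "selfadj x \<Longrightarrow> has_cfc f x y \<Longrightarrow> selfadj y"
  unfolding has_cfc_def by (metis selfadj_limit selfadj_peval)

lemma has_cfc_positive:
  fixes x :: "'a::cstar_algebra"
  assumes x: "selfadj x" and fc: "has_cfc f x y" and f: "\<And>t. t \<in> rspec x \<Longrightarrow> 0 \<le> f t"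
  shows "positive_el y"
proof -
  obtain c where c: "\<And>t. t \<in> rspec x \<Longrightarrow> \<bar>f t\<bar> \<le> c"
    using has_cfc_bounded[OF fc] unfolding bounded_iff by auto
  have "norm (of_real c - y) \<le> c"
  proof (rule has_cfc_norm_le[OF x has_cfc_diff[OF has_cfc_const fc]])
    fix t assume "t \<in> rspec x"
    then show "\<bar>c - f t\<bar> \<le> c" using c[of t] f[of t] by linarith
  qed
  then show ?thesis using has_cfc_selfadj[OF x fc] by (rule positive_elI_norm[rotated])
qed

lemma has_cfc_invertible:
  fixes x :: "'a::cstar_algebra"
  assumes x: "selfadj x" and fc: "has_cfc f x y"
    and cont: "continuous_on (rspec x) f" and f: "\<And>t. t \<in> rspec x \<Longrightarrow> f t \<noteq> 0"
  shows "invertible_el y"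
proof -
  have "continuous_on (rspec x) (\<lambda>t. inverse (f t))" using cont f by (intro continuous_intros) auto
  then obtain z where z: "has_cfc (\<lambda>t. inverse (f t)) x z" using has_cfc_exists[OF x] by blast
  have "has_cfc (\<lambda>t. f t * inverse (f t)) x (y * z)" "has_cfc (\<lambda>t. inverse (f t) * f t) x (z * y)"
    by (intro has_cfc_mult fc z)+
  then have "has_cfc (\<lambda>t. 1) x (y * z)" "has_cfc (\<lambda>t. 1) x (z * y)"
    by (subst has_cfc_cong; simp add: f)+
  then have "y * z = 1" "z * y = 1" using has_cfc_const[of 1 x] cfc_eqI[OF x] by (metis of_real_1)+
  then show ?thesis unfolding invertible_el_def by blast
qed

lemma rspec_has_cfc:
  fixes x :: "'a::cstar_algebra"
  assumes x: "selfadj x" and fc: "has_cfc f x y" and cont: "continuous_on (rspec x) f"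
  shows "rspec y \<subseteq> f ` rspec x"
proof
  fix s assume "s \<in> rspec y"
  moreover have "has_cfc (\<lambda>t. f t - s) x (y - of_real s)" by (intro has_cfc_diff fc has_cfc_const)
  moreover have "continuous_on (rspec x) (\<lambda>t. f t - s)" by (intro continuous_intros cont)
  ultimately show "s \<in> f ` rspec x" using has_cfc_invertible[OF x] unfolding rspec_def by fastforce
qed

lemma has_cfc_poly_compose: "has_cfc f x y \<Longrightarrow> has_cfc (\<lambda>t. poly p (f t)) x (peval p y)"
proof (induction p)
  case 0 then show ?case using has_cfc_const[of 0 x] by simp
next
  case (pCons a p)
  then show ?case unfolding poly_pCons peval_pCons by (intro has_cfc_add has_cfc_mult has_cfc_const) auto
qed

text \<open>One polynomial q close to g on the image of f serves both sides: q(f(t)) approximates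
  g(f(t)) on the spectrum of x, and q approximates g on the spectrum of y, which lies in that image.
  Both values are thus within e/2 of q(y).\<close>

lemma has_cfc_compose:
  fixes x :: "'a::cstar_algebra"
  assumes x: "selfadj x" and fc: "has_cfc f x y" and f: "continuous_on (rspec x) f"
    and g: "continuous_on (f ` rspec x) g"
  shows "has_cfc (\<lambda>t. g (f t)) x (cfc g y)"
proof -
  have y: "selfadj y" using has_cfc_selfadj[OF x fc] .
  have "continuous_on (rspec y) g" using g rspec_has_cfc[OF x fc f] by (rule continuous_on_subset)
  then have gy: "has_cfc g y (cfc g y)" by (rule has_cfc_cfc[OF y])
  have "continuous_on (rspec x) (\<lambda>t. g (f t))" using continuous_on_compose[OF f g] by (simp add: o_def)
  then obtain w where w: "has_cfc (\<lambda>t. g (f t)) x w" using has_cfc_exists[OF x] by blast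
  have "norm (w - cfc g y) \<le> 0"
  proof (rule field_le_epsilon)
    fix e :: real assume "e > 0"
    moreover have "compact (f ` rspec x)" by (intro compact_continuous_image compact_rspec f)
    ultimately obtain q where q: "real_polynomial_function q" "\<And>t. t \<in> f ` rspec x \<Longrightarrow> \<bar>g t - q t\<bar> < e / 2"
      using Stone_Weierstrass_real_polynomial_function[OF _ g] by (metis half_gt_zero)
    then obtain a m where "q = (\<lambda>t. \<Sum>i\<le>m. a i * t ^ i)"
      unfolding real_polynomial_function_iff_sum by blast
    then have qp: "q = poly (\<Sum>i\<le>m. monom (a i) i)" (is "_ = poly ?p") by (simp add: fun_eq_iff poly_sum poly_monom)
    have "norm (w - peval ?p y) \<le> e / 2"
      by (rule has_cfc_norm_le[OF x has_cfc_diff[OF w has_cfc_poly_compose[OF fc]]])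
        (use q qp in \<open>auto intro: less_imp_le\<close>)
    moreover have "norm (cfc g y - peval ?p y) \<le> e / 2"
      by (rule has_cfc_norm_le[OF y has_cfc_diff[OF gy has_cfc_poly]])
        (use q qp rspec_has_cfc[OF x fc f] in \<open>auto intro!: less_imp_le\<close>)
    ultimately show "norm (w - cfc g y) \<le> 0 + e"
      using norm_triangle_ineq4[of "w - peval ?p y" "cfc g y - peval ?p y"] by simp
  qed
  then show ?thesis using w by simp
qed

lemma cfc_compose:
  fixes x :: "'a::cstar_algebra"
  assumes "selfadj x" "continuous_on (rspec x) f" "continuous_on (f ` rspec x) g"
  shows "cfc g (cfc f x) = cfc (\<lambda>t. g (f t)) x"
  using cfc_eqI[OF assms(1) has_cfc_compose[OF assms(1) has_cfc_cfc[OF assms(1,2)] assms(2,3)]] by simp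

lemma rspec_pos_inv: "pos_inv (x::'a::cstar_algebra) \<Longrightarrow> rspec x \<subseteq> {0<..}"
  unfolding pos_inv_def positive_el_def rspec_def
  by (force simp: less_le)

lemma pos_inv_has_cfc:
  fixes x :: "'a::cstar_algebra"
  assumes "selfadj x" "has_cfc f x y" "continuous_on (rspec x) f" "\<And>t. t \<in> rspec x \<Longrightarrow> 0 < f t"
  shows "pos_inv y"
  unfolding pos_inv_def using assms
  by (metis has_cfc_invertible has_cfc_positive less_imp_le less_irrefl)

section \<open>Exponential and logarithm\<close>

lemma peval_sum: "peval (sum p I) x = (\<Sum>i\<in>I. peval (p i) x)"
  by (induction I rule: infinite_finite_induct) (simp_all add: peval_add)

lemma peval_monom: "peval (monom a i) x = a *\<^sub>R x ^ i"
  by (induction i) (simp_all add: monom_0 monom_Suc peval_pCons of_real_def)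

text \<open>Identifies the power series exponential with the functional calculus: the same partial
  sums converge in the algebra and, with the series at |r| norm x as majorant, uniformly on the
  spectrum.\<close>

lemma has_cfc_exp_scaleR:
  fixes x :: "'a::cstar_algebra"
  shows "has_cfc (\<lambda>t. exp (r * t)) x (exp (r *\<^sub>R x))"
proof -
  define P where "P n = (\<Sum>i<n. monom (r ^ i / fact i) i)" for n
  have P: "poly (P n) t = (\<Sum>i<n. (r * t) ^ i /\<^sub>R fact i)" "peval (P n) x = (\<Sum>i<n. (r *\<^sub>R x) ^ i /\<^sub>R fact i)" for n t
    by (simp_all add: P_def poly_sum peval_sum poly_monom peval_monom power_mult_distrib field_simps)
  have "uniform_limit (rspec x) (\<lambda>n t. \<Sum>i<n. (r * t) ^ i /\<^sub>R fact i) (\<lambda>t. \<Sum>i. (r * t) ^ i /\<^sub>R fact i) sequentially"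
  proof (rule Weierstrass_m_test)
    show "summable (\<lambda>i. (\<bar>r\<bar> * norm x) ^ i /\<^sub>R fact i)" by (rule summable_exp_generic)
    fix i t assume "t \<in> rspec x"
    then have "\<bar>r * t\<bar> \<le> \<bar>r\<bar> * norm x" using rspec_bounded[of t x] by (simp add: abs_mult mult_left_mono)
    then have "\<bar>r * t\<bar> ^ i \<le> (\<bar>r\<bar> * norm x) ^ i" by (intro power_mono) auto
    then show "norm ((r * t) ^ i /\<^sub>R fact i) \<le> (\<bar>r\<bar> * norm x) ^ i /\<^sub>R fact i"
      unfolding real_scaleR_def real_norm_def abs_mult[of "inverse (fact i)"] power_abs
      by (intro mult_mono) auto
  qed
  moreover have "(\<lambda>n. peval (P n) x) \<longlonglongrightarrow> exp (r *\<^sub>R x)"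
    using exp_converges[of "r *\<^sub>R x"] unfolding sums_def P .
  ultimately show ?thesis
    unfolding has_cfc_def exp_def[where 'a = real] by (intro exI[of _ P]) (simp add: P(1)[abs_def])
qed

lemma exp_minus_inverses:
  fixes x :: "'a::{real_normed_algebra_1,banach}"
  shows "exp x * exp (- x) = 1" "exp (- x) * exp x = 1"
  using exp_minus_inverse[of x] exp_minus_inverse[of "- x"] by simp_all

lemma pos_inv_exp:
  fixes x :: "'a::cstar_algebra"
  assumes "selfadj x"
  shows "pos_inv (exp x)"
  by (rule pos_inv_has_cfc[OF assms has_cfc_exp_scaleR[of 1 x, unfolded scaleR_one]])
    (auto intro!: continuous_intros)

lemma cfc_exp:
  fixes x :: "'a::cstar_algebra"
  assumes "selfadj x"
  shows "cfc exp x = exp x"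
  using cfc_eqI[OF assms has_cfc_exp_scaleR[of 1 x]] by simp

lemma cfc_of_exp:
  fixes x :: "'a::cstar_algebra"
  assumes "selfadj x" "continuous_on {0<..} f"
  shows "cfc f (exp x) = cfc (\<lambda>t. f (exp t)) x"
proof -
  have "continuous_on (exp ` rspec x) f" using assms(2) by (rule continuous_on_subset) auto
  then show ?thesis
    using cfc_compose[OF assms(1), of exp f] cfc_exp[OF assms(1)] by (simp add: continuous_on_exp)
qed

lemma continuous_on_ln_greaterThan: "continuous_on {0<..} (ln :: real \<Rightarrow> real)"
  by (rule continuous_on_ln[OF continuous_on_id]) auto

lemma cfc_ln_exp:
  fixes x :: "'a::cstar_algebra"
  assumes "selfadj x"
  shows "cfc ln (exp x) = x"
  using cfc_of_exp[OF assms continuous_on_ln_greaterThan] cfc_eqI[OF assms has_cfc_ident] by simp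

lemma cfc_powr_exp:
  fixes x :: "'a::cstar_algebra"
  assumes "selfadj x"
  shows "cfc (\<lambda>t. t powr r) (exp x) = exp (r *\<^sub>R x)"
proof -
  have "cfc (\<lambda>t. t powr r) (exp x) = cfc (\<lambda>t. exp (r * t)) x"
    by (subst cfc_of_exp[OF assms]) (auto intro!: continuous_on_powr' continuous_on_id continuous_on_const simp: exp_powr_real mult.commute)
  then show ?thesis using cfc_eqI[OF assms has_cfc_exp_scaleR] by simp
qed

lemma exp_inj_selfadj:
  fixes x y :: "'a::cstar_algebra"
  shows "selfadj x \<Longrightarrow> selfadj y \<Longrightarrow> exp x = exp y \<Longrightarrow> x = y"
  using cfc_ln_exp by metis

lemma selfadj_cfc:
  fixes x :: "'a::cstar_algebra"
  assumes "selfadj x" "continuous_on (rspec x) f"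
  shows "selfadj (cfc f x)"
  using has_cfc_selfadj has_cfc_cfc assms by blast

lemma
  fixes a :: "'a::cstar_algebra"
  assumes "pos_inv a"
  shows selfadj_ln: "selfadj (cfc ln a)" and exp_ln_pos_inv: "exp (cfc ln a) = a"
proof -
  have a: "selfadj a" "rspec a \<subseteq> {0<..}" using assms rspec_pos_inv pos_inv_selfadj by auto
  then have cont: "continuous_on (rspec a) ln" by (auto intro!: continuous_intros)
  show sa: "selfadj (cfc ln a)" using selfadj_cfc a cont by blast
  have "exp (cfc ln a) = cfc exp (cfc ln a)" using cfc_exp[OF sa] by simp
  also have "\<dots> = cfc (\<lambda>t. exp (ln t)) a" by (rule cfc_compose[OF a(1) cont]) (intro continuous_intros)
  also have "\<dots> = cfc (\<lambda>t. t) a" using a(2) by (intro cfc_cong) auto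
  finally show "exp (cfc ln a) = a" using cfc_eqI[OF a(1) has_cfc_ident] by simp
qed

lemma tendsto_exp_difference_quotient:
  fixes x :: "'a::{real_normed_algebra_1,banach}"
  shows "((\<lambda>h. (1 / h) *\<^sub>R (exp (h *\<^sub>R x) - 1)) \<longlongrightarrow> x) (at_right 0)"
proof -
  have "((\<lambda>h. exp (h *\<^sub>R x)) has_vector_derivative exp (0 *\<^sub>R x) * x) (at 0 within {0<..})"
    by (rule exp_scaleR_has_vector_derivative_right)
  then have "((\<lambda>h. exp (h *\<^sub>R x)) has_vector_derivative x) (at_right 0)" by simp
  then have "((\<lambda>h. (1 / norm (h - 0)) *\<^sub>R (exp (h *\<^sub>R x) - (exp (0 *\<^sub>R x) + (h - 0) *\<^sub>R x))) \<longlongrightarrow> 0) (at_right 0)"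
    unfolding has_vector_derivative_def has_derivative_within by blast
  then have "((\<lambda>h. (1 / norm (h - 0)) *\<^sub>R (exp (h *\<^sub>R x) - (exp (0 *\<^sub>R x) + (h - 0) *\<^sub>R x)) + x) \<longlongrightarrow> 0 + x) (at_right 0)"
    by (intro tendsto_add tendsto_const)
  moreover have "\<forall>\<^sub>F h in at_right 0. (1 / norm (h - 0)) *\<^sub>R (exp (h *\<^sub>R x) - (exp (0 *\<^sub>R x) + (h - 0) *\<^sub>R x)) + x
      = (1 / h) *\<^sub>R (exp (h *\<^sub>R x) - 1)"
    using eventually_at_right_less[of "0::real"] by eventually_elim (simp add: algebra_simps)
  ultimately show ?thesis by (subst (asm) tendsto_cong) auto
qed

section \<open>The order of self-adjoint elements\<close>

lemma cle_refl [simp]: "selfadj (x::'a::cstar_algebra) \<Longrightarrow> cle x x"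
  by (simp add: cle_def)

lemma cle_trans: "cle x y \<Longrightarrow> cle y z \<Longrightarrow> cle x (z::'a::cstar_algebra)"
  unfolding cle_def using positive_el_add[of "y - x" "z - y"] by auto

lemma cle_antisym: "cle x y \<Longrightarrow> cle y x \<Longrightarrow> x = (y::'a::cstar_algebra)"
  unfolding cle_def using positive_el_antisym[of "y - x"] by auto

lemma cle_scaleR: "cle x y \<Longrightarrow> r \<ge> 0 \<Longrightarrow> cle (r *\<^sub>R x) (r *\<^sub>R (y::'a::cstar_algebra))"
  unfolding cle_def using positive_el_scaleR[of "y - x" r] by (auto simp: algebra_simps intro: selfadj_intros)

lemma cle_add_right: "selfadj z \<Longrightarrow> cle (x + z) (y + z) \<longleftrightarrow> cle x (y::'a::cstar_algebra)"
  unfolding cle_def by (auto intro: selfadj_intros) (metis add_diff_cancel_right' selfadj_intros(2))+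

lemma cle_congruence: "cle x y \<Longrightarrow> selfadj z \<Longrightarrow> cle (z * x * z) (z * y * (z::'a::cstar_algebra))"
  unfolding cle_def using positive_el_congruence[of "y - x" z] 
  by (auto simp: left_diff_distrib right_diff_distrib intro: selfadj_intros(6))

lemma cle_limit:
  fixes x y :: "'a::cstar_algebra"
  assumes "X \<longlonglongrightarrow> x" "Y \<longlonglongrightarrow> y" "\<And>n. cle (X n) (Y n)"
  shows "cle x y"
  using assms selfadj_limit[OF assms(1)] selfadj_limit[OF assms(2)] positive_el_limit[OF tendsto_diff[OF assms(2,1)]]
  unfolding cle_def by blast

lemma cle_0_iff: "cle 0 (x::'a::cstar_algebra) \<longleftrightarrow> positive_el x"
  unfolding cle_def by (auto dest: positive_elD)

lemma pos_inv_bounds: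
  fixes x :: "'a::cstar_algebra"
  assumes "pos_inv x"
  obtains d where "d > 0" "cle (of_real d) x"
  using assms unfolding pos_inv_iff cle_def by auto

lemma cle_norm:
  fixes x :: "'a::cstar_algebra"
  shows "selfadj x \<Longrightarrow> cle x (of_real (norm x))"
  unfolding cle_def using positive_el_norm_minus by auto

text \<open>\<open>q - p = (q\<^sup>2 - p\<^sup>2) (q + p)\<^sup>-\<^sup>1\<close>.\<close>
lemma cle_if_squares_cle:
  fixes p q :: "'a::cstar_algebra"
  assumes "positive_el p" "pos_inv q" "p * q = q * p" "cle (p * p) (q * q)"
  shows "cle p q"
proof -
  have "pos_inv (p + q)" using assms by (intro pos_inv_add)
  then obtain u where u: "(p + q) * u = 1" "u * (p + q) = 1" unfolding pos_inv_def invertible_el_def by blast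
  then have "positive_el u" using pos_inv_inverse[OF \<open>pos_inv (p + q)\<close>] pos_inv_positive by blast
  have fact: "q * q - p * p = (q - p) * (p + q)" "q * q - p * p = (p + q) * (q - p)"
    using assms(3) by (simp_all add: algebra_simps)
  have "(q * q - p * p) * u = (q - p) * ((p + q) * u)" unfolding fact(1) by (simp only: mult.assoc)
  moreover have "u * (q * q - p * p) = (u * (p + q)) * (q - p)" unfolding fact(2) by (simp only: mult.assoc)
  ultimately have eq: "(q * q - p * p) * u = q - p" "u * (q * q - p * p) = q - p" using u by simp_all
  have "positive_el ((q * q - p * p) * u)"
    using assms(4) \<open>positive_el u\<close> eq by (intro positive_el_mult) (auto simp: cle_def)
  then show ?thesis unfolding eq cle_def using assms(1,2) pos_inv_selfadj positive_elD by blast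
qed

text \<open>Congruence by exp (- y / 2) reduces the claim to c \<le> 1 for a positive invertible c
  with inverse c'. There c' - 1 = c' (1 - c) is a product of commuting positive elements, and the
  same congruence, applied to 1 \<le> c', gives the result.\<close>

lemma cle_inverse_antimono:
  fixes x y :: "'a::cstar_algebra"
  assumes "selfadj x" "selfadj y" "cle (exp x) (exp y)"
  shows "cle (exp (- y)) (exp (- x))"
proof -
  have hy: "selfadj ((1/2) *\<^sub>R y)" "selfadj (- ((1/2) *\<^sub>R y))" using assms by (auto intro: selfadj_intros)
  define u v where "u = exp ((1/2) *\<^sub>R y)" and "v = exp (- ((1/2) *\<^sub>R y))"
  have uv: "u * v = 1" "v * u = 1" unfolding u_def v_def by (rule exp_minus_inverses)+
  have sq: "u * u = exp y" "v * v = exp (- y)"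
    unfolding u_def v_def by (simp_all add: exp_add_commuting[symmetric] scaleR_2[symmetric] flip: scaleR_2)
  have sa: "pos_inv v" "pos_inv u" "pos_inv (exp x)" unfolding u_def v_def using hy assms by (auto intro: pos_inv_exp)
  define c where "c = v * exp x * v"
  define c' where "c' = u * exp (- x) * u"
  have cc: "c * c' = 1" "c' * c = 1"
  proof -
    have "c * c' = v * (exp x * ((v * u) * exp (- x))) * u" "c' * c = u * (exp (-x) * ((u * v) * exp x)) * v"
      unfolding c_def c'_def by (simp_all only: mult.assoc)
    then show "c * c' = 1" "c' * c = 1"
      using uv exp_minus_inverse[of x] exp_minus_inverse[of "-x"] by simp_all
  qed
  have c: "pos_inv c" unfolding c_def using sa by (intro pos_inv_congruence) (auto simp: pos_inv_def positive_el_def)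
  then have c': "pos_inv c'" using pos_inv_inverse cc by blast
  have "cle c (v * exp y * v)" unfolding c_def using assms sa by (intro cle_congruence pos_inv_selfadj)
  also have "v * exp y * v = (v * u) * (u * v)" unfolding sq(1)[symmetric] by (simp only: mult.assoc)
  finally have "positive_el (1 - c)" using uv by (simp add: cle_def)
  then have "positive_el (c' * (1 - c))"
    using c' cc by (intro positive_el_mult) (auto simp: pos_inv_def algebra_simps)
  then have "cle 1 c'" using cc pos_inv_selfadj[OF c'] by (simp add: cle_def algebra_simps)
  then have "cle (v * 1 * v) (v * c' * v)" using sa by (intro cle_congruence pos_inv_selfadj)
  moreover have "v * c' * v = (v * u) * exp (- x) * (u * v)" unfolding c'_def by (simp only: mult.assoc)
  ultimately show ?thesis using uv sq by simp
qed

section \<open>Reflections in ordered spaces with translations\<close>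

text \<open>The sign puts isomorphisms and reflections, which reverse both the order and the
  translations, into one class closed under composition and inverses; signs multiply, so words with
  an even number of reflections are again genuine isomorphisms.\<close>

definition signed_iso ::
  "bool \<Rightarrow> 'x set \<Rightarrow> ('x \<Rightarrow> 'x \<Rightarrow> bool) \<Rightarrow> (real \<Rightarrow> 'x \<Rightarrow> 'x) \<Rightarrow>
    'y set \<Rightarrow> ('y \<Rightarrow> 'y \<Rightarrow> bool) \<Rightarrow> (real \<Rightarrow> 'y \<Rightarrow> 'y) \<Rightarrow> ('x \<Rightarrow> 'y) \<Rightarrow> bool" where
  "signed_iso \<sigma> S le tr S' le' tr' g \<longleftrightarrow> bij_betw g S S'
    \<and> (\<forall>x\<in>S. \<forall>y\<in>S. le x y \<longleftrightarrow> (if \<sigma> then le' (g x) (g y) else le' (g y) (g x)))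
    \<and> (\<forall>s. \<forall>x\<in>S. g (tr s x) = tr' (if \<sigma> then s else - s) (g x))"

lemma signed_iso_comp:
  assumes "signed_iso \<sigma> S le tr S' le' tr' g" "signed_iso \<tau> S' le' tr' S'' le'' tr'' h"
  shows "signed_iso (\<sigma> \<longleftrightarrow> \<tau>) S le tr S'' le'' tr'' (\<lambda>x. h (g x))"
proof -
  have g: "g x \<in> S'" if "x \<in> S" for x using assms(1) that unfolding signed_iso_def by (auto dest: bij_betwE)
  have "bij_betw (\<lambda>x. h (g x)) S S''"
    using assms bij_betw_trans[of g S S' h S''] unfolding signed_iso_def by (simp add: o_def)
  then show ?thesis using assms g unfolding signed_iso_def by auto
qed

lemma signed_iso_inv:
  assumes "signed_iso \<sigma> S le tr S' le' tr' g" and tr: "\<And>s x. x \<in> S \<Longrightarrow> tr s x \<in> S"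
  shows "signed_iso \<sigma> S' le' tr' S le tr (inv_into S g)"
proof -
  have bij: "bij_betw g S S'" using assms unfolding signed_iso_def by blast
  have inv: "inv_into S g y \<in> S" "g (inv_into S g y) = y" if "y \<in> S'" for y
    using bij_betwE[OF bij_betw_inv_into[OF bij]] bij_betw_inv_into_right[OF bij] that by auto
  have "inv_into S g (tr' s y) = tr (if \<sigma> then s else - s) (inv_into S g y)" if "y \<in> S'" for s y
  proof -
    have "g (tr (if \<sigma> then s else - s) (inv_into S g y)) = tr' s y"
      using assms(1) inv[OF that] unfolding signed_iso_def by auto
    then show ?thesis using bij_betw_inv_into_left[OF bij tr[OF inv(1)[OF that]]] by metis
  qed
  moreover have "le' x y \<longleftrightarrow> (if \<sigma> then le (inv_into S g x) (inv_into S g y) else le (inv_into S g y) (inv_into S g x))"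
    if "x \<in> S'" "y \<in> S'" for x y
    using assms(1) inv[OF that(1)] inv[OF that(2)] unfolding signed_iso_def by auto
  ultimately show ?thesis using bij_betw_inv_into[OF bij] unfolding signed_iso_def by blast
qed

text \<open>\<open>le x (tr s y) \<and> le y (tr s x)\<close> plays the role of \<open>d(x, y) \<le> s\<close> for a metric \<open>d\<close>;
  for this metric, \<open>R m\<close> is an isometric involution that fixes \<open>m\<close> and moves every point \<open>x\<close> by
  \<open>2 d(x, m)\<close>.\<close>
locale reflection_space =
  fixes S :: "'x set" and le :: "'x \<Rightarrow> 'x \<Rightarrow> bool" and tr :: "real \<Rightarrow> 'x \<Rightarrow> 'x" and R :: "'x \<Rightarrow> 'x \<Rightarrow> 'x"
  assumes trans: "le x y \<Longrightarrow> le y z \<Longrightarrow> le x z"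
    and antisym: "x \<in> S \<Longrightarrow> y \<in> S \<Longrightarrow> le x y \<Longrightarrow> le y x \<Longrightarrow> x = y"
    and tr_closed: "x \<in> S \<Longrightarrow> tr s x \<in> S"
    and tr_add: "x \<in> S \<Longrightarrow> tr s (tr t x) = tr (s + t) x"
    and tr_0: "x \<in> S \<Longrightarrow> tr 0 x = x"
    and tr_mono: "x \<in> S \<Longrightarrow> y \<in> S \<Longrightarrow> le x y \<Longrightarrow> le (tr s x) (tr s y)"
    and tr_le: "x \<in> S \<Longrightarrow> s \<ge> 0 \<Longrightarrow> le x (tr s x)"
    and tr_bound: "x \<in> S \<Longrightarrow> y \<in> S \<Longrightarrow> \<exists>s. le x (tr s y)"
    and tr_closure: "x \<in> S \<Longrightarrow> y \<in> S \<Longrightarrow> (\<And>s. s > 0 \<Longrightarrow> le x (tr s y)) \<Longrightarrow> le x y"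
    and R_closed: "m \<in> S \<Longrightarrow> x \<in> S \<Longrightarrow> R m x \<in> S"
    and R_R: "m \<in> S \<Longrightarrow> x \<in> S \<Longrightarrow> R m (R m x) = x"
    and R_self: "m \<in> S \<Longrightarrow> R m m = m"
    and R_antimono: "m \<in> S \<Longrightarrow> x \<in> S \<Longrightarrow> y \<in> S \<Longrightarrow> le x y \<Longrightarrow> le (R m y) (R m x)"
    and R_tr: "m \<in> S \<Longrightarrow> x \<in> S \<Longrightarrow> R m (tr s x) = tr (- s) (R m x)"
    and R_half1: "m \<in> S \<Longrightarrow> x \<in> S \<Longrightarrow> le (R m x) (tr (2 * s) x) \<Longrightarrow> le m (tr s x)"
    and R_half2: "m \<in> S \<Longrightarrow> x \<in> S \<Longrightarrow> le x (tr (2 * s) (R m x)) \<Longrightarrow> le x (tr s m)"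
    and midpoint: "x \<in> S \<Longrightarrow> y \<in> S \<Longrightarrow> \<exists>m\<in>S. R m x = y"
begin

definition near :: "real \<Rightarrow> 'x \<Rightarrow> 'x \<Rightarrow> bool" where
  "near s x y \<longleftrightarrow> le x (tr s y) \<and> le y (tr s x)"

lemma near_sym: "near s x y \<longleftrightarrow> near s y x"
  by (auto simp: near_def)

lemma near_triangle:
  assumes "x \<in> S" "y \<in> S" "z \<in> S" "near s x y" "near t y z"
  shows "near (s + t) x z"
proof -
  have "le (tr s y) (tr s (tr t z))" "le (tr t y) (tr t (tr s x))"
    using assms by (auto simp: near_def intro: tr_mono tr_closed)
  then show ?thesis
    using assms trans unfolding near_def by (auto simp: tr_add add.commute)
qed

lemma near_mono:
  assumes "x \<in> S" "y \<in> S" "near s x y" "s \<le> t"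
  shows "near t x y"
proof -
  have "le (tr s z) (tr t z)" if "z \<in> S" for z
    using tr_le[OF tr_closed[OF that, of s], of "t - s"] assms that by (simp add: tr_add)
  then show ?thesis using assms trans unfolding near_def by blast
qed

lemma near_bound:
  assumes "x \<in> S" "y \<in> S"
  shows "\<exists>s. near s x y"
proof -
  obtain s t where "le x (tr s y)" "le y (tr t x)" using tr_bound assms by blast
  moreover have "le (tr r z) (tr (max s t) z)" if "z \<in> S" "r \<le> max s t" for r z
    using tr_le[OF tr_closed[OF that(1), of r], of "max s t - r"] that by (simp add: tr_add)
  ultimately have "near (max s t) x y" using assms trans unfolding near_def by (meson max.cobounded1 max.cobounded2)
  then show ?thesis ..
qed

lemma near_closure:
  assumes "x \<in> S" "y \<in> S" "\<And>s. s > 0 \<Longrightarrow> near s x y"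
  shows "x = y"
proof (rule antisym)
  show "le x y" "le y x"
    by (rule tr_closure; use assms near_def in blast)+
qed (use assms in auto)

lemma signed_iso_R:
  assumes "m \<in> S"
  shows "signed_iso False S le tr S le tr (R m)"
proof -
  have "bij_betw (R m) S S"
    by (rule bij_betwI[of _ _ _ "R m"]) (auto simp: R_closed R_R assms)
  then show ?thesis
    unfolding signed_iso_def
  proof (intro conjI allI ballI)
    fix x y assume "x \<in> S" "y \<in> S"
    then show "le x y \<longleftrightarrow> (if False then le (R m x) (R m y) else le (R m y) (R m x))"
      using R_antimono[OF assms, of x y] R_antimono[OF assms, of "R m y" "R m x"] R_R R_closed assms by auto
  qed (auto simp: R_tr assms)
qed

end

text \<open>For a reversing map, the negative translation is moved to the other side of the
  inequality, and the two conjuncts of \<open>near\<close> change places.\<close>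

lemma signed_iso_near:
  assumes "reflection_space S le tr R" "reflection_space S' le' tr' R'"
    and g: "signed_iso \<sigma> S le tr S' le' tr' g" and xy: "x \<in> S" "y \<in> S"
  shows "reflection_space.near le tr s x y \<longleftrightarrow> reflection_space.near le' tr' s (g x) (g y)"
proof -
  interpret A: reflection_space S le tr R by fact
  interpret B: reflection_space S' le' tr' R' by fact
  have gS: "g z \<in> S'" if "z \<in> S" for z using g that unfolding signed_iso_def by (auto dest: bij_betwE)
  have *: "le x (tr s y) \<longleftrightarrow> (if \<sigma> then le' (g x) (tr' s (g y)) else le' (g y) (tr' s (g x)))"
    if xy: "x \<in> S" "y \<in> S" for x y
  proof (cases \<sigma>)
    case True then show ?thesis using g xy A.tr_closed unfolding signed_iso_def by auto
  next
    case False
    then have "le x (tr s y) \<longleftrightarrow> le' (tr' (- s) (g y)) (g x)"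
      using g xy A.tr_closed unfolding signed_iso_def by auto
    also have "\<dots> \<longleftrightarrow> le' (g y) (tr' s (g x))"
    proof
      assume "le' (tr' (- s) (g y)) (g x)"
      then have "le' (tr' s (tr' (- s) (g y))) (tr' s (g x))" using gS xy by (intro B.tr_mono B.tr_closed)
      then show "le' (g y) (tr' s (g x))" using gS xy by (simp add: B.tr_add B.tr_0)
    next
      assume "le' (g y) (tr' s (g x))"
      then have "le' (tr' (- s) (g y)) (tr' (- s) (tr' s (g x)))" using gS xy by (intro B.tr_mono B.tr_closed)
      then show "le' (tr' (- s) (g y)) (g x)" using gS xy by (simp add: B.tr_add B.tr_0)
    qed
    finally show ?thesis using False by simp
  qed
  show ?thesis
    unfolding A.near_def B.near_def using *[OF xy] *[OF xy(2,1)] by auto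
qed

context reflection_space
begin

lemma near_iso:
  "signed_iso \<sigma> S le tr S le tr g \<Longrightarrow> x \<in> S \<Longrightarrow> y \<in> S \<Longrightarrow> near s (g x) (g y) \<longleftrightarrow> near s x y"
  using signed_iso_near[OF reflection_space_axioms reflection_space_axioms] by blast

text \<open>Vaisala's argument: if \<open>g\<close> fixes \<open>a\<close> and \<open>b\<close> then so does \<open>g' = R\<^sub>m g\<^sup>-\<^sup>1 R\<^sub>m g\<close>, which moves
  \<open>m\<close> twice as far as \<open>g\<close> does.\<close>
lemma iso_fixes_midpoint:
  assumes m: "m \<in> S" and ab: "a \<in> S" "b \<in> S" "R m a = b"
    and g: "signed_iso True S le tr S le tr g" "g a = a" "g b = b"
  shows "g m = m"
proof -
  define G where "G = {g. signed_iso True S le tr S le tr g \<and> g a = a \<and> g b = b}"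
  have GS: "g x \<in> S" if "g \<in> G" "x \<in> S" for g x
    using that unfolding G_def signed_iso_def by (auto dest: bij_betwE)
  obtain l where l: "near l a m" using near_bound ab m by blast
  \<comment> \<open>The bound is proved for all of G at once, since the induction step passes from g
    to the different map g'. It starts at 2 l because every g in G fixes a, which is within l of
    m.\<close>
  have halving: "\<forall>g\<in>G. near (2 * l / 2 ^ n) (g m) m" for n
  proof (induction n)
    case 0
    show ?case
    proof
      fix g assume g: "g \<in> G"
      then have "near l (g a) (g m)" using near_iso[of True g a m] ab m l by (simp add: G_def)
      then have "near l (g m) a" using g near_sym by (simp add: G_def)
      then have "near (l + l) (g m) m" by (rule near_triangle[OF GS[OF g m] ab(1) m _ l])
      then show "near (2 * l / 2 ^ 0) (g m) m" by simp
    qed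
  next
    case (Suc n)
    show ?case
    proof
      fix g assume g: "g \<in> G"
      have iso: "signed_iso True S le tr S le tr g" using g by (simp add: G_def)
      define h where "h = inv_into S g"
      have h: "signed_iso True S le tr S le tr h" unfolding h_def by (intro signed_iso_inv iso tr_closed)
      have inj: "inj_on g S" "bij_betw g S S" using iso by (auto simp: signed_iso_def bij_betw_def)
      have hg: "h (g x) = x" if "x \<in> S" for x using that inj by (simp add: h_def)
      have gh: "g (h x) = x" "h x \<in> S" if "x \<in> S" for x
        using that bij_betw_inv_into_right[OF inj(2)] h by (auto simp: h_def signed_iso_def dest: bij_betwE)
      define g' where "g' x = R m (h (R m (g x)))" for x
      have "signed_iso True S le tr S le tr g'"
        unfolding g'_def
        using signed_iso_comp[OF signed_iso_comp[OF signed_iso_comp[OF iso signed_iso_R[OF m]] h] signed_iso_R[OF m]]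
        by simp
      moreover have "R m b = a" using ab R_R[OF m ab(1)] by simp
      then have "g' a = a" "g' b = b"
        using g ab hg[of a] hg[of b] by (auto simp: g'_def G_def)
      ultimately have "near (2 * l / 2 ^ n) (g' m) m" using Suc by (auto simp: G_def)
      \<comment> \<open>Undoing the outer reflection and then h leaves the distance between g m and
        its mirror image R m (g m), which is twice the distance from g m to m.\<close>
      then have "near (2 * l / 2 ^ n) (R m (h (R m (g m)))) (R m m)" by (simp add: g'_def R_self m)
      then have "near (2 * l / 2 ^ n) (h (R m (g m))) m"
        using near_iso[OF signed_iso_R[OF m] gh(2)[OF R_closed[OF m GS[OF g m]]] m] by blast
      then have "near (2 * l / 2 ^ n) (R m (g m)) (g m)"
        using near_iso[OF iso gh(2)[OF R_closed[OF m GS[OF g m]]] m]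
          gh(1)[OF R_closed[OF m GS[OF g m]]] by simp
      then show "near (2 * l / 2 ^ Suc n) (g m) m"
        unfolding near_def using R_half1[OF m GS[OF g m], of "2 * l / 2 ^ Suc n"] R_half2[OF m GS[OF g m], of "2 * l / 2 ^ Suc n"]
        by simp
    qed
  qed
  have gG: "g \<in> G" using g by (simp add: G_def)
  have "near s (g m) m" if "s > 0" for s
  proof -
    have "(\<lambda>n. 2 * l / 2 ^ n) \<longlonglongrightarrow> 0" by (rule LIMSEQ_divide_realpow_zero) simp
    then have "\<forall>\<^sub>F n in sequentially. 2 * l / 2 ^ n < s" using that by (rule order_tendstoD)
    then obtain n where n: "2 * l / 2 ^ n < s" using eventually_happens'[OF sequentially_bot] by blast
    have "near (2 * l / 2 ^ n) (g m) m" using halving gG by blast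
    then show ?thesis by (rule near_mono[OF GS[OF gG m] m]) (use n in simp)
  qed
  then show ?thesis by (rule near_closure[OF GS[OF gG m] m])
qed

end

text \<open>Choose n in the target so that R' n exchanges f x and f b, where b = R m x. The map R m
  f^-1 R' n f fixes x and b, hence also their midpoint m, which says that R' n fixes f m; so n = f
  m.\<close>

theorem iso_preserves_reflections:
  assumes "reflection_space S le tr R" "reflection_space S' le' tr' R'"
    and iso: "signed_iso True S le tr S' le' tr' f" and mx: "m \<in> S" "x \<in> S"
  shows "f (R m x) = R' (f m) (f x)"
proof -
  interpret A: reflection_space S le tr R by fact
  interpret B: reflection_space S' le' tr' R' by fact
  have fS: "f z \<in> S'" if "z \<in> S" for z using iso that unfolding signed_iso_def by (auto dest: bij_betwE)
  define b where "b = R m x"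
  have b: "b \<in> S" "R m b = x" using mx by (auto simp: b_def A.R_closed A.R_R)
  obtain n where n: "n \<in> S'" "R' n (f x) = f b" using B.midpoint fS b mx by blast
  have n': "R' n (f b) = f x" using B.R_R[OF n(1), of "f x"] fS mx n(2) by simp
  define h where "h = inv_into S f"
  have h: "signed_iso True S' le' tr' S le tr h" unfolding h_def by (intro signed_iso_inv iso A.tr_closed)
  have bij: "bij_betw f S S'" using iso by (auto simp: signed_iso_def)
  have hf: "h (f z) = z" if "z \<in> S" for z using that bij_betw_inv_into_left[OF bij] by (simp add: h_def)
  have fh: "f (h z) = z" "h z \<in> S" if "z \<in> S'" for z
    using that bij_betw_inv_into_right[OF bij] h by (auto simp: h_def signed_iso_def dest: bij_betwE)
  define g where "g z = R m (h (R' n (f z)))" for z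
  have "signed_iso True S le tr S le tr g"
    unfolding g_def
    using signed_iso_comp[OF signed_iso_comp[OF signed_iso_comp[OF iso B.signed_iso_R[OF n(1)]] h] A.signed_iso_R[OF mx(1)]]
    by simp
  moreover have "g x = x" "g b = b" using n n' hf b mx by (auto simp: g_def b_def)
  ultimately have "g m = m" by (rule A.iso_fixes_midpoint[OF mx b(1) b_def[symmetric]])
  then have "R m (g m) = m" using A.R_self mx by simp
  then have "h (R' n (f m)) = m" unfolding g_def using A.R_R B.R_closed n(1) fS mx fh(2) by simp
  then have fixed: "R' n (f m) = f m" using fh(1)[of "R' n (f m)"] B.R_closed n(1) fS mx by simp
  \<comment> \<open>With s = 0 the two halving axioms say that a fixed point of R' n can only be
    n.\<close>
  have "le' n (f m)" "le' (f m) n"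
    using B.R_half1[OF n(1) fS[OF mx(1)], of 0] B.R_half2[OF n(1) fS[OF mx(1)], of 0]
      B.tr_le[OF fS[OF mx(1)], of 0] B.tr_0 fS n(1) mx fixed by auto
  then have "n = f m" using B.antisym n fS mx by blast
  then show ?thesis using n(2) by (simp add: b_def)
qed

section \<open>Orders given by exponentials\<close>

text \<open>Case \<open>\<alpha> > 0\<close> is the order \<open>A\<^sup>\<alpha> \<le> B\<^sup>\<alpha>\<close> in the coordinates \<open>A = exp x\<close>, \<open>B = exp y\<close>,
  and case \<open>\<alpha> = 0\<close> the order \<open>log A \<le> log B\<close>.\<close>
definition exp_le :: "real \<Rightarrow> 'a::cstar_algebra \<Rightarrow> 'a \<Rightarrow> bool" where
  "exp_le \<alpha> x y \<longleftrightarrow> (if \<alpha> = 0 then cle x y else cle (exp (\<alpha> *\<^sub>R x)) (exp (\<alpha> *\<^sub>R y)))"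

text \<open>With M = exp (\<alpha> m), the equation M X^-1 M = Y characterizes M as the geometric
  mean of X and Y. So m is the midpoint of x and its image, geometric for \<alpha> > 0 and
  arithmetic for \<alpha> = 0.\<close>

definition exp_reflect :: "real \<Rightarrow> 'a::cstar_algebra \<Rightarrow> 'a \<Rightarrow> 'a" where
  "exp_reflect \<alpha> m x = (if \<alpha> = 0 then m + m - x
     else (1 / \<alpha>) *\<^sub>R cfc ln (exp (\<alpha> *\<^sub>R m) * exp (- (\<alpha> *\<^sub>R x)) * exp (\<alpha> *\<^sub>R m)))"

text \<open>In logarithmic coordinates this is multiplication by the scalar exp s, so homogeneity of
  \<phi> becomes commutation with \<open>translate\<close>.\<close>

definition translate :: "real \<Rightarrow> 'a::cstar_algebra \<Rightarrow> 'a" where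
  "translate s x = x + of_real s"

lemma selfadj_translate: "selfadj x \<Longrightarrow> selfadj (translate s (x::'a::cstar_algebra))"
  unfolding translate_def by (intro selfadj_intros) auto

lemma exp_scaleR_add_of_real:
  "exp (r *\<^sub>R (x + of_real s)) = exp (r * s) *\<^sub>R exp (r *\<^sub>R (x::'a::cstar_algebra))"
proof -
  have "exp (r *\<^sub>R (x + of_real s)) = exp (r *\<^sub>R x) * exp (r *\<^sub>R of_real s)"
    unfolding scaleR_add_right by (intro exp_add_commuting) (simp add: of_real_def)
  also have "exp (r *\<^sub>R of_real s :: 'a) = of_real (exp (r * s))"
    by (simp add: of_real_def exp_of_real[unfolded of_real_def])
  finally show ?thesis by (simp add: of_real_def)
qed


lemma pos_inv_invertible: "pos_inv x \<Longrightarrow> invertible_el (x::'a::cstar_algebra)"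
  by (simp add: pos_inv_def)

lemma selfadj_exp: "selfadj x \<Longrightarrow> selfadj (exp (x::'a::cstar_algebra))"
  by (rule pos_inv_selfadj[OF pos_inv_exp])

lemma invertible_el_exp: "selfadj x \<Longrightarrow> invertible_el (exp (x::'a::cstar_algebra))"
  by (rule pos_inv_invertible[OF pos_inv_exp])

lemma
  fixes m x :: "'a::cstar_algebra"
  assumes "selfadj m" "selfadj x"
  shows selfadj_exp_reflect: "selfadj (exp_reflect \<alpha> m x)"
    and exp_exp_reflect: "\<alpha> \<noteq> 0 \<Longrightarrow>
      exp (\<alpha> *\<^sub>R exp_reflect \<alpha> m x) = exp (\<alpha> *\<^sub>R m) * exp (- (\<alpha> *\<^sub>R x)) * exp (\<alpha> *\<^sub>R m)"
proof -
  have p: "pos_inv (exp (\<alpha> *\<^sub>R m) * exp (- (\<alpha> *\<^sub>R x)) * exp (\<alpha> *\<^sub>R m))"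
    using assms by (intro pos_inv_congruence pos_inv_exp selfadj_exp invertible_el_exp selfadj_intros)
  show "selfadj (exp_reflect \<alpha> m x)"
    unfolding exp_reflect_def using selfadj_ln[OF p] assms by (auto intro: selfadj_intros)
  show "exp (\<alpha> *\<^sub>R exp_reflect \<alpha> m x) = exp (\<alpha> *\<^sub>R m) * exp (- (\<alpha> *\<^sub>R x)) * exp (\<alpha> *\<^sub>R m)" if "\<alpha> \<noteq> 0"
    unfolding exp_reflect_def using exp_ln_pos_inv[OF p] that by simp
qed

lemma cle_of_real: "r \<le> s \<Longrightarrow> cle (of_real r) (of_real s :: 'a::cstar_algebra)"
  unfolding cle_def of_real_diff[symmetric] by (intro conjI selfadj_simps positive_el_of_real) simp

lemma reflection_space_0:
  "reflection_space {x::'a::cstar_algebra. selfadj x} (exp_le 0) translate (exp_reflect 0)"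
proof
  fix x y m z :: 'a and s t :: real
  show "exp_le 0 x y \<Longrightarrow> exp_le 0 y z \<Longrightarrow> exp_le 0 x z" by (auto simp: exp_le_def intro: cle_trans)
  show "exp_le 0 x y \<Longrightarrow> exp_le 0 y x \<Longrightarrow> x = y" by (auto simp: exp_le_def intro: cle_antisym)
  show "x \<in> {x. selfadj x} \<Longrightarrow> translate s x \<in> {x. selfadj x}" by (simp add: selfadj_translate)
  show "translate s (translate t x) = translate (s + t) x" "translate 0 x = x"
    by (simp_all add: translate_def algebra_simps)
  show "exp_le 0 x y \<Longrightarrow> exp_le 0 (translate s x) (translate s y)"
    by (simp add: exp_le_def translate_def cle_add_right)
  assume "x \<in> {x. selfadj x}"
  then have x: "selfadj x" by simp
  show "s \<ge> 0 \<Longrightarrow> exp_le 0 x (translate s x)"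
    using selfadj_translate[OF x] x by (simp add: exp_le_def cle_def translate_def)
  assume "y \<in> {x. selfadj x}"
  then have y: "selfadj y" by simp
  show "\<exists>s. exp_le 0 x (translate s y)"
    using cle_norm[OF selfadj_intros(2)[OF x y]] x selfadj_translate[OF y]
    by (auto simp: exp_le_def cle_def translate_def algebra_simps intro!: exI[of _ "norm (x - y)"])
  show "exp_le 0 x y" if "\<And>s. s > 0 \<Longrightarrow> exp_le 0 x (translate s y)"
  proof -
    have "cle x (y + of_real (inverse (real (Suc n))))" for n
      using that[of "inverse (real (Suc n))"] by (simp add: exp_le_def translate_def)
    then have "cle x y" by (rule cle_limit[OF tendsto_const tendsto_add_inverse_Suc])
    then show ?thesis by (simp add: exp_le_def)
  qed
next
  fix x y m z :: 'a and s t :: real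
  assume "m \<in> {x. selfadj x}" "x \<in> {x. selfadj x}"
  then have mx: "selfadj m" "selfadj x" by simp_all
  show "exp_reflect 0 m x \<in> {x. selfadj x}" using selfadj_exp_reflect mx by blast
  show "exp_reflect 0 m (exp_reflect 0 m x) = x" "exp_reflect 0 m m = m"
    "exp_reflect 0 m (translate s x) = translate (- s) (exp_reflect 0 m x)"
    by (simp_all add: exp_reflect_def translate_def)
  have double: "positive_el v" if "positive_el (v + v)" for v :: 'a
    using positive_el_scaleR[OF that, of "1/2"] by simp
  have eq: "translate (2 * s) x - exp_reflect 0 m x = (translate s x - m) + (translate s x - m)"
    "translate (2 * s) (exp_reflect 0 m x) - x = (translate s m - x) + (translate s m - x)"
    unfolding mult_2 of_real_add exp_reflect_def translate_def by simp_all
  have le: "exp_le 0 u v \<longleftrightarrow> selfadj u \<and> selfadj v \<and> positive_el (v - u)" for u v :: 'a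
    by (simp add: exp_le_def cle_def)
  show "exp_le 0 (exp_reflect 0 m x) (translate (2 * s) x) \<Longrightarrow> exp_le 0 m (translate s x)"
    "exp_le 0 x (translate (2 * s) (exp_reflect 0 m x)) \<Longrightarrow> exp_le 0 x (translate s m)"
    unfolding le eq using double mx selfadj_translate by blast+
  assume "y \<in> {x. selfadj x}"
  then have y: "selfadj y" by simp
  show "exp_le 0 x y \<Longrightarrow> exp_le 0 (exp_reflect 0 m y) (exp_reflect 0 m x)"
    using mx y by (auto simp: exp_le_def cle_def exp_reflect_def intro: selfadj_intros)
  show "\<exists>m\<in>{x. selfadj x}. exp_reflect 0 m x = y"
    using mx y by (intro bexI[of _ "(1/2) *\<^sub>R (x + y)"])
      (auto simp: exp_reflect_def algebra_simps scaleR_2[symmetric] intro: selfadj_intros)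
qed

lemma exp_half:
  fixes x :: "'a::{real_normed_algebra_1,banach}"
  shows "exp ((1/2) *\<^sub>R x) * exp ((1/2) *\<^sub>R x) = exp x"
  by (subst exp_add_commuting[symmetric]) (simp_all add: scaleR_add_left[symmetric])

lemma reflection_space_pos:
  assumes \<alpha>: "\<alpha> > 0"
  shows "reflection_space {x::'a::cstar_algebra. selfadj x} (exp_le \<alpha>) translate (exp_reflect \<alpha>)"
proof -
  define E where "E x = exp (\<alpha> *\<^sub>R x)" for x :: 'a
  define E' where "E' x = exp (- (\<alpha> *\<^sub>R x))" for x :: 'a
  have le: "exp_le \<alpha> x y \<longleftrightarrow> cle (E x) (E y)" for x y using \<alpha> by (simp add: exp_le_def E_def)
  have EE': "E x * E' x = 1" "E' x * E x = 1" for x unfolding E_def E'_def by (rule exp_minus_inverses)+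
  have pos: "pos_inv (E x)" "pos_inv (E' x)" if "selfadj x" for x
    unfolding E_def E'_def using that by (auto intro!: pos_inv_exp selfadj_intros)
  have inj: "x = y" if "selfadj x" "selfadj y" "E x = E y" for x y
  proof -
    have "\<alpha> *\<^sub>R x = \<alpha> *\<^sub>R y"
      by (rule exp_inj_selfadj) (use that in \<open>auto simp: E_def intro: selfadj_intros(4)\<close>)
    then show ?thesis using \<alpha> by simp
  qed
  have E_tr: "E (translate s x) = exp (\<alpha> * s) *\<^sub>R E x" for s x
    by (simp add: E_def translate_def exp_scaleR_add_of_real)
  have R: "E (exp_reflect \<alpha> m x) = E m * E' x * E m" "selfadj (exp_reflect \<alpha> m x)" if "selfadj m" "selfadj x" for m x
    using exp_exp_reflect[OF that, of \<alpha>] selfadj_exp_reflect[OF that] \<alpha> by (auto simp: E_def E'_def)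
  have half: "\<exists>u v. pos_inv u \<and> pos_inv v \<and> u * v = 1 \<and> v * u = 1 \<and> u * u = E x \<and> v * v = E' x"
    if "selfadj x" for x
  proof (intro exI conjI)
    let ?h = "(1/2) *\<^sub>R (\<alpha> *\<^sub>R x)"
    show "pos_inv (exp ?h)" "pos_inv (exp (- ?h))" using that by (auto intro!: pos_inv_exp selfadj_intros)
    show "exp ?h * exp (- ?h) = 1" "exp (- ?h) * exp ?h = 1" by (rule exp_minus_inverses)+
    show "exp ?h * exp ?h = E x" unfolding E_def by (rule exp_half)
    show "exp (- ?h) * exp (- ?h) = E' x" unfolding E'_def using exp_half[of "- (\<alpha> *\<^sub>R x)"] by simp
  qed
  have E'_R: "E' (exp_reflect \<alpha> m x) = E' m * E x * E' m" if "selfadj m" "selfadj x" for m x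
  proof -
    have "E' m * E x * E' m * (E m * E' x * E m) = E' m * (E x * ((E' m * E m) * E' x)) * E m"
      by (simp only: mult.assoc)
    then have "E' m * E x * E' m * E (exp_reflect \<alpha> m x) = 1" using EE' by (simp add: R that)
    then show ?thesis using EE' by (metis mult.assoc mult_1_left mult_1_right)
  qed
  text \<open>The common core of the two conditions relating \<open>d(R m x, x)\<close> to \<open>d(x, m)\<close>: conjugation by
    \<open>exp (- \<alpha> x / 2)\<close> moves \<open>x\<close> to the origin.\<close>
  have core: "\<exists>u v c. pos_inv u \<and> pos_inv v \<and> pos_inv c \<and> u * u = E x \<and> u * c * u = E m
      \<and> v * E x * v = 1 \<and> v * (E m * E' x * E m) * v = c * c \<and> v * E m * v = c" if mx: "selfadj m" "selfadj x" for m x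
  proof -
    obtain u v where uv: "pos_inv u" "pos_inv v" "u * v = 1" "v * u = 1" "u * u = E x" "v * v = E' x"
      using half[OF mx(2)] by blast
    let ?c = "v * E m * v"
    have "u * ?c * u = (u * v) * E m * (v * u)" "v * E x * v = (v * u) * (u * v)"
      "v * (E m * E' x * E m) * v = ?c * ?c"
      unfolding uv(5,6)[symmetric] by (simp_all only: mult.assoc)
    moreover have "pos_inv ?c" 
      using mx uv by (blast intro: pos_inv_congruence pos_inv_selfadj pos_inv_invertible pos)
    ultimately show ?thesis using uv by (intro exI[of _ u] exI[of _ v] exI[of _ ?c]) simp
  qed
  show ?thesis
  proof
    fix x y m z :: 'a and s t :: real
    show "exp_le \<alpha> x y \<Longrightarrow> exp_le \<alpha> y z \<Longrightarrow> exp_le \<alpha> x z" unfolding le by (rule cle_trans)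
    show "translate s (translate t x) = translate (s + t) x" "translate 0 x = x"
      by (simp_all add: translate_def algebra_simps)
    show "exp_le \<alpha> x y \<Longrightarrow> exp_le \<alpha> (translate s x) (translate s y)"
      unfolding le E_tr by (rule cle_scaleR) auto
    assume "x \<in> {x. selfadj x}"
    then have x: "selfadj x" by simp
    then show "translate s x \<in> {x. selfadj x}" by (simp add: selfadj_translate)
    show "exp_le \<alpha> x (translate s x)" if "s \<ge> 0"
    proof -
      have "positive_el ((exp (\<alpha> * s) - 1) *\<^sub>R E x)"
        using that \<alpha> pos[OF x] by (intro positive_el_scaleR pos_inv_positive) auto
      then show ?thesis
        unfolding le E_tr cle_def using pos[OF x] by (auto simp: algebra_simps intro: selfadj_intros pos_inv_selfadj)
    qed
    assume "y \<in> {x. selfadj x}"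
    then have y: "selfadj y" by simp
    show "x = y" if "exp_le \<alpha> x y" "exp_le \<alpha> y x" using inj x y cle_antisym that unfolding le by blast
    show "\<exists>s. exp_le \<alpha> x (translate s y)"
    proof -
      obtain d where d: "d > 0" "cle (of_real d) (E y)" using pos_inv_bounds pos[OF y] by blast
      \<comment> \<open>From E x \<le> norm (E x) \<le> k d \<le> k E y, the translation by ln k /
        \<alpha> realizes the factor k. The summand 1 keeps k positive.\<close>
      define k where "k = (norm (E x) + 1) / d"
      have k: "k > 0" "norm (E x) \<le> k * d" unfolding k_def using d by (auto intro!: divide_pos_pos add_nonneg_pos)
      have "cle (E x) (of_real (norm (E x)))" using cle_norm pos_inv_selfadj pos x by blast
      moreover have "cle (of_real (norm (E x))) (of_real (k * d) :: 'a)"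
        using k by (intro cle_of_real)
      moreover have "cle (of_real (k * d)) (k *\<^sub>R E y)"
        using cle_scaleR[OF d(2), of k] k by (simp add: of_real_def)
      ultimately have "cle (E x) (k *\<^sub>R E y)" by (blast intro: cle_trans)
      then show ?thesis unfolding le E_tr using k \<alpha> by (intro exI[of _ "ln k / \<alpha>"]) simp
    qed
    show "exp_le \<alpha> x y" if "\<And>s. s > 0 \<Longrightarrow> exp_le \<alpha> x (translate s y)"
    proof -
      have "(\<lambda>n. exp (\<alpha> * inverse (real (Suc n))) *\<^sub>R E y) \<longlonglongrightarrow> exp (\<alpha> * 0) *\<^sub>R E y"
        by (intro tendsto_intros LIMSEQ_inverse_real_of_nat)
      moreover have "cle (E x) (exp (\<alpha> * inverse (real (Suc n))) *\<^sub>R E y)" for n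
        using that[of "inverse (real (Suc n))"] unfolding le E_tr by simp
      ultimately have "cle (E x) (exp (\<alpha> * 0) *\<^sub>R E y)" by (rule cle_limit[OF tendsto_const])
      then show ?thesis unfolding le by simp
    qed
    show "\<exists>m\<in>{x. selfadj x}. exp_reflect \<alpha> m x = y"
    proof -
      obtain u v where uv: "pos_inv u" "pos_inv v" "u * v = 1" "v * u = 1" "u * u = E x" "v * v = E' x"
        using half[OF x] by blast
      have "pos_inv (v * E y * v)" 
        using y uv by (blast intro: pos_inv_congruence pos_inv_selfadj pos_inv_invertible pos)
      \<comment> \<open>The element u w u built from this root is the geometric mean of E x and E y,
        and its logarithm divided by \<alpha> is the midpoint.\<close>
      then obtain w where w: "pos_inv w" "w * w = v * E y * v" using pos_inv_sqrt_exists by blast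
      have p: "pos_inv (u * w * u)" using w uv by (intro pos_inv_congruence pos_inv_selfadj pos_inv_invertible)
      define m where "m = (1 / \<alpha>) *\<^sub>R cfc ln (u * w * u)"
      have m: "selfadj m" "E m = u * w * u"
        using selfadj_ln[OF p] exp_ln_pos_inv[OF p] \<alpha> by (auto simp: m_def E_def intro: selfadj_intros)
      have "E m * E' x * E m = u * w * (u * v) * ((v * u) * w * u)"
        unfolding m uv(6)[symmetric] by (simp only: mult.assoc)
      also have "\<dots> = u * (w * w) * u" using uv by (simp add: mult.assoc)
      also have "\<dots> = (u * v) * E y * (v * u)" unfolding w(2) by (simp only: mult.assoc)
      finally have "E (exp_reflect \<alpha> m x) = E y" using R m x uv by simp
      then have "exp_reflect \<alpha> m x = y" by (rule inj[OF R(2)[OF m(1) x] y])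
      then show ?thesis using m(1) by blast
    qed
  next
    fix x y m :: 'a and s :: real
    assume "m \<in> {x. selfadj x}"
    then have m: "selfadj m" by simp
    have "E m * E' m * E m = E m" using EE' by simp
    then have "E (exp_reflect \<alpha> m m) = E m" using R(1)[OF m m] by simp
    then show "exp_reflect \<alpha> m m = m" by (rule inj[OF R(2)[OF m m] m])
    assume "x \<in> {x. selfadj x}"
    then have x: "selfadj x" by simp
    show "exp_reflect \<alpha> m x \<in> {x. selfadj x}" using R m x by simp
    have "E (exp_reflect \<alpha> m (exp_reflect \<alpha> m x)) = (E m * E' m) * E x * (E' m * E m)"
      unfolding R(1)[OF m R(2)[OF m x]] E'_R[OF m x] by (simp only: mult.assoc)
    then have "E (exp_reflect \<alpha> m (exp_reflect \<alpha> m x)) = E x" using EE' by simp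
    then show "exp_reflect \<alpha> m (exp_reflect \<alpha> m x) = x" by (rule inj[OF R(2)[OF m R(2)[OF m x]] x])
    have "E' (translate s x) = exp (\<alpha> * (- s)) *\<^sub>R E' x"
      using exp_scaleR_add_of_real[of "-\<alpha>" x s] by (simp add: E'_def translate_def)
    then have "E (exp_reflect \<alpha> m (translate s x)) = E (translate (- s) (exp_reflect \<alpha> m x))"
      unfolding R(1)[OF m selfadj_translate[OF x]] E_tr R(1)[OF m x] by simp
    then show "exp_reflect \<alpha> m (translate s x) = translate (- s) (exp_reflect \<alpha> m x)"
      by (rule inj[OF R(2)[OF m selfadj_translate[OF x]] selfadj_translate[OF R(2)[OF m x]]])
    obtain u v c where c: "pos_inv u" "pos_inv v" "pos_inv c" "u * u = E x" "u * c * u = E m" "v * E x * v = 1"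
      "v * (E m * E' x * E m) * v = c * c" "v * E m * v = c"
      using core[OF m x] by blast
    define k where "k = exp (\<alpha> * s)"
    have k: "k > 0" "exp (\<alpha> * (2 * s)) = k * k" by (simp_all add: k_def exp_add[symmetric])
    show "exp_le \<alpha> m (translate s x)" if "exp_le \<alpha> (exp_reflect \<alpha> m x) (translate (2 * s) x)"
    proof -
      have "cle (E m * E' x * E m) ((k * k) *\<^sub>R E x)"
        using that unfolding le E_tr R(1)[OF m x] k .
      then have "cle (v * (E m * E' x * E m) * v) (v * ((k * k) *\<^sub>R E x) * v)"
        using c by (intro cle_congruence pos_inv_selfadj)
      \<comment> \<open>After the congruence, c is compared with a scalar. The two commute, so
        taking square roots on both sides is legitimate.\<close>
      then have sq: "cle (c * c) ((k *\<^sub>R 1) * (k *\<^sub>R 1))" using c by simp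
      have "cle c (k *\<^sub>R 1)"
        by (rule cle_if_squares_cle[OF pos_inv_positive[OF c(3)] pos_inv_scaleR[OF pos_inv_1 k(1)] _ sq]) simp
      then have "cle (u * c * u) (u * (k *\<^sub>R 1) * u)" using c by (intro cle_congruence pos_inv_selfadj)
      then show ?thesis unfolding le E_tr using c by (simp add: k_def)
    qed
    show "exp_le \<alpha> x (translate s m)" if "exp_le \<alpha> x (translate (2 * s) (exp_reflect \<alpha> m x))"
    proof -
      have "cle (E x) ((k * k) *\<^sub>R (E m * E' x * E m))"
        using that unfolding le E_tr R(1)[OF m x] k .
      then have "cle (v * E x * v) (v * ((k * k) *\<^sub>R (E m * E' x * E m)) * v)"
        using c by (intro cle_congruence pos_inv_selfadj)
      then have sq: "cle (1 * 1) ((k *\<^sub>R c) * (k *\<^sub>R c))" using c by simp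
      have "cle 1 (k *\<^sub>R c)"
        by (rule cle_if_squares_cle[OF positive_el_1 pos_inv_scaleR[OF c(3) k(1)] _ sq]) simp
      then have "cle (u * 1 * u) (u * (k *\<^sub>R c) * u)" using c by (intro cle_congruence pos_inv_selfadj)
      then show ?thesis unfolding le E_tr using c by (simp add: k_def)
    qed
    assume "y \<in> {x. selfadj x}"
    then have y: "selfadj y" by simp
    show "exp_le \<alpha> (exp_reflect \<alpha> m y) (exp_reflect \<alpha> m x)" if "exp_le \<alpha> x y"
    proof -
      have "cle (E' y) (E' x)"
        using that cle_inverse_antimono[of "\<alpha> *\<^sub>R x" "\<alpha> *\<^sub>R y"] x y unfolding le E_def E'_def
        by (auto intro: selfadj_intros)
      then have "cle (E m * E' y * E m) (E m * E' x * E m)" 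
        using m by (blast intro: cle_congruence pos_inv_selfadj pos)
      then show ?thesis unfolding le using R m x y by simp
    qed
  qed
qed

lemma reflection_space_exp_le:
  "\<alpha> \<ge> 0 \<Longrightarrow> reflection_space {x::'a::cstar_algebra. selfadj x} (exp_le \<alpha>) translate (exp_reflect \<alpha>)"
  using reflection_space_0 reflection_space_pos[of \<alpha>] by (cases "\<alpha> = 0") auto

section \<open>Comparison of the orders near the origin\<close>

lemma exp_le_1_iff: "\<alpha> > 0 \<Longrightarrow> exp_le \<alpha> x y \<longleftrightarrow> exp_le 1 (\<alpha> *\<^sub>R x) (\<alpha> *\<^sub>R y)"
  by (simp add: exp_le_def)

lemma cle_scaleR_iff: "r > 0 \<Longrightarrow> cle (r *\<^sub>R x) (r *\<^sub>R y) \<longleftrightarrow> cle x (y::'a::cstar_algebra)"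
  using cle_scaleR[of x y r] cle_scaleR[of "r *\<^sub>R x" "r *\<^sub>R y" "1 / r"] by auto

text \<open>Near the origin, all the orders \<open>exp_le \<alpha>\<close> are infinitesimally equal to the usual one.\<close>
lemma eventually_exp_le:
  fixes x y :: "'a::cstar_algebra"
  assumes xy: "cle x y" and s: "s > 0" and \<alpha>: "\<alpha> \<ge> 0"
  shows "\<forall>\<^sub>F h in at_right 0. exp_le \<alpha> (h *\<^sub>R x) (h *\<^sub>R translate s y)"
proof (cases "\<alpha> = 0")
  case True
  have "cle x (translate s y)"
    using xy positive_el_add[of "y - x" "of_real s"] s selfadj_translate[of y s]
    by (auto simp: cle_def translate_def algebra_simps)
  then show ?thesis
    using eventually_at_right_less[of "0::real"] True
    by (auto simp: exp_le_def elim!: eventually_mono intro: cle_scaleR)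
next
  case False
  then have \<alpha>: "\<alpha> > 0" using \<alpha> by simp
  have sa: "selfadj x" "selfadj y" using xy by (auto simp: cle_def)
  define z w where "z = \<alpha> *\<^sub>R x" and "w = \<alpha> *\<^sub>R translate s y"
  define D where "D h = (1 / h) *\<^sub>R (exp (h *\<^sub>R w) - 1) - (1 / h) *\<^sub>R (exp (h *\<^sub>R z) - 1)" for h :: real
  have zw: "selfadj z" "selfadj w" unfolding z_def w_def using sa by (auto intro: selfadj_intros selfadj_translate)
  have "(D \<longlongrightarrow> w - z) (at_right 0)"
    unfolding D_def by (intro tendsto_diff tendsto_exp_difference_quotient)
  then have "\<forall>\<^sub>F h in at_right 0. dist (D h) (w - z) < \<alpha> * s" using \<alpha> s by (intro tendstoD) auto
  with eventually_at_right_less[of "0::real"] show ?thesis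
  proof eventually_elim
    case (elim h)
    have sae: "selfadj (exp (h *\<^sub>R z))" "selfadj (exp (h *\<^sub>R w))"
      using zw by (auto intro!: selfadj_exp selfadj_intros(4))
    then have "selfadj (D h - (w - z))"
      unfolding D_def using zw by (intro selfadj_intros selfadj_simps)
    \<comment> \<open>The limit of the difference quotient is w - z = \<alpha> (y - x) + \<alpha> s.
      Its last summand outweighs the approximation error, and the first is positive by
      assumption.\<close>
    then have "positive_el (of_real (\<alpha> * s) + (D h - (w - z)))"
      using elim by (intro positive_el_norm_plus) (auto simp: dist_norm)
    moreover have "positive_el (\<alpha> *\<^sub>R (y - x))"
      using xy \<alpha> by (intro positive_el_scaleR) (auto simp: cle_def)
    ultimately have "positive_el (\<alpha> *\<^sub>R (y - x) + (of_real (\<alpha> * s) + (D h - (w - z))))"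
      by (rule positive_el_add[rotated])
    also have "\<alpha> *\<^sub>R (y - x) + (of_real (\<alpha> * s) + (D h - (w - z))) = D h"
      unfolding z_def w_def translate_def by (simp add: algebra_simps of_real_def)
    finally have "positive_el (h *\<^sub>R D h)" using elim by (intro positive_el_scaleR) auto
    also have "h *\<^sub>R D h = exp (h *\<^sub>R w) - exp (h *\<^sub>R z)"
      unfolding D_def using elim by (simp add: algebra_simps)
    finally have "cle (exp (h *\<^sub>R z)) (exp (h *\<^sub>R w))" using sae by (simp add: cle_def)
    then show ?case using \<alpha> by (simp add: exp_le_def z_def w_def mult.commute)
  qed
qed

text \<open>For \<alpha> > 0, subtract 1 from both exponentials, divide by the step h n and pass to
  the limit: the difference quotients tend to \<alpha> x and \<alpha> y. For \<alpha> = 0 a single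
  positive step suffices.\<close>

lemma cle_if_eventually_exp_le:
  fixes x y :: "'a::cstar_algebra"
  assumes sa: "selfadj x" "selfadj y" and \<alpha>: "\<alpha> \<ge> 0"
    and h: "filterlim h (at_right 0) sequentially"
    and le: "\<forall>\<^sub>F n in sequentially. exp_le \<alpha> (h n *\<^sub>R x) (h n *\<^sub>R y)"
  shows "cle x y"
proof -
  have "\<forall>\<^sub>F n in sequentially. h n > 0"
    using filterlim_iff[THEN iffD1, OF h, rule_format, OF eventually_at_right_less] .
  then obtain N where N: "\<And>n. n \<ge> N \<Longrightarrow> h n > 0 \<and> exp_le \<alpha> (h n *\<^sub>R x) (h n *\<^sub>R y)"
    using eventually_conj[OF _ le] unfolding eventually_sequentially by metis
  show ?thesis
  proof (cases "\<alpha> = 0")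
    case True
    then show ?thesis using N[of N] by (auto simp: exp_le_def cle_scaleR_iff)
  next
    case False
    \<comment> \<open>Dropping the first N steps makes the inequality hold at every index, as the
      limit rule for \<open>cle\<close> demands.\<close>
    define k where "k n = h (n + N)" for n
    have k: "filterlim k (at_right 0) sequentially"
      unfolding k_def using filterlim_compose[OF h filterlim_add_const_nat_at_top] by simp
    have "cle ((1 / k n) *\<^sub>R (exp (k n *\<^sub>R (\<alpha> *\<^sub>R x)) - 1)) ((1 / k n) *\<^sub>R (exp (k n *\<^sub>R (\<alpha> *\<^sub>R y)) - 1))" for n
    proof -
      have "k n > 0" "cle (exp (k n *\<^sub>R (\<alpha> *\<^sub>R x))) (exp (k n *\<^sub>R (\<alpha> *\<^sub>R y)))"
        using N[of "n + N"] False by (auto simp: k_def exp_le_def mult.commute)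
      then show ?thesis
        using cle_add_right[of "-1" "exp (k n *\<^sub>R (\<alpha> *\<^sub>R x))" "exp (k n *\<^sub>R (\<alpha> *\<^sub>R y))"]
          selfadj_intros(3)[OF selfadj_simps(2)]
        by (intro cle_scaleR) auto
    qed
    then have "cle (\<alpha> *\<^sub>R x) (\<alpha> *\<^sub>R y)"
      by (rule cle_limit[OF filterlim_compose[OF tendsto_exp_difference_quotient k]
            filterlim_compose[OF tendsto_exp_difference_quotient k]])
    then show ?thesis using cle_scaleR_iff[of \<alpha> x y] \<alpha> False by simp
  qed
qed

lemma cle_closure:
  fixes x y :: "'a::cstar_algebra"
  assumes "selfadj x" "selfadj y" "\<And>s. s > 0 \<Longrightarrow> cle x (translate s y)"
  shows "cle x y"
  using reflection_space.tr_closure[OF reflection_space_exp_le[of 0]] assms by (auto simp: exp_le_def)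

lemma filterlim_powers_at_right_0:
  fixes r :: real
  assumes "0 < r" "r < 1"
  shows "filterlim (\<lambda>n. r ^ n) (at_right 0) sequentially"
  using assms LIMSEQ_realpow_zero[of r]
  by (auto simp: filterlim_at intro!: always_eventually)

text \<open>At scale 2^-n the usual order, with a slack s, implies the \<alpha>-order; \<theta>
  carries it to the \<beta>-order at the same scale because it commutes with halving and
  translations; letting n grow recovers the usual order. The slack is removed by closure.\<close>

lemma cle_transfer:
  fixes \<theta> :: "'a::cstar_algebra \<Rightarrow> 'b::cstar_algebra"
  assumes ab: "\<alpha> \<ge> 0" "\<beta> \<ge> 0"
    and sa: "\<And>x. selfadj x \<Longrightarrow> selfadj (\<theta> x)"
    and half: "\<And>x. selfadj x \<Longrightarrow> \<theta> ((1/2) *\<^sub>R x) = (1/2) *\<^sub>R \<theta> x"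
    and tr: "\<And>x s. selfadj x \<Longrightarrow> \<theta> (translate s x) = translate s (\<theta> x)"
    and le: "\<And>x y. selfadj x \<Longrightarrow> selfadj y \<Longrightarrow> exp_le \<alpha> x y \<Longrightarrow> exp_le \<beta> (\<theta> x) (\<theta> y)"
    and xy: "cle x y"
  shows "cle (\<theta> x) (\<theta> y)"
proof (rule cle_closure)
  have x: "selfadj x" and y: "selfadj y" using xy by (auto simp: cle_def)
  then show "selfadj (\<theta> x)" "selfadj (\<theta> y)" using sa by auto
  have pow: "\<theta> ((1/2) ^ n *\<^sub>R z) = (1/2) ^ n *\<^sub>R \<theta> z" if "selfadj z" for z n
  proof (induction n)
    case (Suc n)
    have "selfadj ((1/2) ^ n *\<^sub>R z)" using that by (intro selfadj_intros)
    then have "\<theta> ((1/2) *\<^sub>R ((1/2) ^ n *\<^sub>R z)) = (1/2) *\<^sub>R ((1/2) ^ n *\<^sub>R \<theta> z)" unfolding Suc[symmetric] by (rule half)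
    then show ?case by (simp only: power_Suc scaleR_scaleR)
  qed simp
  have lim: "filterlim (\<lambda>n. (1/2) ^ n :: real) (at_right 0) sequentially"
    by (rule filterlim_powers_at_right_0) auto
  fix s :: real assume "s > 0"
  have "\<forall>\<^sub>F n in sequentially. exp_le \<alpha> ((1/2) ^ n *\<^sub>R x) ((1/2) ^ n *\<^sub>R translate s y)"
    using filterlim_iff[THEN iffD1, OF lim, rule_format, OF eventually_exp_le[OF xy \<open>s > 0\<close> ab(1)]] .
  then have "\<forall>\<^sub>F n in sequentially. exp_le \<beta> ((1/2) ^ n *\<^sub>R \<theta> x) ((1/2) ^ n *\<^sub>R translate s (\<theta> y))"
  proof eventually_elim
    case (elim n)
    then have "exp_le \<beta> (\<theta> ((1/2) ^ n *\<^sub>R x)) (\<theta> ((1/2) ^ n *\<^sub>R translate s y))"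
      using x y by (intro le selfadj_intros selfadj_translate)
    then show ?case using pow x selfadj_translate[OF y] tr[OF y] by simp
  qed
  then show "cle (\<theta> x) (translate s (\<theta> y))"
    using sa x y ab(2) lim by (intro cle_if_eventually_exp_le[where h = "\<lambda>n. (1/2) ^ n"] selfadj_translate)
qed

section \<open>Order isomorphisms between the self-adjoint parts\<close>

locale selfadj_order_iso =
  fixes T :: "'a::cstar_algebra \<Rightarrow> 'b::cstar_algebra"
  assumes bij: "bij_betw T {x. selfadj x} {y. selfadj y}"
    and cle_iff: "selfadj x \<Longrightarrow> selfadj y \<Longrightarrow> cle (T x) (T y) \<longleftrightarrow> cle x y"
    and T_translate: "selfadj x \<Longrightarrow> T (translate s x) = translate s (T x)"
    and T_0 [simp]: "T 0 = 0"
begin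

lemma selfadj_T: "selfadj x \<Longrightarrow> selfadj (T x)"
  using bij by (auto dest: bij_betwE)

lemma T_reflect: "selfadj m \<Longrightarrow> selfadj x \<Longrightarrow> T (m + m - x) = T m + T m - T x"
  using iso_preserves_reflections[OF reflection_space_exp_le[of 0] reflection_space_exp_le[of 0], of T m x]
    bij cle_iff T_translate
  by (auto simp: signed_iso_def exp_le_def exp_reflect_def)

lemma T_double: "selfadj x \<Longrightarrow> T (x + x) = T x + T x"
  using T_reflect[of x 0] by simp

text \<open>Reflecting x through the midpoint m of x and y gives T y = 2 T m - T x, and doubling
  identifies 2 T m with T (x + y).\<close>

lemma T_add:
  assumes "selfadj x" "selfadj y"
  shows "T (x + y) = T x + T y"
proof -
  define m where "m = (1/2) *\<^sub>R (x + y)"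
  have m: "selfadj m" "m + m = x + y" using assms by (auto simp: m_def simp flip: scaleR_add_left intro: selfadj_intros)
  have "T y = T m + T m - T x" using T_reflect[OF m(1) assms(1)] m(2) by simp
  moreover have "T m + T m = T (x + y)" using T_double[OF m(1)] m(2) by simp
  ultimately show ?thesis by simp
qed

lemma T_minus: "selfadj x \<Longrightarrow> T (- x) = - T x"
  using T_reflect[of 0 x] by simp

lemma T_diff: "selfadj x \<Longrightarrow> selfadj y \<Longrightarrow> T (x - y) = T x - T y"
  using T_add[of x "- y"] T_minus[of y] by (simp add: selfadj_intros)

lemma T_of_real: "T (of_real c) = of_real c"
  using T_translate[of 0 c] by (simp add: translate_def)

lemma T_1: "T 1 = 1"
  using T_of_real[of 1] by simp

lemma positive_T: "positive_el x \<Longrightarrow> positive_el (T x)"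
  using cle_iff[of 0 x] by (auto simp: cle_0_iff dest: positive_elD)

text \<open>For self-adjoint x, a norm bound is the order relation - c \<le> x \<le> c with scalars,
  and T preserves both the order and the scalars.\<close>

lemma norm_T_le:
  assumes x: "selfadj x"
  shows "norm (T x) \<le> norm x"
proof (rule norm_le_if_positive_el)
  have sa: "selfadj (of_real (norm x) :: 'a)" by simp
  show "selfadj (T x)" using selfadj_T x .
  show "positive_el (of_real (norm x) - T x)" "positive_el (of_real (norm x) + T x)"
    using positive_T[OF positive_el_norm_minus[OF x order_refl]] positive_T[OF positive_el_norm_plus[OF x order_refl]]
    by (simp_all add: T_diff T_add x T_of_real)
qed

lemma T_scaleR_nat: "selfadj x \<Longrightarrow> T (real n *\<^sub>R x) = real n *\<^sub>R T x"
  by (induction n) (simp_all add: scaleR_add_left T_add selfadj_intros)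

lemma T_scaleR_int: "selfadj x \<Longrightarrow> T (of_int k *\<^sub>R x) = of_int k *\<^sub>R T x"
proof (cases k rule: int_cases2)
  case (nonpos n)
  moreover assume "selfadj x"
  ultimately show ?thesis using T_minus[of "real n *\<^sub>R x"] T_scaleR_nat[of x n] by (simp add: selfadj_intros)
qed (simp add: T_scaleR_nat)

text \<open>Split n r into its integer part and a remainder e with |e| \<le> 1. Additivity handles
  the integer part, contractivity bounds the rest, so n times the defect d stays below 2 norm x for
  every n and d must vanish.\<close>

lemma T_scaleR:
  assumes x: "selfadj x"
  shows "T (r *\<^sub>R x) = r *\<^sub>R T x"
proof -
  define d where "d = norm (T (r *\<^sub>R x) - r *\<^sub>R T x)"
  have bound: "real n * d \<le> 2 * norm x" for n
  proof -
    define k where "k = \<lfloor>real n * r\<rfloor>"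
    define e where "e = real n * r - of_int k"
    have e: "\<bar>e\<bar> \<le> 1" unfolding e_def k_def by linarith
    have "real n *\<^sub>R T (r *\<^sub>R x) = T (real n *\<^sub>R (r *\<^sub>R x))"
      using x by (simp add: T_scaleR_nat selfadj_intros del: scaleR_scaleR)
    also have "real n *\<^sub>R (r *\<^sub>R x) = of_int k *\<^sub>R x + e *\<^sub>R x" by (simp add: e_def algebra_simps)
    also have "T \<dots> = of_int k *\<^sub>R T x + T (e *\<^sub>R x)"
      using x by (simp add: T_add T_scaleR_int selfadj_intros)
    finally have "real n *\<^sub>R (T (r *\<^sub>R x) - r *\<^sub>R T x) = T (e *\<^sub>R x) - e *\<^sub>R T x"
      by (simp add: e_def algebra_simps)
    then have "real n * d = norm (T (e *\<^sub>R x) - e *\<^sub>R T x)"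
      unfolding d_def by (metis abs_of_nat norm_scaleR)
    also have "\<dots> \<le> norm (T (e *\<^sub>R x)) + norm (e *\<^sub>R T x)" by (rule norm_triangle_ineq4)
    also have "norm (T (e *\<^sub>R x)) \<le> norm x"
      using norm_T_le[of "e *\<^sub>R x"] x e mult_right_mono[OF e norm_ge_zero[of x]] by (simp add: selfadj_intros)
    also have "norm (e *\<^sub>R T x) \<le> norm x"
      using norm_T_le[OF x] e mult_mono[OF e norm_T_le[OF x]] by simp
    finally show ?thesis by simp
  qed
  have "d = 0"
  proof (rule ccontr)
    assume "d \<noteq> 0"
    then have "d > 0" by (simp add: d_def)
    then obtain n where "2 * norm x < real n * d" using reals_Archimedean3 by blast
    then show False using bound[of n] by simp
  qed
  then show ?thesis by (simp add: d_def)
qed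

lemma T_sum: "(\<And>i. i \<in> I \<Longrightarrow> selfadj (f i)) \<Longrightarrow> T (sum f I) = (\<Sum>i\<in>I. T (f i))"
  by (induction I rule: infinite_finite_induct) (simp_all add: T_add selfadj_sum)

text \<open>Kadison's inequality, first for \<open>0 \<le> x \<le> 1\<close>: the Bernstein polynomials \<open>B\<^sub>k\<close> of degree \<open>n\<close> form
  a partition of unity, and \<open>\<Sum>\<^sub>k (k/n - T x) T(B\<^sub>k(x)) (k/n - T x) \<ge> 0\<close>.\<close>
lemma Kadison_inequality_unit_interval:
  assumes x: "positive_el x" "positive_el (1 - x)"
  shows "cle (T x * T x) (T (x * x))"
proof -
  have sa: "selfadj x" using x positive_elD by blast
  have spec: "t \<ge> 0" "t \<le> 1" if "t \<in> rspec x" for t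
    using that x rspec_reflect[of "1 - t" 1 x] by (auto simp: positive_el_def)
  have sas: "selfadj (x * x)" "selfadj (T x * T x)" using sa selfadj_T[OF sa] by (auto intro: selfadj_intros)
  \<comment> \<open>The correction term is the binomial variance: the second moment of k/n under the
    Bernstein weights of degree n is x^2 + (x - x^2)/n. It vanishes as n grows, and n = Suc m keeps
    the division meaningful.\<close>
  have main: "positive_el (T (x * x) + (1 / real (Suc m)) *\<^sub>R T (x - x * x) - T x * T x)" for m
  proof -
    define n where "n = Suc m"
    have n: "real n > 0" by (simp add: n_def)
    have "continuous_on (rspec x) (Bernstein n k)" for k
      unfolding Bernstein_def by (intro continuous_intros)
    then have "\<exists>y. has_cfc (Bernstein n k) x y" for k using has_cfc_exists[OF sa] by blast
    then obtain B where B: "\<And>k. has_cfc (Bernstein n k) x (B k)" by metis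
    have pos: "positive_el (B k)" for k
      by (rule has_cfc_positive[OF sa B]) (use spec in \<open>auto intro: Bernstein_nonneg\<close>)
    have has_sum: "has_cfc (\<lambda>t. \<Sum>k\<in>K. c k * Bernstein n k t) x (\<Sum>k\<in>K. c k *\<^sub>R B k)" if "finite K" for c :: "nat \<Rightarrow> real" and K
      using that
    proof (induction K rule: finite_induct)
      case empty
      show ?case using has_cfc_const[of 0 x] by simp
    next
      case (insert j K)
      have "has_cfc (\<lambda>t. c j * Bernstein n j t + (\<Sum>k\<in>K. c k * Bernstein n k t)) x (of_real (c j) * B j + (\<Sum>k\<in>K. c k *\<^sub>R B k))"
        by (intro has_cfc_add has_cfc_mult has_cfc_const B insert.IH)
      then show ?case using insert.hyps by (simp add: of_real_def)
    qed
    have eqI: "(\<Sum>k\<le>n. c k *\<^sub>R B k) = peval p x" if "\<And>t. (\<Sum>k\<le>n. c k * Bernstein n k t) = poly p t" for c p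
    proof -
      have "(\<lambda>t. \<Sum>k\<le>n. c k * Bernstein n k t) = poly p" using that by (rule ext)
      then show ?thesis
        using cfc_eqI[OF sa has_sum[OF finite_atMost[of n], of c]] cfc_eqI[OF sa has_cfc_poly[of p x]] by simp
    qed
    \<comment> \<open>The zeroth, first and second factorial moments of the Bernstein weights,
      obtained from the corresponding polynomial identities through uniqueness of the
      calculus.\<close>
    have 0: "(\<Sum>k\<le>n. B k) = 1"
      using eqI[of "\<lambda>_. 1" "[:1:]"] by (simp add: peval_pCons)
    have 1: "(\<Sum>k\<le>n. real k *\<^sub>R B k) = real n *\<^sub>R x"
      using eqI[of real "[:0, real n:]"] by (simp add: peval_pCons of_real_def)
    have 2: "(\<Sum>k\<le>n. (real k * (real k - 1)) *\<^sub>R B k) = (real n * (real n - 1)) *\<^sub>R (x * x)"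
      using eqI[of "\<lambda>k. real k * (real k - 1)" "[:0, 0, real n * (real n - 1):]"]
      by (simp add: peval_pCons of_real_def power2_eq_square)
    define S where "S = T x"
    have TB: "(\<Sum>k\<le>n. T (B k)) = 1" "(\<Sum>k\<le>n. real k *\<^sub>R T (B k)) = real n *\<^sub>R S"
      "(\<Sum>k\<le>n. (real k * (real k - 1)) *\<^sub>R T (B k)) = (real n * (real n - 1)) *\<^sub>R T (x * x)"
      using arg_cong[OF 0, of T] arg_cong[OF 1, of T] arg_cong[OF 2, of T] positive_elD[OF pos] sa sas
      by (simp_all add: T_sum T_1 T_scaleR selfadj_intros S_def)
    have "selfadj S" using selfadj_T sa by (simp add: S_def)
    then have "positive_el (\<Sum>k\<le>n. (of_real (real k) - real n *\<^sub>R S) * T (B k) * (of_real (real k) - real n *\<^sub>R S))"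
      by (intro positive_el_sum positive_el_congruence positive_T pos selfadj_intros selfadj_simps)
    also have "(\<Sum>k\<le>n. (of_real (real k) - real n *\<^sub>R S) * T (B k) * (of_real (real k) - real n *\<^sub>R S))
      = (\<Sum>k\<le>n. (real k * (real k - 1)) *\<^sub>R T (B k)) + (\<Sum>k\<le>n. real k *\<^sub>R T (B k))
        - real n *\<^sub>R ((\<Sum>k\<le>n. real k *\<^sub>R T (B k)) * S) - real n *\<^sub>R (S * (\<Sum>k\<le>n. real k *\<^sub>R T (B k)))
        + (real n * real n) *\<^sub>R (S * (\<Sum>k\<le>n. T (B k)) * S)"
      unfolding sum_distrib_left sum_distrib_right scaleR_sum_right sum.distrib[symmetric] sum_subtractf[symmetric]
      by (rule sum.cong) (simp_all add: of_real_def algebra_simps)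
    also have "\<dots> = (real n * (real n - 1)) *\<^sub>R T (x * x) + real n *\<^sub>R S - (real n * real n) *\<^sub>R (S * S)"
      unfolding TB by (simp add: algebra_simps)
    finally have "positive_el ((1 / (real n * real n)) *\<^sub>R ((real n * (real n - 1)) *\<^sub>R T (x * x) + real n *\<^sub>R S - (real n * real n) *\<^sub>R (S * S)))"
      using n by (intro positive_el_scaleR) auto
    also have "(1 / (real n * real n)) *\<^sub>R ((real n * (real n - 1)) *\<^sub>R T (x * x) + real n *\<^sub>R S - (real n * real n) *\<^sub>R (S * S))
      = T (x * x) + (1 / real n) *\<^sub>R (S - T (x * x)) - S * S"
      using n by (simp add: scaleR_diff_right scaleR_add_right scaleR_diff_left right_diff_distrib diff_divide_distrib)
    finally show ?thesis using T_diff[OF sa sas(1)] by (simp add: S_def n_def)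
  qed
  have "(\<lambda>m. T (x * x) + (1 / real (Suc m)) *\<^sub>R T (x - x * x) - T x * T x) \<longlonglongrightarrow> T (x * x) + 0 *\<^sub>R T (x - x * x) - T x * T x"
    by (intro tendsto_intros LIMSEQ_Suc[OF lim_1_over_n])
  then have "positive_el (T (x * x) + 0 *\<^sub>R T (x - x * x) - T x * T x)"
    using main by (rule positive_el_limit)
  then show ?thesis using sas selfadj_T by (simp add: cle_def)
qed

lemma Kadison_inequality:
  assumes x: "selfadj x"
  shows "cle (T x * T x) (T (x * x))"
proof -
  define c where "c = norm x + 1"
  have c: "c > 0" "norm x \<le> c" by (auto simp: c_def add_nonneg_pos)
  \<comment> \<open>An affine change of variable moves x into the unit interval. Both sides of the
    inequality pick up the same terms 2 c T x + c^2, which cancel.\<close>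
  define u where "u = (1 / (2 * c)) *\<^sub>R (of_real c + x)"
  have "positive_el u" unfolding u_def using c x by (intro positive_el_scaleR positive_el_norm_plus) auto
  moreover have "1 - u = (1 / (2 * c)) *\<^sub>R (of_real c - x)"
    unfolding u_def using c by (simp add: algebra_simps of_real_def flip: scaleR_add_left)
  then have "positive_el (1 - u)" using c x by (auto intro!: positive_el_scaleR positive_el_norm_minus)
  ultimately have "cle (T u * T u) (T (u * u))" by (rule Kadison_inequality_unit_interval)
  then have "cle ((2 * c * (2 * c)) *\<^sub>R (T u * T u)) ((2 * c * (2 * c)) *\<^sub>R T (u * u))" using c by (intro cle_scaleR) auto
  moreover have xx: "selfadj (x * x)" using x by (intro selfadj_intros) auto
  have "T u = (1 / (2 * c)) *\<^sub>R (of_real c + T x)"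
    unfolding u_def using x by (simp add: T_scaleR T_add T_of_real selfadj_intros)
  then have "(2 * c * (2 * c)) *\<^sub>R (T u * T u) = T x * T x + (2 * c) *\<^sub>R T x + of_real (c * c)"
    using c by (simp add: of_real_def algebra_simps flip: scaleR_2)
  moreover have "(2 * c * (2 * c)) *\<^sub>R T (u * u) = T (x * x) + (2 * c) *\<^sub>R T x + of_real (c * c)"
  proof -
    have "selfadj u" unfolding u_def using x by (intro selfadj_intros selfadj_simps)
    then have "selfadj (u * u)" by (intro selfadj_intros) auto
    then have "(2 * c * (2 * c)) *\<^sub>R T (u * u) = T ((2 * c * (2 * c)) *\<^sub>R (u * u))" by (simp add: T_scaleR)
    also have "(2 * c * (2 * c)) *\<^sub>R (u * u) = x * x + (2 * c) *\<^sub>R x + of_real (c * c)"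
      unfolding u_def using c by (simp add: of_real_def algebra_simps flip: scaleR_2)
    also have "T \<dots> = T (x * x) + (2 * c) *\<^sub>R T x + of_real (c * c)"
      using x xx by (simp add: T_add T_scaleR selfadj_intros T_of_real del: of_real_mult)
    finally show ?thesis .
  qed
  ultimately have "cle (T x * T x + ((2 * c) *\<^sub>R T x + of_real (c * c))) (T (x * x) + ((2 * c) *\<^sub>R T x + of_real (c * c)))"
    by (simp add: add.assoc)
  moreover have "selfadj ((2 * c) *\<^sub>R T x + of_real (c * c))"
    using selfadj_T[OF x] by (intro selfadj_intros selfadj_simps)
  ultimately show ?thesis using cle_add_right by blast
qed

lemma selfadj_order_iso_inv: "selfadj_order_iso (inv_into {x. selfadj x} T)"
proof
  let ?U = "inv_into {x. selfadj x} T"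
  show bU: "bij_betw ?U {y. selfadj y} {x. selfadj x}" by (rule bij_betw_inv_into[OF bij])
  have U: "selfadj (?U y)" "T (?U y) = y" if "selfadj y" for y
    using bij_betwE[OF bU] bij_betw_inv_into_right[OF bij] that by auto
  have UT: "?U (T x) = x" if "selfadj x" for x
    using bij_betw_inv_into_left[OF bij] that by auto
  show "cle (?U x) (?U y) \<longleftrightarrow> cle x y" if "selfadj x" "selfadj y" for x y
    using cle_iff[of "?U x" "?U y"] U that by simp
  show "?U (translate s y) = translate s (?U y)" if "selfadj y" for s y
    using UT[OF selfadj_translate[OF U(1)[OF that], of s]] T_translate[OF U(1)[OF that], of s] U that by simp
  show "?U 0 = 0" using UT[of 0] by simp
qed

lemma T_square:
  assumes x: "selfadj x"
  shows "T (x * x) = T x * T x"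
proof (rule cle_antisym)
  let ?U = "inv_into {x. selfadj x} T"
  interpret U: selfadj_order_iso ?U by (rule selfadj_order_iso_inv)
  have sas: "selfadj (x * x)" "selfadj (T x * T x)" using x selfadj_T[OF x] by (auto intro: selfadj_intros)
  show "cle (T x * T x) (T (x * x))" using Kadison_inequality x .
  have "cle (?U (T x) * ?U (T x)) (?U (T x * T x))" using U.Kadison_inequality selfadj_T x by blast
  then have "cle (x * x) (?U (T x * T x))" using bij_betw_inv_into_left[OF bij] x by simp
  then have "cle (T (x * x)) (T (?U (T x * T x)))" using cle_iff U.selfadj_T sas by simp
  then show "cle (T (x * x)) (T x * T x)" using bij_betw_inv_into_right[OF bij] sas by simp
qed

lemma T_Jordan:
  assumes "selfadj x" "selfadj y"
  shows "T (x * y + y * x) = T x * T y + T y * T x"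
proof -
  have sas: "selfadj (x * x)" "selfadj (y * y)" "selfadj (x * y + y * x)" "selfadj (x + y)"
    using assms by (auto intro: selfadj_intros)
  have "(x + y) * (x + y) = (x * x + y * y) + (x * y + y * x)" by (simp add: algebra_simps)
  then have "(T x + T y) * (T x + T y) = T x * T x + T y * T y + T (x * y + y * x)"
    using T_square[OF sas(4)] T_square assms sas by (simp add: T_add selfadj_intros)
  then show ?thesis by (simp add: algebra_simps)
qed

lemma T_power:
  assumes x: "selfadj x"
  shows "T (x ^ n) = T x ^ n"
proof (induction n)
  case 0 then show ?case by (simp add: T_1)
next
  case (Suc n)
  have "T (x * x ^ n + x ^ n * x) = T x * T x ^ n + T x ^ n * T x"
    using T_Jordan[OF x selfadj_power[OF x]] Suc by simp
  then have "T (x ^ Suc n + x ^ Suc n) = T x ^ Suc n + T x ^ Suc n" by (simp add: power_commutes)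
  then have "T (x ^ Suc n) + T (x ^ Suc n) = T x ^ Suc n + T x ^ Suc n"
    using T_double[OF selfadj_power[OF x, of "Suc n"]] by simp
  then show ?case by (metis scaleR_half_double)
qed

lemma T_exp:
  assumes x: "selfadj x"
  shows "T (exp x) = exp (T x)"
proof -
  let ?S = "\<lambda>n. \<Sum>i<n. x ^ i /\<^sub>R fact i"
  have sa: "selfadj (?S n)" for n using x by (intro selfadj_sum selfadj_intros selfadj_power)
  have S: "?S \<longlonglongrightarrow> exp x" using exp_converges[of x] by (simp add: sums_def)
  have "(\<lambda>n. T (?S n)) \<longlonglongrightarrow> T (exp x)"
  proof (rule tendsto_dist_iff[THEN iffD2], rule tendsto_sandwich)
    show "\<forall>\<^sub>F n in sequentially. 0 \<le> dist (T (?S n)) (T (exp x))" by simp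
    show "\<forall>\<^sub>F n in sequentially. dist (T (?S n)) (T (exp x)) \<le> dist (?S n) (exp x)"
    proof (intro always_eventually allI)
      fix n
      show "dist (T (?S n)) (T (exp x)) \<le> dist (?S n) (exp x)"
        using norm_T_le[OF selfadj_intros(2)[OF sa[of n] selfadj_exp[OF x]]] T_diff[OF sa[of n] selfadj_exp[OF x]]
        by (simp add: dist_norm)
    qed
    show "(\<lambda>n. dist (?S n) (exp x)) \<longlonglongrightarrow> 0" by (rule tendsto_dist_iff[THEN iffD1, OF S])
  qed simp
  moreover have "T (?S n) = (\<Sum>i<n. T x ^ i /\<^sub>R fact i)" for n
    using x by (simp add: T_sum T_scaleR T_power selfadj_intros selfadj_power)
  ultimately have "(\<lambda>n. \<Sum>i<n. T x ^ i /\<^sub>R fact i) \<longlonglongrightarrow> T (exp x)" by simp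
  moreover have "(\<lambda>n. \<Sum>i<n. T x ^ i /\<^sub>R fact i) \<longlonglongrightarrow> exp (T x)" using exp_converges[of "T x"] by (simp add: sums_def)
  ultimately show ?thesis by (rule LIMSEQ_unique)
qed

text \<open>Since T commutes with exp and real scaling, exp (\<alpha> T x) is T applied to exp
  (\<alpha> x), and preservation of the usual order already gives every exponent.\<close>

lemma exp_le_T_iff:
  assumes "selfadj x" "selfadj y"
  shows "exp_le \<alpha> (T x) (T y) \<longleftrightarrow> exp_le \<alpha> x y"
proof -
  have "exp (\<alpha> *\<^sub>R T z) = T (exp (\<alpha> *\<^sub>R z))" if "selfadj z" for z
    using that T_exp[of "\<alpha> *\<^sub>R z"] T_scaleR by (simp add: selfadj_intros)
  then show ?thesis
    unfolding exp_le_def using assms cle_iff by (simp add: selfadj_intros selfadj_exp)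
qed

end

section \<open>Extension to Jordan *-isomorphisms\<close>

abbreviation imult :: "'a::cstar_algebra \<Rightarrow> 'a" where
  "imult \<equiv> cscale \<i>"

lemma cscale_0 [simp]: "cscale c 0 = (0::'a::cstar_algebra)"
  using cscale_add_right[of c "0::'a" 0] by simp

lemma cscale_minus: "cscale c (- x) = - cscale c (x::'a::cstar_algebra)"
  using cscale_add_right[of c x "- x"] by (simp add: eq_neg_iff_add_eq_0 add.commute)

lemma cscale_diff: "cscale c (x - y) = cscale c x - cscale c (y::'a::cstar_algebra)"
  using cscale_add_right[of c x "- y"] by (simp add: cscale_minus)

lemma cscale_scaleR: "cscale c (r *\<^sub>R x) = r *\<^sub>R cscale c (x::'a::cstar_algebra)"
  by (simp add: cscale_of_real[symmetric] cscale_assoc mult.commute)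

lemma imult_imult: "imult (imult x) = - (x::'a::cstar_algebra)"
  using cscale_of_real[of "-1" x] by (simp add: cscale_assoc)

lemma cscale_eq: "cscale c x = Re c *\<^sub>R x + Im c *\<^sub>R imult (x::'a::cstar_algebra)"
proof -
  have "cscale c x = cscale (complex_of_real (Re c) + complex_of_real (Im c) * \<i>) x"
    by (simp add: complex_eq[symmetric] mult.commute)
  then show ?thesis
    by (simp add: cscale_add_left cscale_of_real cscale_assoc[symmetric])
qed

lemma cstar_imult: "cstar (imult x) = - imult (cstar (x::'a::cstar_algebra))"
  by (simp add: cstar_cscale cscale_eq[of "- \<i>"])

definition re_part :: "'a::cstar_algebra \<Rightarrow> 'a" where
  "re_part x = (1/2) *\<^sub>R (x + cstar x)"

definition im_part :: "'a::cstar_algebra \<Rightarrow> 'a" where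
  "im_part x = (1/2) *\<^sub>R imult (cstar x - x)"

lemma selfadj_parts: "selfadj (re_part x)" "selfadj (im_part x)"
  by (simp_all add: selfadj_def re_part_def im_part_def cstar_scaleR cstar_add cstar_diff cstar_cstar
      cstar_imult cscale_diff add.commute)

lemma parts_decomposition: "x = re_part x + imult (im_part x)"
proof -
  have "imult (im_part x) = (1/2) *\<^sub>R (x - cstar x)"
    by (simp add: im_part_def cscale_scaleR imult_imult)
  moreover have "x = (1/2) *\<^sub>R (x + x)" by simp
  ultimately show ?thesis by (simp add: re_part_def flip: scaleR_add_right)
qed

lemma parts_of_sum:
  assumes "selfadj p" "selfadj q"
  shows "re_part (p + imult q) = p" "im_part (p + imult q) = q"
proof -
  have *: "cstar (p + imult q) = p - imult q" using assms by (simp add: cstar_add cstar_imult selfadj_def)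
  have "p + imult q + (p - imult q) = p + p" "imult (p - imult q - (p + imult q)) = q + q"
    by (simp_all add: cscale_diff cscale_add_right cscale_minus imult_imult)
  then show "re_part (p + imult q) = p" "im_part (p + imult q) = q"
    unfolding re_part_def im_part_def * by simp_all
qed

lemma parts_cases:
  fixes x :: "'a::cstar_algebra"
  obtains p q where "selfadj p" "selfadj q" "x = p + imult q"
  using parts_decomposition selfadj_parts by blast

context selfadj_order_iso
begin

definition extension :: "'a \<Rightarrow> 'b" where
  "extension x = T (re_part x) + imult (T (im_part x))"

lemma extension_sum: "selfadj p \<Longrightarrow> selfadj q \<Longrightarrow> extension (p + imult q) = T p + imult (T q)"
  by (simp add: extension_def parts_of_sum)

lemma extension_selfadj: "selfadj x \<Longrightarrow> extension x = T x"
  using extension_sum[of x 0] by simp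

lemma jordan_star_iso_extension: "jordan_star_iso extension"
  unfolding jordan_star_iso_def clinear_map_def
proof (intro conjI allI)
  fix x y :: 'a and c :: complex
  obtain p q where x: "selfadj p" "selfadj q" "x = p + imult q" by (rule parts_cases)
  obtain r s where y: "selfadj r" "selfadj s" "y = r + imult s" by (rule parts_cases)
  have "x + y = (p + r) + imult (q + s)" by (simp add: x y cscale_add_right)
  then have "extension (x + y) = T (p + r) + imult (T (q + s))"
    using x y by (simp only: extension_sum selfadj_intros)
  then show "extension (x + y) = extension x + extension y"
    unfolding x(3) y(3) using x y by (simp add: extension_sum T_add cscale_add_right)
  have "cscale c x = (Re c *\<^sub>R p - Im c *\<^sub>R q) + imult (Re c *\<^sub>R q + Im c *\<^sub>R p)"
    unfolding cscale_eq[of c] x by (simp add: cscale_add_right cscale_scaleR imult_imult algebra_simps)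
  then have "extension (cscale c x) = T (Re c *\<^sub>R p - Im c *\<^sub>R q) + imult (T (Re c *\<^sub>R q + Im c *\<^sub>R p))"
    using x by (simp only: extension_sum selfadj_intros)
  then show "extension (cscale c x) = cscale c (extension x)"
    unfolding x(3) cscale_eq[of c] using x
    by (simp add: extension_sum T_add T_diff T_scaleR selfadj_intros cscale_add_right cscale_scaleR imult_imult algebra_simps)
  have "x * y + y * x = ((p * r + r * p) - (q * s + s * q)) + imult ((p * s + s * p) + (q * r + r * q))"
    by (simp add: x y distrib_left distrib_right cscale_mult_left cscale_mult_right cscale_add_right imult_imult)
  then have "extension (x * y + y * x) = T ((p * r + r * p) - (q * s + s * q)) + imult (T ((p * s + s * p) + (q * r + r * q)))"
    using x y by (simp only: extension_sum selfadj_intros)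
  then show "extension (x * y + y * x) = extension x * extension y + extension y * extension x"
    unfolding x(3) y(3) using x y
    by (simp add: extension_sum T_add T_diff T_Jordan selfadj_intros distrib_left distrib_right
        cscale_mult_left cscale_mult_right cscale_add_right imult_imult)
  have "cstar x = p + imult (- q)" using x by (simp add: cstar_add cstar_imult selfadj_def cscale_minus)
  then have "extension (cstar x) = T p + imult (T (- q))" using x by (simp only: extension_sum selfadj_intros)
  then show "extension (cstar x) = cstar (extension x)"
    unfolding x(3) using x selfadj_T[OF x(1)] selfadj_T[OF x(2)]
    by (simp add: extension_sum T_minus cstar_add cstar_imult selfadj_def cscale_minus)
next
  have "inj extension"
  proof (rule injI)
    fix x y :: 'a assume eq: "extension x = extension y"
    obtain p q where x: "selfadj p" "selfadj q" "x = p + imult q" by (rule parts_cases)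
    obtain r s where y: "selfadj r" "selfadj s" "y = r + imult s" by (rule parts_cases)
    have "T p + imult (T q) = T r + imult (T s)" using eq x y by (simp add: extension_sum)
    then have "T p = T r" "T q = T s" using parts_of_sum selfadj_T x y by metis+
    then have "p = r" "q = s" using bij x y by (auto simp: bij_betw_def inj_on_def)
    then show "x = y" using x y by simp
  qed
  moreover have "y \<in> range extension" for y
  proof -
    obtain r s where y: "selfadj r" "selfadj s" "y = r + imult s" by (rule parts_cases)
    then obtain p q where "selfadj p" "selfadj q" "T p = r" "T q = s"
      using bij unfolding bij_betw_def by (metis (no_types, lifting) imageE mem_Collect_eq)
    then have "extension (p + imult q) = y" using y by (simp add: extension_sum)
    then show ?thesis by blast
  qed
  ultimately show "bij extension" unfolding bij_def by blast
qed

end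

lemma algebra_star_iso_if_commutative:
  fixes J :: "'a::cstar_algebra \<Rightarrow> 'b::cstar_algebra"
  assumes J: "jordan_star_iso J" and comm: "commutative_alg TYPE('a)" "commutative_alg TYPE('b)"
  shows "algebra_star_iso J"
proof -
  have "J (x * y) = J x * J y" for x y
  proof -
    have "J (x * y + x * y) = J x * J y + J x * J y"
      using J comm unfolding jordan_star_iso_def commutative_alg_def by metis
    then have "J (x * y) + J (x * y) = J x * J y + J x * J y"
      using J unfolding jordan_star_iso_def clinear_map_def by metis
    then show ?thesis by (metis scaleR_half_double)
  qed
  then show ?thesis using J unfolding jordan_star_iso_def algebra_star_iso_def by blast
qed

section \<open>Commutativity\<close>

text \<open>Ogasawara's theorem: with \<open>A = x y + y x\<close> and \<open>B = i (x y - y x)\<close> one has \<open>A\<^sup>2 \<ge> B\<^sup>2\<close>, and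
  replacing \<open>y\<close> by \<open>y x y\<close> improves \<open>A\<^sup>2 \<ge> k B\<^sup>2\<close> to \<open>A\<^sup>4 \<ge> (k\<^sup>2 + 2 k - 1) B\<^sup>4\<close>.\<close>
locale squaring_monotone =
  fixes ty :: "'a::cstar_algebra itself"
  assumes square_iff: "pos_inv (x::'a) \<Longrightarrow> pos_inv y \<Longrightarrow> cle (x * x) (y * y) \<longleftrightarrow> cle x y"
begin

lemma square_mono:
  fixes x y :: 'a
  assumes "positive_el x" "cle x y"
  shows "cle (x * x) (y * y)"
proof (rule cle_limit)
  let ?e = "\<lambda>n. of_real (inverse (real (Suc n))) :: 'a"
  show "(\<lambda>n. (x + ?e n) * (x + ?e n)) \<longlonglongrightarrow> x * x" "(\<lambda>n. (y + ?e n) * (y + ?e n)) \<longlonglongrightarrow> y * y"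
    by (intro tendsto_mult tendsto_add_inverse_Suc)+
  have "positive_el (x + (y - x))" using assms by (intro positive_el_add) (auto simp: cle_def)
  then have "positive_el y" by simp
  then show "cle ((x + ?e n) * (x + ?e n)) ((y + ?e n) * (y + ?e n))" for n
    using assms square_iff[OF pos_inv_add_inverse_Suc pos_inv_add_inverse_Suc] cle_add_right[of "?e n"] by simp
qed

text \<open>Monotonicity of squares is available for invertible elements only. Replacing x by x + r
  would need 2 r x \<le> 2 r y, which is the claim; the root s of x x + r r is invertible instead,
  dominates x because it commutes with x, and satisfies s s \<le> (y + r)^2.\<close>

lemma square_cancel:
  fixes x y :: 'a
  assumes "positive_el x" "positive_el y" "cle (x * x) (y * y)"
  shows "cle x y"
proof (rule cle_limit[OF tendsto_const tendsto_add_inverse_Suc])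
  fix n
  define r where "r = inverse (real (Suc n))"
  have r: "r > 0" by (simp add: r_def)
  have sa: "selfadj x" "selfadj y" using assms positive_elD by auto
  have p: "pos_inv (x * x + of_real (r * r))"
    using positive_el_square[OF sa(1)] pos_inv_of_real[of "r * r"] r by (intro pos_inv_add) auto
  then obtain s where s: "pos_inv s" "s * s = x * x + of_real (r * r)" "\<And>v. v * (x * x + of_real (r * r)) = (x * x + of_real (r * r)) * v \<Longrightarrow> v * s = s * v"
    using pos_inv_sqrt_exists by blast
  have xs: "x * s = s * x" by (rule s(3)) (simp add: of_real_def algebra_simps)
  have "cle (x * x) (s * s)"
    unfolding s(2) cle_def using sa r by (auto intro!: selfadj_intros positive_el_of_real simp del: of_real_mult)
  then have xs_le: "cle x s" by (rule cle_if_squares_cle[OF assms(1) s(1) xs])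
  have "positive_el ((y * y - x * x) + (2 * r) *\<^sub>R y)"
    using assms r by (intro positive_el_add positive_el_scaleR) (auto simp: cle_def)
  also have "(y * y - x * x) + (2 * r) *\<^sub>R y = (y + of_real r) * (y + of_real r) - s * s"
    unfolding s(2) by (simp add: of_real_def algebra_simps flip: scaleR_2)
  finally have "cle (s * s) ((y + of_real r) * (y + of_real r))"
    using sa pos_inv_selfadj[OF s(1)] by (auto simp: cle_def intro!: selfadj_intros)
  moreover have "pos_inv (y + of_real r)" using assms r by (intro pos_inv_add pos_inv_of_real)
  ultimately have "cle s (y + of_real r)" using square_iff s(1) by blast
  then show "cle x (y + of_real (inverse (real (Suc n))))" using xs_le cle_trans unfolding r_def by blast
qed

text \<open>This is the derivative of squaring at x in direction y: square x \<le> x + t y, divide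
  the difference by t and let t tend to 0.\<close>

lemma anticommutator_positive:
  fixes x y :: 'a
  assumes "positive_el x" "positive_el y"
  shows "positive_el (x * y + y * x)"
proof (rule positive_el_limit)
  let ?t = "\<lambda>n. inverse (real (Suc n))"
  have "(\<lambda>n. x * y + y * x + ?t n *\<^sub>R (y * y)) \<longlonglongrightarrow> x * y + y * x + 0 *\<^sub>R (y * y)"
    by (intro tendsto_intros LIMSEQ_inverse_real_of_nat)
  then show "(\<lambda>n. x * y + y * x + ?t n *\<^sub>R (y * y)) \<longlonglongrightarrow> x * y + y * x" by simp
  fix n
  define t where "t = ?t n"
  have t: "t > 0" by (simp add: t_def)
  have "cle x (x + t *\<^sub>R y)"
    using assms t by (auto simp: cle_def positive_el_scaleR dest: positive_elD intro: selfadj_intros)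
  then have "positive_el ((x + t *\<^sub>R y) * (x + t *\<^sub>R y) - x * x)" using square_mono assms by (simp add: cle_def)
  then have "positive_el ((1 / t) *\<^sub>R ((x + t *\<^sub>R y) * (x + t *\<^sub>R y) - x * x))"
    using t by (intro positive_el_scaleR) auto
  also have "(x + t *\<^sub>R y) * (x + t *\<^sub>R y) - x * x = t *\<^sub>R (x * y + y * x + t *\<^sub>R (y * y))"
    by (simp add: algebra_simps)
  finally show "positive_el (x * y + y * x + ?t n *\<^sub>R (y * y))" using t by (simp add: t_def)
qed

text \<open>The square root fits the recursion, whose step raises the square of the constant by at
  least 1. As the constants are unbounded, dividing by them forces B B = 0 in
  \<open>positive_commute\<close>.\<close>

lemma commutator_bound:
  fixes x y :: 'a
  assumes "positive_el x" "positive_el y"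
  defines "A \<equiv> x * y + y * x" and "B \<equiv> imult (x * y - y * x)"
  shows "cle (sqrt (real (Suc n)) *\<^sub>R (B * B)) (A * A)"
  using assms(1,2) unfolding A_def B_def
proof (induction n arbitrary: x y)
  case (0 x y)
  define A B where "A = x * y + y * x" and "B = imult (x * y - y * x)"
  have sa: "selfadj x" "selfadj y" using 0 positive_elD by auto
  \<comment> \<open>Since B is i times a commutator, A A - B B is a sum of two squares, (x y + y
    x)^2 + (x y - y x)^2, which equals twice the anticommutator of x and y x y.\<close>
  have yxy: "positive_el (y * x * y)" using positive_el_congruence[OF 0(1) sa(2)] .
  have "positive_el (2 *\<^sub>R (x * (y * x * y) + (y * x * y) * x))"
    using anticommutator_positive[OF 0(1) yxy] by (intro positive_el_scaleR) auto
  also have "2 *\<^sub>R (x * (y * x * y) + (y * x * y) * x) = A * A - B * B"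
    unfolding A_def B_def
    by (simp add: cscale_mult_left cscale_mult_right cscale_diff cscale_add_right imult_imult algebra_simps scaleR_2)
  finally have "positive_el (A * A - B * B)" .
  moreover have "selfadj A" "selfadj B"
    unfolding A_def B_def selfadj_def using sa
    by (simp_all add: cstar_add cstar_diff cstar_mult cstar_imult selfadj_def cscale_diff add.commute)
  ultimately show ?case unfolding A_def[symmetric] B_def[symmetric] by (auto simp: cle_def intro: selfadj_intros)
next
  case (Suc n x y)
  define A B where "A = x * y + y * x" and "B = imult (x * y - y * x)"
  define k where "k = sqrt (real (Suc n))"
  have k: "k \<ge> 1" "k * k = real (Suc n)" by (simp_all add: k_def)
  have sa: "selfadj x" "selfadj y" using Suc.prems positive_elD by auto
  have saAB: "selfadj A" "selfadj B"
    unfolding A_def B_def selfadj_def using sa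
    by (simp_all add: cstar_add cstar_diff cstar_mult cstar_imult selfadj_def cscale_diff add.commute)
  have saAA: "selfadj (A * A)" "selfadj (B * B)" using saAB by (auto intro: selfadj_intros)
  have saAA2: "selfadj (A * A * (A * A))" "selfadj (B * B * (B * B))" using saAA by (auto intro: selfadj_intros)
  have posA: "positive_el A" unfolding A_def using anticommutator_positive Suc.prems by blast
  have posBB: "positive_el (B * B)" "positive_el (A * A)" using positive_el_square saAB by auto
  define z where "z = y * x * y"
  have z: "positive_el z" unfolding z_def using positive_el_congruence[OF Suc.prems(1) sa(2)] .
  define P Q where "P = x * z + z * x" and "Q = imult (x * z - z * x)"
  \<comment> \<open>The induction hypothesis for the pair x, y x y thereby turns into an inequality
    in A and B alone: (A A - B B)^2 dominates k (A B + B A)^2.\<close>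
  have PQ: "2 *\<^sub>R P = A * A - B * B" "2 *\<^sub>R Q = A * B + B * A"
    unfolding A_def B_def P_def Q_def z_def
    by (simp_all add: cscale_mult_left cscale_mult_right imult_imult cscale_diff cscale_add_right algebra_simps scaleR_2)
  have "cle (k *\<^sub>R (Q * Q)) (P * P)"
    using Suc.IH[OF Suc.prems(1) z] unfolding P_def Q_def k_def .
  then have "cle (4 *\<^sub>R (k *\<^sub>R (Q * Q))) (4 *\<^sub>R (P * P))" by (rule cle_scaleR) simp
  moreover have "4 *\<^sub>R (P * P) = (2 *\<^sub>R P) * (2 *\<^sub>R P)" "4 *\<^sub>R (k *\<^sub>R (Q * Q)) = k *\<^sub>R ((2 *\<^sub>R Q) * (2 *\<^sub>R Q))" by simp_all
  ultimately have 1: "positive_el ((A * A - B * B) * (A * A - B * B) - k *\<^sub>R ((A * B + B * A) * (A * B + B * A)))"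
    unfolding PQ cle_def by simp
  have AB: "positive_el (A * A - k *\<^sub>R (B * B))"
    using Suc.IH[OF Suc.prems] unfolding A_def[symmetric] B_def[symmetric] k_def[symmetric] by (simp add: cle_def)
  have 2: "positive_el (A * (B * B) * A)" by (rule positive_el_congruence[OF posBB(1) saAB(1)])
  have 3: "positive_el (B * (A * A - k *\<^sub>R (B * B)) * B)" by (rule positive_el_congruence[OF AB saAB(2)])
  have 4: "positive_el (A * (B * A * B) + (B * A * B) * A)"
    by (rule anticommutator_positive[OF posA positive_el_congruence[OF posA saAB(2)]])
  have 5: "positive_el ((A * A - k *\<^sub>R (B * B)) * (B * B) + (B * B) * (A * A - k *\<^sub>R (B * B)))"
    by (rule anticommutator_positive[OF AB posBB(1)])
  \<comment> \<open>The added positive terms are chosen to cancel all mixed products: k times the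
    third bracket removes the expansion of (A B + B A)^2 at the cost of k^2 B^4, and the last line
    removes A^2 B^2 + B^2 A^2 at the cost of 2 k B^4.\<close>
  have "positive_el ((A * A - B * B) * (A * A - B * B) - k *\<^sub>R ((A * B + B * A) * (A * B + B * A))
     + k *\<^sub>R (A * (B * B) * A + B * (A * A - k *\<^sub>R (B * B)) * B + (A * (B * A * B) + (B * A * B) * A))
     + ((A * A - k *\<^sub>R (B * B)) * (B * B) + (B * B) * (A * A - k *\<^sub>R (B * B))))"
    using k by (intro positive_el_add[OF positive_el_add[OF 1
          positive_el_scaleR[OF positive_el_add[OF positive_el_add[OF 2 3] 4]]] 5]) auto
  also have "((A * A - B * B) * (A * A - B * B) - k *\<^sub>R ((A * B + B * A) * (A * B + B * A))
     + k *\<^sub>R (A * (B * B) * A + B * (A * A - k *\<^sub>R (B * B)) * B + (A * (B * A * B) + (B * A * B) * A))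
     + ((A * A - k *\<^sub>R (B * B)) * (B * B) + (B * B) * (A * A - k *\<^sub>R (B * B))))
     = A * A * (A * A) - (k * k + (k + k) - 1) *\<^sub>R (B * B * (B * B))"
    by (simp add: algebra_simps scaleR_2) (simp add: scaleR_add_left[symmetric])
  finally have *: "positive_el (A * A * (A * A) - (k * k + (k + k) - 1) *\<^sub>R (B * B * (B * B)))" .
  have combine: "u - a *\<^sub>R v + b *\<^sub>R v = u - (a - b) *\<^sub>R v" for u v :: 'a and a b :: real
    by (simp add: scaleR_diff_left)
  \<comment> \<open>As k k = n + 1, the coefficient exceeds n + 2 by 2 k - 2, which is nonnegative
    for k \<ge> 1 and is discarded.\<close>
  have coef: "(k * k + (k + k) - 1) - (k + k - 2) = real (Suc (Suc n))" using k by simp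
  have "positive_el (A * A * (A * A) - (k * k + (k + k) - 1) *\<^sub>R (B * B * (B * B))
      + (k + k - 2) *\<^sub>R (B * B * (B * B)))"
    using k by (intro positive_el_add[OF * positive_el_scaleR[OF positive_el_square[OF saAA(2)]]]) auto
  also have "A * A * (A * A) - (k * k + (k + k) - 1) *\<^sub>R (B * B * (B * B)) + (k + k - 2) *\<^sub>R (B * B * (B * B))
      = A * A * (A * A) - real (Suc (Suc n)) *\<^sub>R (B * B * (B * B))"
    unfolding coef[symmetric] by (rule combine)
  also have "\<dots> = A * A * (A * A) - (sqrt (real (Suc (Suc n))) *\<^sub>R (B * B)) * (sqrt (real (Suc (Suc n))) *\<^sub>R (B * B))"
    by simp
  finally have "cle ((sqrt (real (Suc (Suc n))) *\<^sub>R (B * B)) * (sqrt (real (Suc (Suc n))) *\<^sub>R (B * B))) (A * A * (A * A))"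
    using saAA2 by (simp add: cle_def selfadj_intros)
  then have "cle (sqrt (real (Suc (Suc n))) *\<^sub>R (B * B)) (A * A)"
    by (rule square_cancel[OF positive_el_scaleR[OF posBB(1)] posBB(2), rotated]) simp
  then show ?case unfolding A_def B_def .
qed

lemma positive_commute:
  fixes x y :: 'a
  assumes "positive_el x" "positive_el y"
  shows "x * y = y * x"
proof -
  define A B where "A = x * y + y * x" and "B = imult (x * y - y * x)"
  have sa: "selfadj x" "selfadj y" using assms positive_elD by auto
  have saB: "selfadj B"
    unfolding B_def selfadj_def using sa by (simp add: cstar_diff cstar_mult cstar_imult selfadj_def cscale_diff)
  let ?t = "\<lambda>n. 1 / sqrt (real (Suc n))"
  have "positive_el (?t n *\<^sub>R (A * A) - B * B)" for n
  proof -
    have "positive_el (A * A - sqrt (real (Suc n)) *\<^sub>R (B * B))"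
      using commutator_bound[OF assms, of n] unfolding A_def[symmetric] B_def[symmetric] cle_def by blast
    then have "positive_el (?t n *\<^sub>R (A * A - sqrt (real (Suc n)) *\<^sub>R (B * B)))" by (intro positive_el_scaleR) auto
    then show ?thesis by (simp add: scaleR_diff_right del: of_nat_Suc)
  qed
  moreover have "(\<lambda>n. ?t n *\<^sub>R (A * A) - B * B) \<longlonglongrightarrow> 0 *\<^sub>R (A * A) - B * B"
  proof (intro tendsto_intros)
    have "filterlim (\<lambda>n. sqrt (real (Suc n))) at_top sequentially"
      using filterlim_compose[OF sqrt_at_top filterlim_compose[OF filterlim_real_sequentially filterlim_Suc]] by simp
    then show "?t \<longlonglongrightarrow> 0" using tendsto_divide_0 tendsto_const filterlim_at_top_imp_at_infinity by blast
  qed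
  ultimately have "positive_el (0 *\<^sub>R (A * A) - B * B)" by (rule positive_el_limit[rotated])
  then have "positive_el (- (B * B))" by simp
  then have "B * B = 0" by (rule positive_el_antisym[OF positive_el_square[OF saB]])
  then have "B = 0" using norm_square_selfadj[OF saB] by simp
  then have "imult (imult (x * y - y * x)) = 0" by (simp add: B_def)
  then show ?thesis by (simp add: imult_imult)
qed

lemma commutative: "commutative_alg TYPE('a)"
proof -
  have sa: "p * q = q * p" if "selfadj p" "selfadj q" for p q :: 'a
  proof -
    have "(of_real (norm p) + p) * (of_real (norm q) + q) = (of_real (norm q) + q) * (of_real (norm p) + p)"
      using that by (intro positive_commute positive_el_norm_plus) auto
    then show ?thesis by (simp add: of_real_def algebra_simps)
  qed
  have "x * y = y * x" for x y :: 'a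
  proof -
    obtain p q where x: "selfadj p" "selfadj q" "x = p + imult q" by (rule parts_cases)
    obtain r s where y: "selfadj r" "selfadj s" "y = r + imult s" by (rule parts_cases)
    show ?thesis
      using sa[OF x(1) y(1)] sa[OF x(1) y(2)] sa[OF x(2) y(1)] sa[OF x(2) y(2)]
      by (simp add: x y distrib_left distrib_right cscale_mult_left cscale_mult_right cscale_add_right imult_imult algebra_simps)
  qed
  then show ?thesis by (simp add: commutative_alg_def)
qed

end

section \<open>From coinciding orders to monotone squaring\<close>

lemma exp_scaleR_2:
  fixes x :: "'a::{real_normed_algebra_1,banach}"
  shows "exp (2 *\<^sub>R x) = exp x * exp x"
  by (simp add: scaleR_2 exp_add_commuting)

text \<open>Squaring exp x doubles x, and doubling preserves the usual order; if exp preserves and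
  reflects this order, so does squaring on positive invertible elements.\<close>

lemma commutative_if_exp_monotone:
  assumes "\<And>x y :: 'a::cstar_algebra. selfadj x \<Longrightarrow> selfadj y \<Longrightarrow> exp_le 1 x y \<longleftrightarrow> cle x y"
  shows "commutative_alg TYPE('a)"
proof -
  interpret squaring_monotone "TYPE('a)"
  proof
    fix a b :: 'a assume "pos_inv a" "pos_inv b"
    then obtain x y where xy: "selfadj x" "a = exp x" "selfadj y" "b = exp y"
      using selfadj_ln exp_ln_pos_inv by metis
    have "cle (a * a) (b * b) \<longleftrightarrow> exp_le 1 (2 *\<^sub>R x) (2 *\<^sub>R y)"
      by (simp add: exp_le_def xy exp_scaleR_2)
    also have "\<dots> \<longleftrightarrow> cle x y" using assms xy by (simp add: selfadj_intros cle_scaleR_iff)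
    also have "\<dots> \<longleftrightarrow> cle a b" using assms[of x y] xy by (simp add: exp_le_def)
    finally show "cle (a * a) (b * b) \<longleftrightarrow> cle a b" .
  qed
  show ?thesis by (rule commutative)
qed

text \<open>For \<alpha> > 0 the hypothesis says that \<open>exp_le 1\<close> is invariant under
  scaling by r = \<alpha> / \<beta> < 1. Iterating brings any pair to the origin, where this order
  is compared with the usual one; for \<alpha> = 0 rescaling by 1 / \<beta> is enough.\<close>

lemma commutative_if_exp_le_eq:
  assumes ab: "0 \<le> \<alpha>" "\<alpha> < \<beta>"
    and eq: "\<And>x y :: 'a::cstar_algebra. selfadj x \<Longrightarrow> selfadj y \<Longrightarrow> exp_le \<alpha> x y \<longleftrightarrow> exp_le \<beta> x y"
  shows "commutative_alg TYPE('a)"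
proof (rule commutative_if_exp_monotone)
  fix x y :: 'a assume sa: "selfadj x" "selfadj y"
  show "exp_le 1 x y \<longleftrightarrow> cle x y"
  proof (cases "\<alpha> = 0")
    case True
    have "exp_le 1 x y \<longleftrightarrow> exp_le \<beta> ((1 / \<beta>) *\<^sub>R x) ((1 / \<beta>) *\<^sub>R y)" using ab by (simp add: exp_le_1_iff[of \<beta>])
    also have "\<dots> \<longleftrightarrow> cle ((1 / \<beta>) *\<^sub>R x) ((1 / \<beta>) *\<^sub>R y)"
      using eq[of "(1 / \<beta>) *\<^sub>R x" "(1 / \<beta>) *\<^sub>R y"] True sa by (simp add: exp_le_def selfadj_intros)
    finally show ?thesis using ab by (simp add: cle_scaleR_iff)
  next
    case False
    then have a: "\<alpha> > 0" using ab by simp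
    define r where "r = \<alpha> / \<beta>"
    have r: "0 < r" "r < 1" using a ab by (auto simp: r_def)
    have step: "exp_le 1 u v \<longleftrightarrow> exp_le 1 (r *\<^sub>R u) (r *\<^sub>R v)" if "selfadj u" "selfadj v" for u v :: 'a
      using eq[of "(1 / \<beta>) *\<^sub>R u" "(1 / \<beta>) *\<^sub>R v"] that a ab
      by (simp add: exp_le_1_iff[of \<alpha>] exp_le_1_iff[of \<beta>] selfadj_intros r_def)
    have pow: "exp_le 1 u v \<longleftrightarrow> exp_le 1 (r ^ n *\<^sub>R u) (r ^ n *\<^sub>R v)" if "selfadj u" "selfadj v" for u v :: 'a and n
      using step[of "r ^ n *\<^sub>R u" "r ^ n *\<^sub>R v" for n] that
      by (induction n) (simp_all add: selfadj_intros)
    have lim: "filterlim (\<lambda>n. r ^ n) (at_right 0) sequentially" using r by (rule filterlim_powers_at_right_0)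
    show ?thesis
    proof
      assume "exp_le 1 x y"
      then show "cle x y"
        using pow[OF sa] by (intro cle_if_eventually_exp_le[OF sa _ lim, of 1]) auto
    next
      assume le: "cle x y"
      interpret reflection_space "{x::'a. selfadj x}" "exp_le 1" translate "exp_reflect 1"
        by (rule reflection_space_exp_le) simp
      show "exp_le 1 x y"
      proof (rule tr_closure)
        fix s :: real assume "s > 0"
        have "\<forall>\<^sub>F n in sequentially. exp_le 1 (r ^ n *\<^sub>R x) (r ^ n *\<^sub>R translate s y)"
          using filterlim_iff[THEN iffD1, OF lim, rule_format, OF eventually_exp_le[OF le \<open>s > 0\<close>]] by simp
        then obtain n where "exp_le 1 (r ^ n *\<^sub>R x) (r ^ n *\<^sub>R translate s y)"
          using eventually_happens'[OF sequentially_bot] by blast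
        then show "exp_le 1 x (translate s y)" using pow[OF sa(1) selfadj_translate[OF sa(2)]] by blast
      qed (use sa in auto)
    qed
  qed
qed

section \<open>The classification\<close>

lemma pos_inv_expE:
  fixes A :: "'a::cstar_algebra"
  assumes "pos_inv A"
  obtains x where "selfadj x" "A = exp x"
  using selfadj_ln[OF assms] exp_ln_pos_inv[OF assms] by metis

text \<open>The origin corresponds to the unit, so the congruence M 1 M is a square. The result is
  independent of the exponent, which lets doubling pass between the \<alpha>- and the
  \<beta>-geometry.\<close>

lemma exp_reflect_0:
  assumes "selfadj x"
  shows "exp_reflect \<alpha> x 0 = x + x"
proof (cases "\<alpha> = 0")
  case True then show ?thesis by (simp add: exp_reflect_def)
next
  case False
  have "exp (\<alpha> *\<^sub>R exp_reflect \<alpha> x 0) = exp (\<alpha> *\<^sub>R (x + x))"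
    using exp_exp_reflect[OF assms selfadj_simps(1) False]
    by (simp add: scaleR_add_right exp_add_commuting)
  then have "\<alpha> *\<^sub>R exp_reflect \<alpha> x 0 = \<alpha> *\<^sub>R (x + x)"
    using assms by (intro exp_inj_selfadj[of "\<alpha> *\<^sub>R exp_reflect \<alpha> x 0"] selfadj_intros selfadj_exp_reflect selfadj_simps)
  then show ?thesis using False by simp
qed

text \<open>\<open>cle_transfer\<close> works in one direction, so it is used for \<theta> and, with
  the exponents exchanged, for its inverse.\<close>

lemma selfadj_order_isoI:
  fixes \<theta> :: "'a::cstar_algebra \<Rightarrow> 'b::cstar_algebra"
  assumes ab: "\<alpha> \<ge> 0" "\<beta> \<ge> 0"
    and bij: "bij_betw \<theta> {x. selfadj x} {y. selfadj y}"
    and le: "\<And>x y. selfadj x \<Longrightarrow> selfadj y \<Longrightarrow> exp_le \<alpha> x y \<longleftrightarrow> exp_le \<beta> (\<theta> x) (\<theta> y)"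
    and tr: "\<And>x s. selfadj x \<Longrightarrow> \<theta> (translate s x) = translate s (\<theta> x)"
    and double: "\<And>x. selfadj x \<Longrightarrow> \<theta> (x + x) = \<theta> x + \<theta> x"
  shows "selfadj_order_iso \<theta>"
proof
  let ?U = "inv_into {x. selfadj x} \<theta>"
  have sa: "selfadj (\<theta> x)" if "selfadj x" for x using bij that by (auto dest: bij_betwE)
  have U: "selfadj (?U y)" "\<theta> (?U y) = y" if "selfadj y" for y
    using bij_betwE[OF bij_betw_inv_into[OF bij]] bij_betw_inv_into_right[OF bij] that by auto
  have U\<theta>: "?U (\<theta> x) = x" if "selfadj x" for x
    using bij_betw_inv_into_left[OF bij] that by auto
  have half: "\<theta> ((1/2) *\<^sub>R x) = (1/2) *\<^sub>R \<theta> x" if "selfadj x" for x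
  proof -
    have "\<theta> ((1/2) *\<^sub>R x + (1/2) *\<^sub>R x) = \<theta> ((1/2) *\<^sub>R x) + \<theta> ((1/2) *\<^sub>R x)"
      using that by (intro double selfadj_intros)
    then have "\<theta> x = \<theta> ((1/2) *\<^sub>R x) + \<theta> ((1/2) *\<^sub>R x)" by (simp flip: scaleR_add_left)
    then show ?thesis by simp
  qed
  show "bij_betw \<theta> {x. selfadj x} {y. selfadj y}" by fact
  show "\<theta> (translate s x) = translate s (\<theta> x)" if "selfadj x" for s x using tr that .
  show "\<theta> 0 = 0" using double[of 0] by simp
  have fwd: "cle x y \<Longrightarrow> cle (\<theta> x) (\<theta> y)" for x y
    using cle_transfer[of \<alpha> \<beta> \<theta> x y] ab sa half tr le by blast
  have U_half: "?U ((1/2) *\<^sub>R y) = (1/2) *\<^sub>R ?U y" if "selfadj y" for y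
    using U\<theta>[OF selfadj_intros(4)[OF U(1)[OF that]], of "1/2"] half[OF U(1)[OF that]] U(2)[OF that] by simp
  have U_tr: "?U (translate s y) = translate s (?U y)" if "selfadj y" for y s
    using U\<theta>[OF selfadj_translate[OF U(1)[OF that]], of s] tr[OF U(1)[OF that], of s] U(2)[OF that] by simp
  have U_le: "exp_le \<beta> x y \<Longrightarrow> exp_le \<alpha> (?U x) (?U y)" if "selfadj x" "selfadj y" for x y
    using le[OF U(1)[OF that(1)] U(1)[OF that(2)]] U(2)[OF that(1)] U(2)[OF that(2)] by simp
  have bwd: "cle x y \<Longrightarrow> cle (?U x) (?U y)" for x y
    using cle_transfer[of \<beta> \<alpha> ?U x y] ab U(1) U_half U_tr U_le by blast
  show "cle (\<theta> x) (\<theta> y) \<longleftrightarrow> cle x y" if "selfadj x" "selfadj y" for x y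
    using fwd[of x y] bwd[of "\<theta> x" "\<theta> y"] U\<theta> that by auto
qed

text \<open>\<open>X\<close> and \<open>T\<close> come from normalizing \<open>L\<close> so that \<open>T 0 = 0\<close>.\<close>
lemma exp_order_iso_structure:
  fixes L :: "'a::cstar_algebra \<Rightarrow> 'b::cstar_algebra"
  assumes ab: "\<alpha> \<ge> 0" "\<beta> \<ge> 0"
    and L: "signed_iso True {x. selfadj x} (exp_le \<alpha>) translate {y. selfadj y} (exp_le \<beta>) translate L"
  obtains X T where "selfadj X" "selfadj_order_iso T"
    "\<And>x y. selfadj x \<Longrightarrow> selfadj y \<Longrightarrow> exp_le \<alpha> x y \<longleftrightarrow> exp_le \<beta> (T x) (T y)"
    "\<And>x. selfadj x \<Longrightarrow> \<beta> = 0 \<Longrightarrow> L x = T x + X"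
    "\<And>x. selfadj x \<Longrightarrow> \<beta> > 0 \<Longrightarrow> exp (\<beta> *\<^sub>R L x) = exp X * exp (\<beta> *\<^sub>R T x) * exp X"
proof -
  have bij: "bij_betw L {x. selfadj x} {y. selfadj y}"
    and le: "\<And>x y. selfadj x \<Longrightarrow> selfadj y \<Longrightarrow> exp_le \<alpha> x y \<longleftrightarrow> exp_le \<beta> (L x) (L y)"
    and tr: "\<And>s x. selfadj x \<Longrightarrow> L (translate s x) = translate s (L x)"
    using L by (auto simp: signed_iso_def)
  have sa: "selfadj (L x)" if "selfadj x" for x using bij that by (auto dest: bij_betwE)
  have double: "L (x + x) = exp_reflect \<beta> (L x) (L 0)" if "selfadj x" for x
    using iso_preserves_reflections[OF reflection_space_exp_le[OF ab(1)] reflection_space_exp_le[OF ab(2)] L, of x 0]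
      that exp_reflect_0[OF that] by simp
  show thesis
  proof (cases "\<beta> = 0")
    case True
    define T where "T x = L x - L 0" for x
    have "selfadj_order_iso T"
    proof (rule selfadj_order_isoI[OF ab])
      have "T = (\<lambda>y. y - L 0) \<circ> L" by (simp add: T_def fun_eq_iff)
      moreover have "bij_betw (\<lambda>y. y - L 0) {y. selfadj y} {y. selfadj y}"
        using sa[of 0] by (intro bij_betwI[of _ _ _ "\<lambda>y. y + L 0"]) (auto intro: selfadj_intros)
      ultimately show "bij_betw T {x. selfadj x} {y. selfadj y}" using bij_betw_trans[OF bij] by simp
      show "exp_le \<alpha> x y \<longleftrightarrow> exp_le \<beta> (T x) (T y)" if "selfadj x" "selfadj y" for x y
        using le[OF that] True cle_add_right[of "- L 0" "L x" "L y"] sa[of 0]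
        by (simp add: T_def exp_le_def selfadj_intros)
      show "T (translate s x) = translate s (T x)" if "selfadj x" for s x
        using tr[OF that] by (simp add: T_def translate_def)
      show "T (x + x) = T x + T x" if "selfadj x" for x
        using double[OF that] True by (simp add: T_def exp_reflect_def)
    qed
    moreover have "exp_le \<alpha> x y \<longleftrightarrow> exp_le \<beta> (T x) (T y)" if "selfadj x" "selfadj y" for x y
      using le[OF that] True cle_add_right[of "- L 0" "L x" "L y"] sa[of 0]
      by (simp add: T_def exp_le_def selfadj_intros)
    ultimately show thesis
      using True sa[of 0] by (intro that[of "L 0" T]) (auto simp: T_def)
  next
    case False
    then have b: "\<beta> > 0" using ab by simp
    \<comment> \<open>Half of \<beta> L 0 is taken because the congruence by exp (- X) multiplies on
      both sides; it sends exp (\<beta> L 0) to 1, so that the normalized map fixes 0.\<close>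
    define X where "X = (1/2) *\<^sub>R (\<beta> *\<^sub>R L 0)"
    have X: "selfadj X" "selfadj (- X)" using sa[of 0] by (auto simp: X_def intro: selfadj_intros)
    define c c' where "c = exp X" and "c' = exp (- X)"
    have cc: "c * c' = 1" "c' * c = 1" unfolding c_def c'_def by (rule exp_minus_inverses)+
    have c: "pos_inv c" "pos_inv c'" unfolding c_def c'_def using X by (auto intro: pos_inv_exp)
    have c'sq: "c' * c' = exp (- (\<beta> *\<^sub>R L 0))"
      unfolding c'_def X_def using exp_half[of "- (\<beta> *\<^sub>R L 0)"] by simp
    define e where "e x = exp (\<beta> *\<^sub>R L x)" for x
    have e: "pos_inv (e x)" if "selfadj x" for x
      unfolding e_def using sa that by (auto intro!: pos_inv_exp selfadj_intros)
    define T where "T x = (1 / \<beta>) *\<^sub>R cfc ln (c' * e x * c')" for x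
    have p: "pos_inv (c' * e x * c')" if "selfadj x" for x
      using pos_inv_congruence[OF e[OF that] pos_inv_selfadj[OF c(2)] pos_inv_invertible[OF c(2)]] .
    have saT: "selfadj (T x)" if "selfadj x" for x
      unfolding T_def using selfadj_ln[OF p[OF that]] by (rule selfadj_intros)
    have eT: "exp (\<beta> *\<^sub>R T x) = c' * e x * c'" if "selfadj x" for x
      unfolding T_def using exp_ln_pos_inv[OF p[OF that]] b by simp
    have cec: "c * (c' * y * c') * c = y" "c' * (c * y * c) * c' = y" for y
    proof -
      have "c * (c' * y * c') * c = (c * c') * y * (c' * c)" "c' * (c * y * c) * c' = (c' * c) * y * (c * c')"
        by (simp_all only: mult.assoc)
      then show "c * (c' * y * c') * c = y" "c' * (c * y * c) * c' = y" using cc by simp_all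
    qed
    have inj: "x = y" if "selfadj x" "selfadj y" "exp (\<beta> *\<^sub>R x) = exp (\<beta> *\<^sub>R y)" for x y :: 'b
      using exp_inj_selfadj[of "\<beta> *\<^sub>R x" "\<beta> *\<^sub>R y"] that b by (simp add: selfadj_intros)
    have T_le: "exp_le \<alpha> x y \<longleftrightarrow> exp_le \<beta> (T x) (T y)" if "selfadj x" "selfadj y" for x y
    proof -
      have "exp_le \<beta> (T x) (T y) \<longleftrightarrow> cle (c' * e x * c') (c' * e y * c')"
        using that b by (simp add: exp_le_def eT)
      also have "\<dots> \<longleftrightarrow> cle (e x) (e y)"
        using cle_congruence[of "e x" "e y" c'] cle_congruence[of "c' * e x * c'" "c' * e y * c'" c]
          pos_inv_selfadj c cec by auto
      also have "\<dots> \<longleftrightarrow> exp_le \<alpha> x y" using le[OF that] b by (simp add: exp_le_def e_def)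
      finally show ?thesis by simp
    qed
    have "selfadj_order_iso T"
    proof (rule selfadj_order_isoI[OF ab])
      show "bij_betw T {x. selfadj x} {y. selfadj y}"
        unfolding bij_betw_def
      proof (intro conjI inj_onI equalityI subsetI)
        fix x y assume xy: "x \<in> {x. selfadj x}" "y \<in> {x. selfadj x}" "T x = T y"
        then have "e x = e y" using eT[of x] eT[of y] cec(1)[of "e x"] cec(1)[of "e y"] by simp
        then have "L x = L y" unfolding e_def using xy sa by (intro inj[of "L x" "L y"]) auto
        then show "x = y" using bij xy by (auto simp: bij_betw_def inj_on_def)
      next
        fix y :: 'b assume "y \<in> {y. selfadj y}"
        then have y: "selfadj y" by simp
        have q: "pos_inv (c * exp (\<beta> *\<^sub>R y) * c)"
          using pos_inv_congruence[OF pos_inv_exp[OF selfadj_intros(4)[OF y]] pos_inv_selfadj[OF c(1)] pos_inv_invertible[OF c(1)]] .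
        define z where "z = (1 / \<beta>) *\<^sub>R cfc ln (c * exp (\<beta> *\<^sub>R y) * c)"
        have "selfadj z" unfolding z_def using selfadj_ln[OF q] by (rule selfadj_intros)
        then obtain x where x: "selfadj x" "L x = z" using bij unfolding bij_betw_def by (metis (no_types, lifting) imageE mem_Collect_eq)
        have "e x = c * exp (\<beta> *\<^sub>R y) * c" unfolding e_def x(2) z_def using exp_ln_pos_inv[OF q] b by simp
        then have "exp (\<beta> *\<^sub>R T x) = exp (\<beta> *\<^sub>R y)" using eT[OF x(1)] cec by simp
        then have "T x = y" by (rule inj[OF saT[OF x(1)] y])
        then show "y \<in> T ` {x. selfadj x}" using x(1) by blast
      qed (use saT in auto)
      show "exp_le \<alpha> x y \<longleftrightarrow> exp_le \<beta> (T x) (T y)" if "selfadj x" "selfadj y" for x y using T_le that .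
      show "T (translate s x) = translate s (T x)" if x: "selfadj x" for s x
      proof (rule inj[OF saT[OF selfadj_translate[OF x]] selfadj_translate[OF saT[OF x]]])
        have "e (translate s x) = exp (\<beta> * s) *\<^sub>R e x"
          unfolding e_def tr[OF x] by (simp add: translate_def exp_scaleR_add_of_real)
        then have "exp (\<beta> *\<^sub>R T (translate s x)) = exp (\<beta> * s) *\<^sub>R (c' * e x * c')"
          unfolding eT[OF selfadj_translate[OF x]] by simp
        then show "exp (\<beta> *\<^sub>R T (translate s x)) = exp (\<beta> *\<^sub>R translate s (T x))"
          unfolding translate_def[of s "T x"] exp_scaleR_add_of_real eT[OF x] .
      qed
      show "T (x + x) = T x + T x" if x: "selfadj x" for x
      proof (rule inj[OF saT[OF selfadj_intros(1)[OF x x]] selfadj_intros(1)[OF saT[OF x] saT[OF x]]])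
        \<comment> \<open>L (x + x) is the reflection of L 0 through L x, and the inverse of exp
          (\<beta> L 0) is c' c'. Its two factors are just what normalizes each copy of e x.\<close>
        have "e (x + x) = e x * (c' * c') * e x"
          unfolding e_def double[OF x] c'sq using exp_exp_reflect[OF sa[OF x] sa[OF selfadj_simps(1)] False] .
        then have "c' * e (x + x) * c' = (c' * e x * c') * (c' * e x * c')" by (simp add: mult.assoc)
        then show "exp (\<beta> *\<^sub>R T (x + x)) = exp (\<beta> *\<^sub>R (T x + T x))"
          unfolding eT[OF selfadj_intros(1)[OF x x]] scaleR_add_right
          by (simp add: exp_add_commuting eT[OF x])
      qed
    qed
    moreover have "exp (\<beta> *\<^sub>R L x) = exp X * exp (\<beta> *\<^sub>R T x) * exp X" if "selfadj x" for x
      unfolding eT[OF that] c_def[symmetric] cec by (simp add: e_def)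
    ultimately show thesis using X T_le False by (intro that[of X T]) auto
  qed
qed

section \<open>Translation of the hypotheses into logarithmic coordinates\<close>

lemma cfc_power_function:
  fixes x :: "'a::cstar_algebra"
  assumes "selfadj x" "\<And>t. t > 0 \<Longrightarrow> f t = t powr \<alpha>"
  shows "cfc f (exp x) = exp (\<alpha> *\<^sub>R x)"
  using cfc_cong[of "exp x" f "\<lambda>t. t powr \<alpha>"] cfc_powr_exp[OF assms(1)] assms(2)
    rspec_pos_inv[OF pos_inv_exp[OF assms(1)]] by auto

lemma cfc_log_function:
  fixes x :: "'a::cstar_algebra"
  assumes "selfadj x" "\<And>t. t > 0 \<Longrightarrow> f t = ln t"
  shows "cfc f (exp x) = x"
  using cfc_cong[of "exp x" f ln] cfc_ln_exp[OF assms(1)] assms(2)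
    rspec_pos_inv[OF pos_inv_exp[OF assms(1)]] by auto

definition power_or_log :: "(real \<Rightarrow> real) \<Rightarrow> real \<Rightarrow> bool" where
  "power_or_log f \<alpha> \<longleftrightarrow> \<alpha> > 0 \<and> (\<forall>t>0. f t = t powr \<alpha>) \<or> \<alpha> = 0 \<and> (\<forall>t>0. f t = ln t)"

lemma power_or_log_nonneg: "power_or_log f \<alpha> \<Longrightarrow> \<alpha> \<ge> 0"
  by (auto simp: power_or_log_def)

lemma cle_cfc_power_or_log:
  fixes x y :: "'a::cstar_algebra"
  assumes "power_or_log f \<alpha>" "selfadj x" "selfadj y"
  shows "cle (cfc f (exp x)) (cfc f (exp y)) \<longleftrightarrow> exp_le \<alpha> x y"
  using assms cfc_power_function[of x f \<alpha>] cfc_power_function[of y f \<alpha>] cfc_log_function[of x f] cfc_log_function[of y f]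
  unfolding power_or_log_def exp_le_def by auto

definition homogeneous_order_iso ::
  "(real \<Rightarrow> real) \<Rightarrow> (real \<Rightarrow> real) \<Rightarrow> ('a::cstar_algebra \<Rightarrow> 'b::cstar_algebra) \<Rightarrow> bool" where
  "homogeneous_order_iso f g \<phi> \<longleftrightarrow> \<phi> ` {A. pos_inv A} = {B. pos_inv B}
    \<and> (\<forall>A t. pos_inv A \<longrightarrow> t > 0 \<longrightarrow> \<phi> (t *\<^sub>R A) = t *\<^sub>R \<phi> A)
    \<and> (\<forall>A B. pos_inv A \<longrightarrow> pos_inv B \<longrightarrow>
          (cle (cfc f A) (cfc f B) \<longleftrightarrow> cle (cfc g (\<phi> A)) (cfc g (\<phi> B))))"

lemma log_coordinates_signed_iso:
  fixes \<phi> :: "'a::cstar_algebra \<Rightarrow> 'b::cstar_algebra"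
  assumes f: "power_or_log f \<alpha>" and g: "power_or_log g \<beta>"
    and \<phi>: "homogeneous_order_iso f g \<phi>"
  shows "signed_iso True {x. selfadj x} (exp_le \<alpha>) translate {y. selfadj y} (exp_le \<beta>) translate
    (\<lambda>x. cfc ln (\<phi> (exp x)))"
proof -
  define L where "L x = cfc ln (\<phi> (exp x))" for x
  have surj: "\<phi> ` {A. pos_inv A} = {B. pos_inv B}"
    and hom: "\<And>A t. pos_inv A \<Longrightarrow> t > 0 \<Longrightarrow> \<phi> (t *\<^sub>R A) = t *\<^sub>R \<phi> A"
    and order: "\<And>A B. pos_inv A \<Longrightarrow> pos_inv B \<Longrightarrow>
                  cle (cfc f A) (cfc f B) \<longleftrightarrow> cle (cfc g (\<phi> A)) (cfc g (\<phi> B))"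
    using \<phi> unfolding homogeneous_order_iso_def by blast+
  have p: "pos_inv (\<phi> (exp x))" if "selfadj x" for x using surj pos_inv_exp[OF that] by blast
  have sa: "selfadj (L x)" if "selfadj x" for x unfolding L_def using selfadj_ln[OF p[OF that]] .
  have eL: "exp (L x) = \<phi> (exp x)" if "selfadj x" for x unfolding L_def using exp_ln_pos_inv[OF p[OF that]] .
  have le: "exp_le \<alpha> x y \<longleftrightarrow> exp_le \<beta> (L x) (L y)" if "selfadj x" "selfadj y" for x y
    using order[OF pos_inv_exp[OF that(1)] pos_inv_exp[OF that(2)]] cle_cfc_power_or_log[OF f that]
      cle_cfc_power_or_log[OF g sa[OF that(1)] sa[OF that(2)]] eL that by simp
  have tr: "L (translate s x) = translate s (L x)" if "selfadj x" for x s
  proof (rule exp_inj_selfadj[OF sa[OF selfadj_translate[OF that]] selfadj_translate[OF sa[OF that]]])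
    have e: "exp (translate s z) = exp s *\<^sub>R exp z" for z :: "'c::cstar_algebra"
      using exp_scaleR_add_of_real[of 1 z s] by (simp add: translate_def)
    have "\<phi> (exp (translate s x)) = exp s *\<^sub>R \<phi> (exp x)"
      unfolding e by (rule hom[OF pos_inv_exp[OF that] exp_gt_zero])
    then show "exp (L (translate s x)) = exp (translate s (L x))"
      using eL that selfadj_translate[OF that] by (simp add: e)
  qed
  interpret A: reflection_space "{x::'a. selfadj x}" "exp_le \<alpha>" translate "exp_reflect \<alpha>"
    by (rule reflection_space_exp_le[OF power_or_log_nonneg[OF f]])
  interpret B: reflection_space "{x::'b. selfadj x}" "exp_le \<beta>" translate "exp_reflect \<beta>"
    by (rule reflection_space_exp_le[OF power_or_log_nonneg[OF g]])
  have "bij_betw L {x. selfadj x} {y. selfadj y}"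
    unfolding bij_betw_def
  proof (intro conjI inj_onI equalityI subsetI)
    fix x y assume xy: "x \<in> {x. selfadj x}" "y \<in> {x. selfadj x}" "L x = L y"
    \<comment> \<open>Injectivity comes from the order: equal images are comparable both ways by
      reflexivity, here translation by 0, and the equivalence pulls both relations back.\<close>
    then have "exp_le \<beta> (L x) (L y)" "exp_le \<beta> (L y) (L x)"
      using B.tr_le[of "L y" 0] B.tr_0[of "L y"] sa[of y] by auto
    then show "x = y" using A.antisym le xy by auto
  next
    fix y :: 'b assume "y \<in> {y. selfadj y}"
    then have y: "selfadj y" by simp
    have "exp y \<in> \<phi> ` {A. pos_inv A}" using surj pos_inv_exp[OF y] by simp
    then obtain a where a: "pos_inv a" "\<phi> a = exp y" by auto
    have "L (cfc ln a) = y" unfolding L_def exp_ln_pos_inv[OF a(1)] a(2) using cfc_ln_exp[OF y] .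
    then show "y \<in> L ` {x. selfadj x}" using selfadj_ln[OF a(1)] by blast
  qed (use sa in auto)
  then show ?thesis using le tr unfolding signed_iso_def L_def by auto
qed

lemma order_maps_structure:
  fixes \<phi> :: "'a::cstar_algebra \<Rightarrow> 'b::cstar_algebra"
  assumes f: "power_or_log f \<alpha>" and g: "power_or_log g \<beta>"
    and \<phi>: "homogeneous_order_iso f g \<phi>"
  obtains X J L where "selfadj X" "jordan_star_iso J"
    "\<And>x. selfadj x \<Longrightarrow> selfadj (J x)" "\<And>x. selfadj x \<Longrightarrow> J (exp x) = exp (J x)"
    "\<And>r x. selfadj x \<Longrightarrow> J (r *\<^sub>R x) = r *\<^sub>R J x"
    "\<And>x. selfadj x \<Longrightarrow> selfadj (L x)" "\<And>x. selfadj x \<Longrightarrow> \<phi> (exp x) = exp (L x)"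
    "\<And>x. selfadj x \<Longrightarrow> \<beta> = 0 \<Longrightarrow> L x = J x + X"
    "\<And>x. selfadj x \<Longrightarrow> \<beta> > 0 \<Longrightarrow> exp (\<beta> *\<^sub>R L x) = exp X * exp (\<beta> *\<^sub>R J x) * exp X"
    "\<alpha> \<noteq> \<beta> \<Longrightarrow> commutative_alg TYPE('a) \<and> commutative_alg TYPE('b)"
proof -
  define L where "L x = cfc ln (\<phi> (exp x))" for x
  have p: "pos_inv (\<phi> (exp x))" if "selfadj x" for x using \<phi> pos_inv_exp[OF that] by (auto simp: homogeneous_order_iso_def)
  have saL: "selfadj (L x)" if "selfadj x" for x unfolding L_def using selfadj_ln[OF p[OF that]] .
  have eL: "exp (L x) = \<phi> (exp x)" if "selfadj x" for x unfolding L_def using exp_ln_pos_inv[OF p[OF that]] .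
  have iso: "signed_iso True {x. selfadj x} (exp_le \<alpha>) translate {y. selfadj y} (exp_le \<beta>) translate L"
    unfolding L_def by (rule log_coordinates_signed_iso[OF assms])
  have ab: "\<alpha> \<ge> 0" "\<beta> \<ge> 0" using f g power_or_log_nonneg by auto
  obtain X T where XT: "selfadj X" "selfadj_order_iso T"
    "\<And>x y. selfadj x \<Longrightarrow> selfadj y \<Longrightarrow> exp_le \<alpha> x y \<longleftrightarrow> exp_le \<beta> (T x) (T y)"
    "\<And>x. selfadj x \<Longrightarrow> \<beta> = 0 \<Longrightarrow> L x = T x + X"
    "\<And>x. selfadj x \<Longrightarrow> \<beta> > 0 \<Longrightarrow> exp (\<beta> *\<^sub>R L x) = exp X * exp (\<beta> *\<^sub>R T x) * exp X"
    using exp_order_iso_structure[OF ab iso] by blast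
  interpret selfadj_order_iso T by fact
  have same: "exp_le \<alpha> x y \<longleftrightarrow> exp_le \<beta> x y" if "selfadj x" "selfadj y" for x y :: 'a
    using XT(3)[OF that] exp_le_T_iff[OF that] by simp
  have same': "exp_le \<alpha> x y \<longleftrightarrow> exp_le \<beta> x y" if "selfadj x" "selfadj y" for x y :: 'b
  proof -
    have "x \<in> T ` {x. selfadj x}" "y \<in> T ` {x. selfadj x}" using bij that by (auto simp: bij_betw_def)
    then obtain u v where uv: "selfadj u" "selfadj v" "x = T u" "y = T v" by auto
    show ?thesis unfolding uv exp_le_T_iff[OF uv(1,2)] by (rule same[OF uv(1,2)])
  qed
  have comm: "commutative_alg TYPE('a) \<and> commutative_alg TYPE('b)" if "\<alpha> \<noteq> \<beta>"
  proof (cases "\<alpha> < \<beta>")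
    case True
    show ?thesis
      using commutative_if_exp_le_eq[OF ab(1) True same] commutative_if_exp_le_eq[OF ab(1) True same'] by blast
  next
    case False
    then have "\<beta> < \<alpha>" using that by simp
    then show ?thesis
      using commutative_if_exp_le_eq[OF ab(2) _ same[symmetric]] commutative_if_exp_le_eq[OF ab(2) _ same'[symmetric]]
      by blast
  qed
  show thesis
    by (rule that[of X extension L])
      (simp_all add: XT jordan_star_iso_extension extension_selfadj selfadj_T selfadj_exp T_exp T_scaleR
        selfadj_intros saL eL comm)
qed

text \<open>In a commutative algebra the congruence by exp X adds 2 X to the exponent \<beta> y,
  whence the shift (2 / \<beta>) X.\<close>

lemma commutative_exp_multiple:
  fixes X y z :: "'a::cstar_algebra"
  assumes comm: "commutative_alg TYPE('a)" and b: "\<beta> > 0"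
    and sa: "selfadj X" "selfadj y" "selfadj z"
    and eq: "exp (\<beta> *\<^sub>R z) = exp X * exp (\<beta> *\<^sub>R y) * exp X"
  shows "z = y + (2 / \<beta>) *\<^sub>R X"
proof -
  have c: "u * v = v * u" for u v :: 'a using comm by (simp add: commutative_alg_def)
  have "exp X * exp (\<beta> *\<^sub>R y) * exp X = exp (\<beta> *\<^sub>R (y + (2 / \<beta>) *\<^sub>R X))"
    using b by (simp add: exp_add_commuting[OF c, symmetric] algebra_simps scaleR_2)
  then have "\<beta> *\<^sub>R z = \<beta> *\<^sub>R (y + (2 / \<beta>) *\<^sub>R X)"
    using eq sa by (intro exp_inj_selfadj[of "\<beta> *\<^sub>R z"] selfadj_intros) auto
  then show ?thesis using b by simp
qed

theorem theorem17:
  fixes f g :: "real \<Rightarrow> real"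
    and \<phi> :: "'a::cstar_algebra \<Rightarrow> 'b::cstar_algebra"
  assumes f_kind: "is_power_fun f \<or> is_log_fun f"
    and g_kind: "is_power_fun g \<or> is_log_fun g"
    and maps_into: "\<And>A. pos_inv A \<Longrightarrow> pos_inv (\<phi> A)"
    and surj: "\<And>B. pos_inv B \<Longrightarrow> \<exists>A. pos_inv A \<and> \<phi> A = B"
    and hom: "\<And>A t. pos_inv A \<Longrightarrow> t > 0 \<Longrightarrow> \<phi> (t *\<^sub>R A) = t *\<^sub>R \<phi> A"
    and order: "\<And>A B. pos_inv A \<Longrightarrow> pos_inv B \<Longrightarrow>
                  cle (cfc f A) (cfc f B) \<longleftrightarrow> cle (cfc g (\<phi> A)) (cfc g (\<phi> B))"
  shows
    "(is_power_fun f \<and> is_power_fun g \<and> (\<forall>t>0. f t = g t) \<longrightarrow>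
        (\<exists>C J. pos_inv C \<and> jordan_star_iso J \<and>
           (\<forall>A. pos_inv A \<longrightarrow>
              \<phi> A = cfc (the_inv_into {0<..} f) (C * J (cfc f A) * C))))
     \<and> (is_power_fun f \<and> is_power_fun g \<and> \<not> (\<forall>t>0. f t = g t) \<longrightarrow>
        commutative_alg TYPE('a) \<and> commutative_alg TYPE('b) \<and>
        (\<exists>C J. pos_inv C \<and> algebra_star_iso J \<and> (\<forall>A. pos_inv A \<longrightarrow> \<phi> A = C * J A)))
     \<and> (is_log_fun f \<and> is_log_fun g \<longrightarrow>
        (\<exists>J X0. jordan_star_iso J \<and> selfadj X0 \<and>
           (\<forall>A. pos_inv A \<longrightarrow> \<phi> A = cfc exp (J (cfc ln A) + X0))))
     \<and> (is_power_fun f \<and> is_log_fun g \<longrightarrow>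
        commutative_alg TYPE('a) \<and> commutative_alg TYPE('b) \<and>
        (\<exists>C J. pos_inv C \<and> algebra_star_iso J \<and> (\<forall>A. pos_inv A \<longrightarrow> \<phi> A = C * J A)))"
proof -
  have \<phi>: "homogeneous_order_iso f g \<phi>"
    unfolding homogeneous_order_iso_def using maps_into surj hom order by blast
  have power: "\<exists>\<alpha>>0. power_or_log f \<alpha> \<and> (\<forall>t>0. f t = t powr \<alpha>)" if "is_power_fun f" for f
    using that by (auto simp: is_power_fun_def power_or_log_def)
  have log: "power_or_log f 0" if "is_log_fun f" for f
    using that by (auto simp: is_log_fun_def power_or_log_def)
  \<comment> \<open>Serves (c2) and (c4) alike: both are instances of different exponents, the
    logarithm counting as exponent 0.\<close>
  have commutative: "commutative_alg TYPE('a) \<and> commutative_alg TYPE('b) \<and>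
        (\<exists>C J. pos_inv C \<and> algebra_star_iso J \<and> (\<forall>A. pos_inv A \<longrightarrow> \<phi> A = C * J A))"
    if f: "power_or_log f \<alpha>" and g: "power_or_log g \<beta>" and ne: "\<alpha> \<noteq> \<beta>" for \<alpha> \<beta>
  proof -
    obtain X J L where J: "selfadj X" "jordan_star_iso J"
      "\<And>x. selfadj x \<Longrightarrow> selfadj (J x)" "\<And>x. selfadj x \<Longrightarrow> J (exp x) = exp (J x)"
      "\<And>r x. selfadj x \<Longrightarrow> J (r *\<^sub>R x) = r *\<^sub>R J x"
      "\<And>x. selfadj x \<Longrightarrow> selfadj (L x)" "\<And>x. selfadj x \<Longrightarrow> \<phi> (exp x) = exp (L x)"
      "\<And>x. selfadj x \<Longrightarrow> \<beta> = 0 \<Longrightarrow> L x = J x + X"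
      "\<And>x. selfadj x \<Longrightarrow> \<beta> > 0 \<Longrightarrow> exp (\<beta> *\<^sub>R L x) = exp X * exp (\<beta> *\<^sub>R J x) * exp X"
      "\<alpha> \<noteq> \<beta> \<Longrightarrow> commutative_alg TYPE('a) \<and> commutative_alg TYPE('b)"
      by (rule order_maps_structure[OF f g \<phi>]) blast
    have comm: "commutative_alg TYPE('a)" "commutative_alg TYPE('b)" using J(10) ne by auto
    \<comment> \<open>The total shift in logarithmic coordinates, whether the normalization was
      additive or by congruence; C is its exponential.\<close>
    define Y where "Y = (if \<beta> = 0 then X else (2 / \<beta>) *\<^sub>R X)"
    have L: "L x = J x + Y" if "selfadj x" for x
      using J(8)[OF that] commutative_exp_multiple[OF comm(2) _ J(1) J(3)[OF that] J(6)[OF that] J(9)[OF that]]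
        power_or_log_nonneg[OF g] by (cases "\<beta> = 0") (auto simp: Y_def)
    have comm': "u * v = v * u" for u v :: 'b using comm(2) by (simp add: commutative_alg_def)
    have "\<phi> A = exp Y * J A" if A: "pos_inv A" for A
    proof -
      obtain x where x: "selfadj x" "A = exp x" using A by (rule pos_inv_expE)
      show ?thesis unfolding x(2) J(7)[OF x(1)] L[OF x(1)] J(4)[OF x(1)]
        using exp_add_commuting[OF comm'] comm' by metis
    qed
    moreover have "pos_inv (exp Y)" unfolding Y_def using J(1) by (auto intro: pos_inv_exp selfadj_intros)
    ultimately show ?thesis using comm algebra_star_iso_if_commutative[OF J(2) comm] by blast
  qed
  show ?thesis
  proof (intro conjI impI)
    assume asm: "is_power_fun f \<and> is_power_fun g \<and> (\<forall>t>0. f t = g t)"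
    obtain \<alpha> where \<alpha>: "\<alpha> > 0" "power_or_log f \<alpha>" "\<And>t. t > 0 \<Longrightarrow> f t = t powr \<alpha>" using power asm by blast
    then have g: "power_or_log g \<alpha>" using asm by (auto simp: power_or_log_def)
    obtain X J L where J: "selfadj X" "jordan_star_iso J"
      "\<And>x. selfadj x \<Longrightarrow> selfadj (J x)" "\<And>x. selfadj x \<Longrightarrow> J (exp x) = exp (J x)"
      "\<And>r x. selfadj x \<Longrightarrow> J (r *\<^sub>R x) = r *\<^sub>R J x"
      "\<And>x. selfadj x \<Longrightarrow> selfadj (L x)" "\<And>x. selfadj x \<Longrightarrow> \<phi> (exp x) = exp (L x)"
      "\<And>x. selfadj x \<Longrightarrow> \<alpha> = 0 \<Longrightarrow> L x = J x + X"
      "\<And>x. selfadj x \<Longrightarrow> \<alpha> > 0 \<Longrightarrow> exp (\<alpha> *\<^sub>R L x) = exp X * exp (\<alpha> *\<^sub>R J x) * exp X"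
      "\<alpha> \<noteq> \<alpha> \<Longrightarrow> commutative_alg TYPE('a) \<and> commutative_alg TYPE('b)"
      by (rule order_maps_structure[OF \<alpha>(2) g \<phi>]) blast
    \<comment> \<open>Since f is prescribed only for positive arguments, its inverse is identified
      with the power 1 / \<alpha> only there. This suffices because the spectrum of a positive
      invertible element lies in the positive reals.\<close>
    have inv: "the_inv_into {0<..} f t = t powr (1 / \<alpha>)" if "t > 0" for t
    proof (rule the_inv_into_f_eq)
      show "inj_on f {0<..}"
        by (rule inj_on_inverseI[where g = "\<lambda>s. s powr (1 / \<alpha>)"]) (use \<alpha> in \<open>simp add: powr_powr\<close>)
      show "f (t powr (1 / \<alpha>)) = t" using that \<alpha> by (simp add: powr_powr)
    qed (use that in auto)
    have "\<phi> A = cfc (the_inv_into {0<..} f) (exp X * J (cfc f A) * exp X)" if A: "pos_inv A" for A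
    proof -
      obtain x where x: "selfadj x" "A = exp x" using A by (rule pos_inv_expE)
      have cfc: "cfc f (exp x) = exp (\<alpha> *\<^sub>R x)" by (rule cfc_power_function[OF x(1) \<alpha>(3)])
      have "exp X * J (cfc f A) * exp X = exp X * exp (\<alpha> *\<^sub>R J x) * exp X"
        unfolding x(2) cfc using J(4)[of "\<alpha> *\<^sub>R x"] J(5)[OF x(1)] x(1)
        by (simp add: selfadj_intros)
      also have "\<dots> = exp (\<alpha> *\<^sub>R L x)" using J(9)[OF x(1) \<alpha>(1)] by simp
      also have "cfc (the_inv_into {0<..} f) \<dots> = exp ((1 / \<alpha>) *\<^sub>R (\<alpha> *\<^sub>R L x))"
        using J(6)[OF x(1)] by (intro cfc_power_function inv selfadj_intros)
      finally show ?thesis using \<alpha>(1) J(7)[OF x(1)] x(2) by simp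
    qed
    then show "\<exists>C J. pos_inv C \<and> jordan_star_iso J \<and>
           (\<forall>A. pos_inv A \<longrightarrow> \<phi> A = cfc (the_inv_into {0<..} f) (C * J (cfc f A) * C))"
      using pos_inv_exp[OF J(1)] J(2) by blast
  next
    assume asm: "is_power_fun f \<and> is_power_fun g \<and> \<not> (\<forall>t>0. f t = g t)"
    obtain \<alpha> \<beta> where "power_or_log f \<alpha>" "\<forall>t>0. f t = t powr \<alpha>" "power_or_log g \<beta>" "\<forall>t>0. g t = t powr \<beta>"
      using power asm by meson
    moreover from this have "\<alpha> \<noteq> \<beta>" using asm by auto
    ultimately show "commutative_alg TYPE('a)" "commutative_alg TYPE('b)"
      "\<exists>C J. pos_inv C \<and> algebra_star_iso J \<and> (\<forall>A. pos_inv A \<longrightarrow> \<phi> A = C * J A)"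
      using commutative by blast+
  next
    assume asm: "is_power_fun f \<and> is_log_fun g"
    then obtain \<alpha> where "\<alpha> > 0" "power_or_log f \<alpha>" "power_or_log g 0" using power log by blast
    then show "commutative_alg TYPE('a)" "commutative_alg TYPE('b)"
      "\<exists>C J. pos_inv C \<and> algebra_star_iso J \<and> (\<forall>A. pos_inv A \<longrightarrow> \<phi> A = C * J A)"
      using commutative[of \<alpha> 0] by auto
  next
    assume asm: "is_log_fun f \<and> is_log_fun g"
    then have fg: "power_or_log f 0" "power_or_log g 0" using log by auto
    obtain X J L where J: "selfadj X" "jordan_star_iso J"
      "\<And>x. selfadj x \<Longrightarrow> selfadj (J x)" "\<And>x. selfadj x \<Longrightarrow> J (exp x) = exp (J x)"
      "\<And>r x. selfadj x \<Longrightarrow> J (r *\<^sub>R x) = r *\<^sub>R J x"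
      "\<And>x. selfadj x \<Longrightarrow> selfadj (L x)" "\<And>x. selfadj x \<Longrightarrow> \<phi> (exp x) = exp (L x)"
      "\<And>x. selfadj x \<Longrightarrow> (0::real) = 0 \<Longrightarrow> L x = J x + X"
      "\<And>x. selfadj x \<Longrightarrow> (0::real) > 0 \<Longrightarrow> exp ((0::real) *\<^sub>R L x) = exp X * exp ((0::real) *\<^sub>R J x) * exp X"
      "(0::real) \<noteq> (0::real) \<Longrightarrow> commutative_alg TYPE('a) \<and> commutative_alg TYPE('b)"
      by (rule order_maps_structure[OF fg \<phi>]) blast
    have "\<phi> A = cfc exp (J (cfc ln A) + X)" if "pos_inv A" for A
    proof -
      have sa: "selfadj (cfc ln A)" "exp (cfc ln A) = A" using selfadj_ln[OF that] exp_ln_pos_inv[OF that] .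
      show ?thesis
        using J(7)[OF sa(1)] J(8)[OF sa(1) refl] sa(2) cfc_exp[OF selfadj_intros(1)[OF J(3)[OF sa(1)] J(1)]] by simp
    qed
    then show "\<exists>J X0. jordan_star_iso J \<and> selfadj X0 \<and> (\<forall>A. pos_inv A \<longrightarrow> \<phi> A = cfc exp (J (cfc ln A) + X0))"
      using J(1,2) by blast
  qed
qed

end
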